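(* Let $A\in\mathbb{R}^{n\times d}$, $C\in\mathbb{R}^{n\times d_C}$, $U\in\mathbb{R}^{n_R\times d_C}$ and $R\in\mathbb{R}^{n_R\times d}$ be given matrices, and let $k$ be an integer with $1\le k\le \mathrm{rank}(U)$. Then there exist a $k$-subset $\widehat S\subset[n_R]$ and a $k$-subset $\widehat W\subset[d_C]$ such that $U_{\widehat S,\widehat W}\in\mathbb{R}^{k\times k}$ is invertible and $$\mathrm{minroot}\ p_{\widehat S,\widehat W}(x;A,C,U,R)\ \ge\ \mathrm{minroot}\ P_k(x;A,C,U,R).$$ Consequently, $$\big\|A-C_{:,\widehat W}(U_{\widehat S,\widehat W})^{-1}R_{\widehat S,:}\big\|_2^2\ \le\ \mathrm{maxroot}\ P_k(-x;A,C,U,R).$$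
   Context: Notation: $[m]=\{1,\dots,m\}$; $\binom{[m]}{k}$ is the set of $k$-element subsets ($k$-subsets) of $[m]$. For a matrix $M$, $M_{S,W}$ is the submatrix with rows indexed by $S$ and columns indexed by $W$; $M_{:,W}$ keeps all rows and $M_{S,:}$ keeps all columns. $\|\cdot\|_2$ is the spectral norm. $\mathrm{minroot}\,f$ and $\mathrm{maxroot}\,f$ denote the smallest and largest root of a real-rooted polynomial $f$ in $x$. For $A\in\mathbb{R}^{n\times d}$, $C\in\mathbb{R}^{n\times d_C}$, $U\in\mathbb{R}^{n_R\times d_C}$, $R\in\mathbb{R}^{n_R\times d}$, an integer $0\le k\le\mathrm{rank}(U)$, and $S\in\binom{[n_R]}{k}$, $W\in\binom{[d_C]}{k}$, define $$p_{S,W}(x;A,C,U,R):=(-1)^{d-k}\det\begin{bmatrix} I_n & 0 & C_{:,W} & A\\ 0 & 0 & U_{S,W} & R_{S,:}\\ (C_{:,W})^T & (U_{S,W})^T & 0 & 0\\ A^T & (R_{S,:})^T & 0 & -x I_d\end{bmatrix},$$ $$P_k(x;A,C,U,R):=\sum_{S\in\binom{[n_R]}{k},\,W\in\binom{[d_C]}{k}}p_{S,W}(x;A,C,U,R).$$ $P_k(-x;\cdot)$ denotes the polynomial obtained by replacing $x$ with $-x$. *)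

theory Defs
  imports
    "Jordan_Normal_Form.DL_Rank_Submatrix"
    "Jordan_Normal_Form.Gauss_Jordan_Elimination"
    "Jordan_Normal_Form.Char_Poly"
begin

text \<open>
  Indices are 0-based: the index set of size \<open>m\<close> is \<open>{..<m}\<close>.  For such \<open>S\<close> and \<open>W\<close>,
  \<open>submatrix M S W\<close> lists the selected rows and columns in increasing order of their
  indices; \<open>UNIV\<close> in either place keeps all rows resp. all columns.
\<close>

definition ksubsets :: "nat \<Rightarrow> nat \<Rightarrow> nat set set" where
  "ksubsets m k = {S. S \<subseteq> {..<m} \<and> card S = k}"

definition spectral_norm :: "real mat \<Rightarrow> real" where
  "spectral_norm M =
     Sup {sqrt ((M *\<^sub>v v) \<bullet> (M *\<^sub>v v)) | v. v \<in> carrier_vec (dim_col M) \<and> v \<bullet> v \<le> 1}"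

definition real_rooted :: "real poly \<Rightarrow> bool" where
  "real_rooted f \<longleftrightarrow>
     f \<noteq> 0 \<and> (\<forall>z::complex. poly (map_poly complex_of_real f) z = 0 \<longrightarrow> z \<in> \<real>)"

text \<open>
  \<open>minroot\<close> and \<open>maxroot\<close> are meaningful only for real-rooted polynomials of positive degree;
  on a polynomial without real roots their value is unspecified.
\<close>

definition minroot :: "real poly \<Rightarrow> real" where
  "minroot f = Min {x. poly f x = 0}"

definition maxroot :: "real poly \<Rightarrow> real" where
  "maxroot f = Max {x. poly f x = 0}"

abbreviation const_mat :: "real mat \<Rightarrow> real poly mat" where
  "const_mat \<equiv> map_mat (\<lambda>a. [:a:])"

text \<open>
  The 4-by-4 block matrix, with block rows of heights \<open>n, k, k, d\<close> (and block columns of the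
  same widths), as a 2-by-2 arrangement of 2-by-2 block matrices; the variable of the
  polynomials is \<open>x\<close>.
\<close>

definition cur_block_mat ::
    "nat set \<Rightarrow> nat set \<Rightarrow> real mat \<Rightarrow> real mat \<Rightarrow> real mat \<Rightarrow> real mat \<Rightarrow> real poly mat" where
  "cur_block_mat S W A C U R =
     (let n = dim_row A; d = dim_col A; k = card S;
          CW = const_mat (submatrix C UNIV W);
          USW = const_mat (submatrix U S W);
          RS = const_mat (submatrix R S UNIV);
          A' = const_mat A
      in four_block_mat
           (four_block_mat (1\<^sub>m n) (0\<^sub>m n k)
                           (0\<^sub>m k n) (0\<^sub>m k k))
           (four_block_mat CW A'
                           USW RS)
           (four_block_mat (transpose_mat CW) (transpose_mat USW)
                           (transpose_mat A') (transpose_mat RS))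
           (four_block_mat (0\<^sub>m k k) (0\<^sub>m k d)
                           (0\<^sub>m d k) ([:0, -1:] \<cdot>\<^sub>m 1\<^sub>m d)))"

text \<open>The sign uses an integer exponent because \<open>k\<close> may exceed \<open>d\<close>.\<close>

definition cur_poly ::
    "nat set \<Rightarrow> nat set \<Rightarrow> real mat \<Rightarrow> real mat \<Rightarrow> real mat \<Rightarrow> real mat \<Rightarrow> real poly" where
  "cur_poly S W A C U R =
     smult ((-1) powi (int (dim_col A) - int (card S))) (det (cur_block_mat S W A C U R))"

definition cur_sum_poly ::
    "nat \<Rightarrow> real mat \<Rightarrow> real mat \<Rightarrow> real mat \<Rightarrow> real mat \<Rightarrow> real poly" where
  "cur_sum_poly k A C U R =
     (\<Sum>S\<in>ksubsets (dim_row U) k. \<Sum>W\<in>ksubsets (dim_col U) k. cur_poly S W A C U R)"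

end

theory Submission
  imports Defs "HOL-Computational_Algebra.Fundamental_Theorem_Algebra"
begin

text \<open>
  Up to sign, every \<open>cur_poly S W A C U R\<close> is a principal minor of one fixed symmetric pencil
  \<open>H - x D\<close>: the minor on the rows of \<open>A\<close>, the chosen rows \<open>S\<close> of \<open>U\<close>, the chosen columns \<open>W\<close> of
  \<open>U\<close> and the columns of \<open>A\<close>, where \<open>D\<close> is the diagonal projection onto the last block.  So
  \<open>cur_sum_poly\<close> is, up to sign, the sum of the principal minors in which prescribed numbers of
  indices are removed from two blocks of the index set.

  Such a sum is a coefficient of the two-variable polynomial obtained by adding \<open>y\<close> and \<open>z\<close> to the
  diagonal entries of these blocks.  If the Hermitian part of a matrix is positive definite (the
  matrix is accretive), then its determinant is nonzero, and this persists when numbers with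
  nonnegative real part are added to the diagonal.  By the theorem of Gauss and Lucas no
  coefficient of such a polynomial up to its degree vanishes (\<open>sum_sum_minors_nonzero\<close>).  For nonreal \<open>x\<close> the
  matrix \<open>H - x D\<close>, after a small diagonal perturbation and multiplication by \<open>\<plusminus> \<i>\<close>, is accretive.
  Letting the perturbation tend to zero shows that the sum of minors vanishes identically or is
  real-rooted (\<open>sum_sum_pdet_real_rooted\<close>).  The same reasoning in the right half-plane shows that
  one signed minor is nonnegative for \<open>x > 0\<close>, and vanishes there only if it is zero
  (\<open>poly_pdet_nonneg\<close>, \<open>pdet_eq_0_if_positive_root\<close>).

  The sum is then split, index by index, into the minors that contain the index and those that do
  not.  Scaling the row and the column of that index gives the first part any positive weight
  relative to the second, so all positive combinations of the two parts are real-rooted.  A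
  real-rooted polynomial has no strict local minimum with a positive value, and this forces one of the two parts to have
  no root to the left of the smallest root of the sum (\<open>no_root_below_summand\<close>).  A part whose degree
  drops counts as having a root at minus infinity, which is why the roots are compared after the
  substitution \<open>x = 1 / u\<close>.  When all indices have been decided, one pair \<open>S\<close>, \<open>W\<close> remains
  (\<open>select_pdet\<close>).  Its polynomial has full degree \<open>d\<close>, which says exactly that the submatrix of
  \<open>U\<close> on \<open>S\<close> and \<open>W\<close> is nonsingular (\<open>coeff_cur_poly_nonzero_iff\<close>).  The rank assumption provides a
  nonsingular minor, so the sum itself has full degree and the selection can start.

  The norm bound follows because each eigenvalue \<open>t\<close> of \<open>E\<^sup>T E\<close>, for the residual
  \<open>E = A - C\<^sub>W (U\<^sub>S\<^sub>W)\<^sup>-\<^sup>1 R\<^sub>S\<close>, gives the root \<open>- t\<close> of the selected polynomial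
  (\<open>cur_poly_root_of_eigenvalue\<close>), and the square of the norm is at most the maximum of the Rayleigh
  quotient, which is such an eigenvalue (\<open>spectral_norm_le\<close>).
\<close>


section \<open>Determinants over finite index sets\<close>

text \<open>The Leibniz determinant over an arbitrary finite index set.  Principal minors are then
  determinants of the same function on a smaller set, without any renumbering of rows and columns.\<close>

definition idet :: "'i set \<Rightarrow> ('i \<Rightarrow> 'i \<Rightarrow> 'a::comm_ring_1) \<Rightarrow> 'a" where
  "idet I f = (\<Sum>p | p permutes I. of_int (sign p) * (\<Prod>i\<in>I. f i (p i)))"

lemma idet_cong:
  assumes "\<And>i j. i \<in> I \<Longrightarrow> j \<in> I \<Longrightarrow> f i j = g i j"
  shows "idet I f = idet I g"
  unfolding idet_def
  by (intro sum.cong refl arg_cong2[of _ _ _ _ "(*)"] prod.cong)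
     (auto simp: permutes_in_image assms)

lemma idet_empty [simp]: "idet {} f = 1"
  by (simp add: idet_def)

text \<open>Conjugating the permutations with the bijection preserves their signs.\<close>

lemma idet_reindex:
  assumes h: "bij_betw h A B" and fin: "finite A"
  shows "idet B f = idet A (\<lambda>i j. f (h i) (h j))"
proof -
  have inj: "inj_on h A" and B: "B = h ` A"
    using h by (auto simp: bij_betw_def)
  let ?m = "map_permutation A h"
  have bij: "bij_betw ?m {p. p permutes A} {p. p permutes B}"
  proof (rule bij_betw_byWitness[where f' = "map_permutation B (inv_into A h)"])
    have h': "bij_betw (inv_into A h) B A"
      by (rule bij_betw_inv_into[OF h])
    show "\<forall>p\<in>{p. p permutes A}. map_permutation B (inv_into A h) (?m p) = p"
      using map_permutation_compose_inv[OF h] inv_into_f_f[OF inj] by auto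
    show "\<forall>p\<in>{p. p permutes B}. ?m (map_permutation B (inv_into A h) p) = p"
      using map_permutation_compose_inv[OF h', where g = h] by (auto simp: B f_inv_into_f)
    show "?m ` {p. p permutes A} \<subseteq> {p. p permutes B}"
      using map_permutation_permutes[OF h] by auto
    show "map_permutation B (inv_into A h) ` {p. p permutes B} \<subseteq> {p. p permutes A}"
      using map_permutation_permutes[OF h'] by auto
  qed
  have "idet B f = (\<Sum>p | p permutes A. of_int (sign (?m p)) * (\<Prod>i\<in>B. f i (?m p i)))"
    unfolding idet_def by (rule sum.reindex_bij_betw[OF bij, symmetric])
  also have "\<dots> = idet A (\<lambda>i j. f (h i) (h j))"
    unfolding idet_def
  proof (rule sum.cong[OF refl])
    fix p assume "p \<in> {p. p permutes A}"
    then have p: "p permutes A" by simp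
    have "(\<Prod>i\<in>B. f i (?m p i)) = (\<Prod>i\<in>A. f (h i) (?m p (h i)))"
      using prod.reindex_bij_betw[OF h, of "\<lambda>i. f i (?m p i)"] by simp
    also have "\<dots> = (\<Prod>i\<in>A. f (h i) (h (p i)))"
      by (rule prod.cong) (auto simp: map_permutation_apply[OF inj])
    finally show "of_int (sign (?m p)) * (\<Prod>i\<in>B. f i (?m p i)) =
        of_int (sign p) * (\<Prod>i\<in>A. f (h i) (h (p i)))"
      using sign_map_permutation[OF inj p fin] by simp
  qed
  finally show ?thesis .
qed

lemma det_eq_idet:
  assumes "M \<in> carrier_mat n n"
  shows "det M = idet {..<n} (\<lambda>i j. M $$ (i, j))"
  using assms by (auto simp: det_def idet_def atLeast0LessThan)

text \<open>An enumeration of the index set reduces this to the criterion for ordinary matrices.\<close>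

lemma idet_eq_0_iff_kernel:
  fixes f :: "'i \<Rightarrow> 'i \<Rightarrow> 'a::field"
  assumes fin: "finite I"
  shows "idet I f = 0 \<longleftrightarrow> (\<exists>v. (\<exists>i\<in>I. v i \<noteq> 0) \<and> (\<forall>i\<in>I. (\<Sum>j\<in>I. f i j * v j) = 0))"
proof -
  define n where "n = card I"
  obtain h where h: "bij_betw h {..<n} I"
    using fin unfolding n_def by (metis atLeast0LessThan ex_bij_betw_nat_finite)
  define g where "g = inv_into {..<n} h"
  have gh: "g (h i) = i" if "i < n" for i
    using h that by (simp add: g_def bij_betw_def)
  have hI: "h i \<in> I" if "i < n" for i
    using h that by (auto simp: bij_betw_def)
  have Ih: "\<exists>k<n. i = h k" if "i \<in> I" for i
    using h that by (auto simp: bij_betw_def)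
  define M where "M = mat n n (\<lambda>(i, j). f (h i) (h j))"
  have M: "M \<in> carrier_mat n n" by (simp add: M_def)
  have "idet I f = det M"
    by (simp add: idet_reindex[OF h] det_eq_idet[OF M]) (rule idet_cong, simp add: M_def)
  have ent: "(M *\<^sub>v v) $ i = (\<Sum>j\<in>I. f (h i) j * v $ (g j))" if "i < n" "v \<in> carrier_vec n" for v i
  proof -
    have "(M *\<^sub>v v) $ i = (\<Sum>j<n. f (h i) (h j) * v $ j)"
      using that by (simp add: M_def scalar_prod_def atLeast0LessThan)
    also have "\<dots> = (\<Sum>j<n. f (h i) (h j) * v $ (g (h j)))"
      by (rule sum.cong) (auto simp: gh)
    also have "\<dots> = (\<Sum>j\<in>I. f (h i) j * v $ (g j))"
      by (rule sum.reindex_bij_betw[OF h])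
    finally show ?thesis .
  qed
  have "det M = 0 \<longleftrightarrow> (\<exists>v. v \<in> carrier_vec n \<and> v \<noteq> 0\<^sub>v n \<and> M *\<^sub>v v = 0\<^sub>v n)"
    by (rule det_0_iff_vec_prod_zero[OF M])
  also have "\<dots> \<longleftrightarrow> (\<exists>v. (\<exists>i\<in>I. v i \<noteq> 0) \<and> (\<forall>i\<in>I. (\<Sum>j\<in>I. f i j * v j) = 0))"
  proof
    assume "\<exists>v. v \<in> carrier_vec n \<and> v \<noteq> 0\<^sub>v n \<and> M *\<^sub>v v = 0\<^sub>v n"
    then obtain v where v: "v \<in> carrier_vec n" "v \<noteq> 0\<^sub>v n" "M *\<^sub>v v = 0\<^sub>v n" by blast
    obtain i where i: "i < n" "v $ i \<noteq> 0"
      using v(1,2) by (auto simp: vec_eq_iff)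
    show "\<exists>v. (\<exists>i\<in>I. v i \<noteq> 0) \<and> (\<forall>i\<in>I. (\<Sum>j\<in>I. f i j * v j) = 0)"
    proof (intro exI[of _ "\<lambda>j. v $ g j"] conjI ballI)
      show "\<exists>i\<in>I. v $ g i \<noteq> 0" using i by (intro bexI[of _ "h i"]) (auto simp: gh hI)
      fix j assume "j \<in> I"
      then obtain k where "k < n" "j = h k" using Ih by blast
      with ent[OF this(1) v(1)] v(3) show "(\<Sum>l\<in>I. f j l * v $ g l) = 0" by simp
    qed
  next
    assume "\<exists>v. (\<exists>i\<in>I. v i \<noteq> 0) \<and> (\<forall>i\<in>I. (\<Sum>j\<in>I. f i j * v j) = 0)"
    then obtain v i where v: "i \<in> I" "v i \<noteq> 0" "\<forall>i\<in>I. (\<Sum>j\<in>I. f i j * v j) = 0" by blast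
    obtain k where k: "k < n" "i = h k" using Ih v(1) by blast
    define w where "w = vec n (\<lambda>i. v (h i))"
    have w: "w \<in> carrier_vec n" by (simp add: w_def)
    have "w $ k \<noteq> 0" using k v by (simp add: w_def)
    then have "w \<noteq> 0\<^sub>v n" using k by auto
    moreover have "M *\<^sub>v w = 0\<^sub>v n"
    proof (rule eq_vecI)
      fix j assume "j < dim_vec (0\<^sub>v n)"
      then have j: "j < n" by simp
      have "(M *\<^sub>v w) $ j = (\<Sum>l\<in>I. f (h j) l * v l)"
        unfolding ent[OF j w] by (rule sum.cong) (auto simp: w_def gh dest!: Ih)
      then show "(M *\<^sub>v w) $ j = 0\<^sub>v n $ j" using v(3) hI[OF j] j by simp
    qed (simp add: M_def)
    ultimately show "\<exists>v. v \<in> carrier_vec n \<and> v \<noteq> 0\<^sub>v n \<and> M *\<^sub>v v = 0\<^sub>v n"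
      using w by blast
  qed
  finally show ?thesis by (simp add: \<open>idet I f = det M\<close>)
qed

text \<open>Expanding the product in each Leibniz term, a choice \<open>X\<close> of diagonal summands contributes only
  for those permutations that fix \<open>X\<close> pointwise, and these are the permutations of the complement.\<close>

lemma idet_add_diag:
  fixes f :: "'i \<Rightarrow> 'i \<Rightarrow> 'a::comm_ring_1"
  assumes fin: "finite I"
  shows "idet I (\<lambda>i j. f i j + (if i = j then y i else 0)) =
    (\<Sum>X\<in>Pow I. (\<Prod>i\<in>X. y i) * idet (I - X) f)"
proof -
  let ?s = "\<lambda>p. of_int (sign p) :: 'a"
  have finP: "finite {p. p permutes I}" by (rule finite_permutations[OF fin])
  have fixed_sum: "(\<Sum>p | p permutes I. ?s p * ((\<Prod>i\<in>X. if i = p i then y i else 0) * (\<Prod>i\<in>I-X. f i (p i))))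
     = (\<Prod>i\<in>X. y i) * idet (I - X) f" if "X \<subseteq> I" for X
  proof -
    have finX: "finite X" using that fin finite_subset by blast
    have eq: "{p. p permutes I \<and> (\<forall>i\<in>X. p i = i)} = {p. p permutes (I - X)}"
    proof (intro equalityI subsetI CollectI; elim CollectE)
      fix p assume "p permutes I \<and> (\<forall>i\<in>X. p i = i)"
      then show "p permutes (I - X)"
        using permutes_superset[of p I "I - X"] by blast
    next
      fix p assume p: "p permutes (I - X)"
      show "p permutes I \<and> (\<forall>i\<in>X. p i = i)"
        using permutes_subset[OF p, of I] permutes_not_in[OF p] by blast
    qed
    have "(\<Sum>p | p permutes I. ?s p * ((\<Prod>i\<in>X. if i = p i then y i else 0) * (\<Prod>i\<in>I-X. f i (p i))))
      = (\<Sum>p | p permutes I \<and> (\<forall>i\<in>X. p i = i).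
           ?s p * ((\<Prod>i\<in>X. if i = p i then y i else 0) * (\<Prod>i\<in>I-X. f i (p i))))"
    proof (rule sum.mono_neutral_right[OF finP], goal_cases)
      case 2
      show ?case
      proof
        fix p assume "p \<in> {p. p permutes I} - {p. p permutes I \<and> (\<forall>i\<in>X. p i = i)}"
        then obtain i where "i \<in> X" "i \<noteq> p i" by fastforce
        then have "(\<Prod>i\<in>X. if i = p i then y i else 0) = 0"
          using finX by (intro prod_zero) auto
        then show "?s p * ((\<Prod>i\<in>X. if i = p i then y i else 0) * (\<Prod>i\<in>I-X. f i (p i))) = 0"
          by simp
      qed
    qed auto
    also have "\<dots> = (\<Sum>p | p permutes (I - X). ?s p * ((\<Prod>i\<in>X. y i) * (\<Prod>i\<in>I-X. f i (p i))))"
      unfolding eq[symmetric] by (intro sum.cong refl) (auto intro!: arg_cong2[of _ _ _ _ "(*)"] prod.cong)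
    also have "\<dots> = (\<Prod>i\<in>X. y i) * idet (I - X) f"
      unfolding idet_def sum_distrib_left by (intro sum.cong) (auto simp: mult_ac)
    finally show ?thesis .
  qed
  have "idet I (\<lambda>i j. f i j + (if i = j then y i else 0)) =
    (\<Sum>p | p permutes I. ?s p * (\<Prod>i\<in>I. (if i = p i then y i else 0) + f i (p i)))"
    unfolding idet_def by (simp add: add.commute)
  also have "\<dots> = (\<Sum>p | p permutes I. \<Sum>X\<in>Pow I.
      ?s p * ((\<Prod>i\<in>X. if i = p i then y i else 0) * (\<Prod>i\<in>I-X. f i (p i))))"
    by (simp add: prod_add[OF fin] sum_distrib_left)
  also have "\<dots> = (\<Sum>X\<in>Pow I. \<Sum>p | p permutes I.
      ?s p * ((\<Prod>i\<in>X. if i = p i then y i else 0) * (\<Prod>i\<in>I-X. f i (p i))))"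
    by (rule sum.swap)
  also have "\<dots> = (\<Sum>X\<in>Pow I. (\<Prod>i\<in>X. y i) * idet (I - X) f)"
    by (intro sum.cong refl fixed_sum) auto
  finally show ?thesis .
qed

lemma idet_scale:
  fixes f :: "'i \<Rightarrow> 'i \<Rightarrow> 'a::comm_ring_1"
  shows "idet I (\<lambda>i j. s i * f i j * t j) = (\<Prod>i\<in>I. s i) * (\<Prod>i\<in>I. t i) * idet I f"
  unfolding idet_def sum_distrib_left
proof (intro sum.cong refl)
  fix p assume "p \<in> {p. p permutes I}"
  then have p: "p permutes I" by simp
  have "(\<Prod>i\<in>I. t (p i)) = (\<Prod>i\<in>I. t i)"
    using prod.permute[OF p, of t] by (simp add: o_def)
  then show "of_int (sign p) * (\<Prod>i\<in>I. s i * f i (p i) * t (p i)) =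
      prod s I * prod t I * (of_int (sign p) * (\<Prod>i\<in>I. f i (p i)))"
    by (simp add: prod.distrib mult_ac)
qed

lemma poly_idet: "poly (idet I F) x = idet I (\<lambda>i j. poly (F i j) x)"
  unfolding idet_def by (simp add: poly_sum poly_prod)

lemma tendsto_idet:
  fixes f :: "'b \<Rightarrow> 'i \<Rightarrow> 'i \<Rightarrow> 'a::real_normed_field"
  assumes "\<And>i j. i \<in> I \<Longrightarrow> j \<in> I \<Longrightarrow> ((\<lambda>m. f m i j) \<longlongrightarrow> g i j) F"
  shows "((\<lambda>m. idet I (f m)) \<longlongrightarrow> idet I g) F"
  unfolding idet_def
  by (intro tendsto_sum tendsto_mult tendsto_const tendsto_prod assms) (auto simp: permutes_in_image)

lemma degree_idet_le:
  assumes "finite I" "\<And>i j. degree (F i j) \<le> 1"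
  shows "degree (idet I F) \<le> card I"
  unfolding idet_def
proof (rule degree_sum_le)
  show "finite {p. p permutes I}" by (rule finite_permutations[OF assms(1)])
  fix p
  have "degree (\<Prod>i\<in>I. F i (p i)) \<le> (\<Sum>i\<in>I. degree (F i (p i)))"
    using degree_prod_sum_le[OF assms(1), of "\<lambda>i. F i (p i)"] by (simp add: o_def)
  also have "\<dots> \<le> card I" using sum_mono[of I "\<lambda>i. degree (F i (p i))" "\<lambda>_. 1"] assms(2) by simp
  finally show "degree (of_int (sign p) * (\<Prod>i\<in>I. F i (p i))) \<le> card I"
    by (cases "sign p = 1") (auto simp: sign_def)
qed

section \<open>Accretive matrices and sums of principal minors\<close>

lemma idet_add_diag_on:
  fixes f :: "'i \<Rightarrow> 'i \<Rightarrow> 'a::comm_ring_1"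
  assumes fin: "finite I" and T: "T \<subseteq> I"
  shows "idet I (\<lambda>i j. f i j + (if i = j \<and> i \<in> T then y else 0)) =
    (\<Sum>X\<in>Pow T. y ^ card X * idet (I - X) f)"
proof -
  have "idet I (\<lambda>i j. f i j + (if i = j \<and> i \<in> T then y else 0)) =
    idet I (\<lambda>i j. f i j + (if i = j then (if i \<in> T then y else 0) else 0))"
    by (rule idet_cong) auto
  also have "\<dots> = (\<Sum>X\<in>Pow I. (\<Prod>i\<in>X. if i \<in> T then y else 0) * idet (I - X) f)"
    by (rule idet_add_diag[OF fin])
  also have "\<dots> = (\<Sum>X\<in>Pow T. (\<Prod>i\<in>X. if i \<in> T then y else 0) * idet (I - X) f)"
  proof (rule sum.mono_neutral_right)
    show "\<forall>X\<in>Pow I - Pow T. (\<Prod>i\<in>X. if i \<in> T then y else 0) * idet (I - X) f = 0"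
    proof
      fix X assume X: "X \<in> Pow I - Pow T"
      then obtain i where "i \<in> X" "i \<notin> T" by blast
      moreover have "finite X" using X fin finite_subset by blast
      ultimately have "(\<Prod>i\<in>X. if i \<in> T then y else 0) = 0"
        by (intro prod_zero) auto
      then show "(\<Prod>i\<in>X. if i \<in> T then y else 0) * idet (I - X) f = 0" by simp
    qed
  qed (use fin T in auto)
  also have "\<dots> = (\<Sum>X\<in>Pow T. y ^ card X * idet (I - X) f)"
  proof (rule sum.cong[OF refl])
    fix X assume "X \<in> Pow T"
    then have "(\<Prod>i\<in>X. if i \<in> T then y else 0) = (\<Prod>i\<in>X. y)"
      by (intro prod.cong) auto
    then show "(\<Prod>i\<in>X. if i \<in> T then y else 0) * idet (I - X) f = y ^ card X * idet (I - X) f"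
      by simp
  qed
  finally show ?thesis .
qed

lemma poly_pderiv_prod_linear:
  fixes r :: "nat \<Rightarrow> 'a::field_char_0"
  assumes "\<And>i. i < m \<Longrightarrow> z \<noteq> r i"
  shows "poly (pderiv (\<Prod>i<m. [:- r i, 1:])) z = poly (\<Prod>i<m. [:- r i, 1:]) z * (\<Sum>i<m. 1 / (z - r i))"
  using assms
proof (induction m)
  case (Suc m)
  let ?A = "\<Prod>i<m. [:- r i, 1:]"
  have nz: "z - r m \<noteq> 0" using Suc.prems[of m] by simp
  have "poly (pderiv (?A * [:- r m, 1:])) z = poly ?A z + (z - r m) * poly (pderiv ?A) z"
    by (simp only: pderiv_mult poly_add poly_mult) (simp add: pderiv_pCons)
  also have "poly (pderiv ?A) z = poly ?A z * (\<Sum>i<m. 1 / (z - r i))"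
    using Suc.IH Suc.prems by simp
  finally have "poly (pderiv (?A * [:- r m, 1:])) z =
      poly ?A z + (z - r m) * (poly ?A z * (\<Sum>i<m. 1 / (z - r i)))" .
  moreover have "poly (?A * [:- r m, 1:]) z = poly ?A z * (z - r m)"
    unfolding poly_mult by simp
  ultimately show ?case
    unfolding prod.lessThan_Suc sum.lessThan_Suc using nz by (simp only:) (simp add: field_simps)
qed simp

lemma Re_inverse_pos: "0 < Re w \<Longrightarrow> 0 < Re (1 / w)"
  by (auto simp: Re_divide sum_power2_gt_zero_iff intro!: divide_pos_pos)

text \<open>The theorem of Gauss and Lucas for a half-plane: the logarithmic derivative is the sum of the
  \<open>1 / (z - r)\<close> over the roots \<open>r\<close>, and each of these has positive real part when all roots lie in
  the open left half-plane.\<close>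

lemma pderiv_nonzero_right_half_plane:
  fixes p :: "complex poly"
  assumes nz: "\<And>z. 0 \<le> Re z \<Longrightarrow> poly p z \<noteq> 0" and deg: "0 < degree p" and z: "0 \<le> Re z"
  shows "poly (pderiv p) z \<noteq> 0"
proof -
  obtain r where r: "smult (lead_coeff p) (\<Prod>i<degree p. [:- r i, 1:]) = p"
    using complex_poly_decompose' by blast
  have c: "lead_coeff p \<noteq> 0" using deg by auto
  have root: "poly p (r i) = 0" if "i < degree p" for i
    by (subst r[symmetric]) (use that in \<open>auto simp: poly_prod\<close>)
  have pos: "0 < Re (z - r i)" if "i < degree p" for i
    using nz[of "r i"] root[OF that] z by (cases "0 \<le> Re (r i)") auto
  let ?q = "\<Prod>i<degree p. [:- r i, 1:]"
  have "0 < Re (\<Sum>i<degree p. 1 / (z - r i))"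
    unfolding Re_sum by (rule sum_pos) (use deg pos Re_inverse_pos in auto)
  then have "(\<Sum>i<degree p. 1 / (z - r i)) \<noteq> 0" by fastforce
  moreover have "poly p z = lead_coeff p * poly ?q z"
    by (subst r[symmetric]) simp
  then have "poly ?q z \<noteq> 0" using nz[OF z] by auto
  moreover have "poly (pderiv p) z = lead_coeff p * poly (pderiv ?q) z"
    by (subst r[symmetric]) (simp add: pderiv_smult)
  moreover have "z \<noteq> r i" if "i < degree p" for i using pos[OF that] by auto
  ultimately show ?thesis using c by (subst (asm) poly_pderiv_prod_linear) auto
qed

text \<open>Up to a nonzero factor the coefficient \<open>a\<close> is the value at \<open>0\<close> of the \<open>a\<close>-th derivative, and
  differentiation creates no zeros in the closed right half-plane.\<close>

lemma coeff_nonzero_right_half_plane: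
  fixes p :: "complex poly"
  assumes "\<And>z. 0 \<le> Re z \<Longrightarrow> poly p z \<noteq> 0" and "a \<le> degree p"
  shows "coeff p a \<noteq> 0"
  using assms
proof (induction a arbitrary: p)
  case 0
  then show ?case using 0(1)[of 0] by (simp add: poly_0_coeff_0)
next
  case (Suc a)
  have "coeff (pderiv p) a \<noteq> 0"
    using Suc.prems by (intro Suc.IH pderiv_nonzero_right_half_plane) (auto simp: degree_pderiv)
  then show ?case by (simp add: coeff_pderiv)
qed

abbreviation qform :: "'i set \<Rightarrow> ('i \<Rightarrow> 'i \<Rightarrow> complex) \<Rightarrow> ('i \<Rightarrow> complex) \<Rightarrow> complex" where
  "qform I M v \<equiv> \<Sum>i\<in>I. \<Sum>j\<in>I. cnj (v i) * M i j * v j"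

text \<open>Positive definiteness of the Hermitian part, stated as a condition on the quadratic form.\<close>

definition accretive :: "'i set \<Rightarrow> ('i \<Rightarrow> 'i \<Rightarrow> complex) \<Rightarrow> bool" where
  "accretive I M \<longleftrightarrow> (\<forall>v. (\<exists>i\<in>I. v i \<noteq> 0) \<longrightarrow> 0 < Re (qform I M v))"

lemma accretive_subset:
  assumes "accretive I M" "J \<subseteq> I" "finite I"
  shows "accretive J M"
  unfolding accretive_def
proof (intro allI impI)
  fix v :: "'a \<Rightarrow> complex" assume v: "\<exists>i\<in>J. v i \<noteq> 0"
  define w where "w i = (if i \<in> J then v i else 0)" for i
  have "\<exists>i\<in>I. w i \<noteq> 0" using v assms(2) by (auto simp: w_def)
  then have "0 < Re (\<Sum>i\<in>I. \<Sum>j\<in>I. cnj (w i) * M i j * w j)"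
    using assms(1) unfolding accretive_def by blast
  also have "(\<Sum>i\<in>I. \<Sum>j\<in>I. cnj (w i) * M i j * w j) = (\<Sum>i\<in>J. \<Sum>j\<in>J. cnj (v i) * M i j * v j)"
  proof -
    have "(\<Sum>i\<in>I. \<Sum>j\<in>I. cnj (w i) * M i j * w j) = (\<Sum>i\<in>J. \<Sum>j\<in>I. cnj (w i) * M i j * w j)"
      by (rule sum.mono_neutral_right) (use assms in \<open>auto simp: w_def\<close>)
    also have "\<dots> = (\<Sum>i\<in>J. \<Sum>j\<in>J. cnj (w i) * M i j * w j)"
      by (rule sum.cong[OF refl], rule sum.mono_neutral_right) (use assms in \<open>auto simp: w_def\<close>)
    also have "\<dots> = (\<Sum>i\<in>J. \<Sum>j\<in>J. cnj (v i) * M i j * v j)"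
      by (intro sum.cong refl) (auto simp: w_def)
    finally show ?thesis .
  qed
  finally show "0 < Re (\<Sum>i\<in>J. \<Sum>j\<in>J. cnj (v i) * M i j * v j)" .
qed

lemma diag_form:
  fixes y :: "'i \<Rightarrow> 'a::comm_ring_1"
  assumes "finite I"
  shows "(\<Sum>i\<in>I. \<Sum>j\<in>I. u i * (if i = j then y i else 0) * v j) = (\<Sum>i\<in>I. u i * y i * v i)"
proof (rule sum.cong[OF refl])
  fix i assume i: "i \<in> I"
  have "(\<Sum>j\<in>I. u i * (if i = j then y i else 0) * v j) = (\<Sum>j\<in>I. if i = j then u i * y i * v j else 0)"
    by (rule sum.cong) auto
  then show "(\<Sum>j\<in>I. u i * (if i = j then y i else 0) * v j) = u i * y i * v i"
    using assms i by simp
qed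

lemma Re_qform_add_diag:
  assumes "finite I"
  shows "Re (qform I (\<lambda>i j. M i j + (if i = j then y i else 0)) v) =
    Re (qform I M v) + (\<Sum>i\<in>I. (cmod (v i))\<^sup>2 * Re (y i))"
proof -
  have re: "Re (cnj (v i) * y i * v i) = (cmod (v i))\<^sup>2 * Re (y i)" for i
  proof -
    have "cnj (v i) * y i * v i = of_real ((cmod (v i))\<^sup>2) * y i"
      by (simp only: complex_norm_square) (simp add: mult_ac)
    then show ?thesis
      by (simp only: Re_complex_of_real Im_complex_of_real times_complex.sel)
  qed
  have "qform I (\<lambda>i j. M i j + (if i = j then y i else 0)) v =
     qform I M v + (\<Sum>i\<in>I. cnj (v i) * y i * v i)"
    unfolding diag_form[OF assms, of "\<lambda>i. cnj (v i)" y v, symmetric]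
    by (simp only: ring_distribs sum.distrib)
  then show ?thesis by (simp only: plus_complex.sel Re_sum re)
qed

lemma accretive_add_diag:
  assumes "accretive I M" and "finite I" and "\<And>i. i \<in> I \<Longrightarrow> 0 \<le> Re (y i)"
  shows "accretive I (\<lambda>i j. M i j + (if i = j then y i else 0))"
  unfolding accretive_def Re_qform_add_diag[OF assms(2)]
proof (intro allI impI)
  fix v :: "'a \<Rightarrow> complex" assume "\<exists>i\<in>I. v i \<noteq> 0"
  then have "0 < Re (qform I M v)" using assms(1) unfolding accretive_def by blast
  moreover have "0 \<le> (\<Sum>i\<in>I. (cmod (v i))\<^sup>2 * Re (y i))"
    using assms(3) by (intro sum_nonneg mult_nonneg_nonneg) auto
  ultimately show "0 < Re (qform I M v) + (\<Sum>i\<in>I. (cmod (v i))\<^sup>2 * Re (y i))"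
    by (rule add_pos_nonneg)
qed

text \<open>On a kernel vector the quadratic form would be zero.\<close>

lemma idet_accretive_nonzero:
  assumes "accretive I M" "finite I"
  shows "idet I M \<noteq> 0"
proof
  assume "idet I M = 0"
  then obtain v where v: "\<exists>i\<in>I. v i \<noteq> 0" "\<forall>i\<in>I. (\<Sum>j\<in>I. M i j * v j) = 0"
    using idet_eq_0_iff_kernel[OF assms(2)] by blast
  have "(\<Sum>i\<in>I. \<Sum>j\<in>I. cnj (v i) * M i j * v j) = (\<Sum>i\<in>I. cnj (v i) * (\<Sum>j\<in>I. M i j * v j))"
    by (simp add: sum_distrib_left mult.assoc)
  also have "\<dots> = 0" using v(2) by simp
  finally have "Re (\<Sum>i\<in>I. \<Sum>j\<in>I. cnj (v i) * M i j * v j) = 0" by (simp only: zero_complex.sel)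
  moreover have "0 < Re (\<Sum>i\<in>I. \<Sum>j\<in>I. cnj (v i) * M i j * v j)"
    using assms(1) v(1) unfolding accretive_def by blast
  ultimately show False by (simp only:)
qed

text \<open>The sum is the coefficient of \<open>z ^ a\<close> in the determinant with \<open>z\<close> added to the diagonal entries
  in \<open>T\<close>, a polynomial without zeros in the closed right half-plane.\<close>

lemma sum_minors_nonzero:
  assumes M: "accretive I M" and fin: "finite I" and T: "T \<subseteq> I" and a: "a \<le> card T"
  shows "(\<Sum>X | X \<subseteq> T \<and> card X = a. idet (I - X) M) \<noteq> 0"
proof -
  have finT: "finite T" using fin T finite_subset by blast
  define P where "P = (\<Sum>X\<in>Pow T. monom (idet (I - X) M) (card X))"
  have co: "coeff P b = (\<Sum>X | X \<subseteq> T \<and> card X = b. idet (I - X) M)" for b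
  proof -
    have "coeff P b = (\<Sum>X\<in>Pow T. if card X = b then idet (I - X) M else 0)"
      by (simp add: P_def coeff_sum)
    also have "\<dots> = (\<Sum>X | X \<subseteq> T \<and> card X = b. idet (I - X) M)"
      by (subst sum.inter_filter[symmetric]) (use finT in \<open>auto intro!: sum.cong\<close>)
    finally show ?thesis .
  qed
  have "poly P z \<noteq> 0" if z: "0 \<le> Re z" for z
  proof -
    have "poly P z = idet I (\<lambda>i j. M i j + (if i = j \<and> i \<in> T then z else 0))"
      unfolding idet_add_diag_on[OF fin T] by (simp add: P_def poly_sum poly_monom mult.commute)
    also have "\<dots> = idet I (\<lambda>i j. M i j + (if i = j then (if i \<in> T then z else 0) else 0))"
      by (rule idet_cong) auto
    also have "\<dots> \<noteq> 0"
      using z by (intro idet_accretive_nonzero accretive_add_diag M fin) auto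
    finally show ?thesis .
  qed
  moreover have "a \<le> degree P"
  proof -
    have "{X. X \<subseteq> T \<and> card X = card T} = {T}"
      using finT card_subset_eq by auto
    then have "coeff P (card T) = idet (I - T) M" by (simp add: co)
    also have "\<dots> \<noteq> 0"
      by (intro idet_accretive_nonzero accretive_subset[OF M]) (use fin in auto)
    finally show ?thesis using a le_degree by fastforce
  qed
  ultimately have "coeff P a \<noteq> 0"
    using coeff_nonzero_right_half_plane by blast
  then show ?thesis by (simp add: co)
qed

text \<open>The argument of \<open>sum_minors_nonzero\<close> is repeated in a second variable, which is added to the
  diagonal on \<open>T2\<close>: the case of one block shows that the resulting polynomial has no zeros in the
  closed right half-plane and that its leading coefficient does not vanish.\<close>

lemma sum_sum_minors_nonzero:
  assumes M: "accretive I M" and fin: "finite I" and T: "T1 \<subseteq> I" "T2 \<subseteq> I" "T1 \<inter> T2 = {}"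
    and a: "a \<le> card T1" and b: "b \<le> card T2"
  shows "(\<Sum>X | X \<subseteq> T1 \<and> card X = a. \<Sum>Z | Z \<subseteq> T2 \<and> card Z = b. idet (I - X - Z) M) \<noteq> 0"
proof -
  have finT: "finite T2" using fin T finite_subset by blast
  let ?S = "\<lambda>Z. \<Sum>X | X \<subseteq> T1 \<and> card X = a. idet (I - X - Z) M"
  define P where "P = (\<Sum>Z\<in>Pow T2. monom (?S Z) (card Z))"
  have co: "coeff P c = (\<Sum>Z | Z \<subseteq> T2 \<and> card Z = c. ?S Z)" for c
  proof -
    have "coeff P c = (\<Sum>Z\<in>Pow T2. if card Z = c then ?S Z else 0)"
      by (simp add: P_def coeff_sum)
    also have "\<dots> = (\<Sum>Z | Z \<subseteq> T2 \<and> card Z = c. ?S Z)"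
      by (subst sum.inter_filter[symmetric]) (use finT in \<open>auto intro!: sum.cong\<close>)
    finally show ?thesis .
  qed
  have "poly P z \<noteq> 0" if z: "0 \<le> Re z" for z
  proof -
    let ?M = "\<lambda>i j. M i j + (if i = j \<and> i \<in> T2 then z else 0)"
    have "poly P z = (\<Sum>Z\<in>Pow T2. \<Sum>X | X \<subseteq> T1 \<and> card X = a. z ^ card Z * idet (I - X - Z) M)"
      by (simp add: P_def poly_sum poly_monom sum_distrib_left sum_distrib_right mult.commute)
    also have "\<dots> = (\<Sum>X | X \<subseteq> T1 \<and> card X = a. \<Sum>Z\<in>Pow T2. z ^ card Z * idet (I - X - Z) M)"
      by (rule sum.swap)
    also have "\<dots> = (\<Sum>X | X \<subseteq> T1 \<and> card X = a. idet (I - X) ?M)"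
      by (intro sum.cong refl idet_add_diag_on[symmetric]) (use fin T in auto)
    also have "\<dots> \<noteq> 0"
    proof (rule sum_minors_nonzero[OF _ fin T(1) a])
      have "accretive I (\<lambda>i j. M i j + (if i = j then (if i \<in> T2 then z else 0) else 0))"
        using z by (intro accretive_add_diag M fin) auto
      also have "(\<lambda>i j. M i j + (if i = j then (if i \<in> T2 then z else 0) else 0)) = ?M"
        by (auto simp: fun_eq_iff)
      finally show "accretive I ?M" .
    qed
    finally show ?thesis .
  qed
  moreover have "b \<le> degree P"
  proof -
    have "{Z. Z \<subseteq> T2 \<and> card Z = card T2} = {T2}"
      using finT card_subset_eq by auto
    then have "coeff P (card T2) = ?S T2" by (simp add: co)
    also have "\<dots> = (\<Sum>X | X \<subseteq> T1 \<and> card X = a. idet ((I - T2) - X) M)"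
      by (intro sum.cong refl arg_cong2[of _ _ _ _ idet]) auto
    also have "\<dots> \<noteq> 0"
      by (rule sum_minors_nonzero[OF accretive_subset[OF M]]) (use fin T a in auto)
    finally show ?thesis using b le_degree by fastforce
  qed
  ultimately have "coeff P b \<noteq> 0"
    using coeff_nonzero_right_half_plane by blast
  then show ?thesis unfolding co by (subst sum.swap)
qed

section \<open>Limits of nonvanishing polynomials and real-rooted polynomials\<close>

text \<open>An elementary form of Hurwitz' theorem.  If a polynomial of degree at most \<open>D\<close> has no root within
  distance \<open>d\<close> of \<open>x0\<close>, then comparing it root by root at \<open>x0\<close> and at another point \<open>x1\<close> bounds
  its value at \<open>x1\<close> by a constant times its value at \<open>x0\<close>, with a constant that depends only on
  \<open>D\<close>, \<open>d\<close>, \<open>x0\<close> and \<open>x1\<close>.  The bound passes to the limit.\<close>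

lemma zero_limit_of_nonvanishing:
  fixes Q :: "complex poly" and q :: "nat \<Rightarrow> complex poly"
  assumes deg: "\<And>m. degree (q m) \<le> D" and d: "0 < d"
    and nz: "\<And>m z. cmod (z - x0) < d \<Longrightarrow> poly (q m) z \<noteq> 0"
    and lim: "\<And>z. (\<lambda>m. poly (q m) z) \<longlonglongrightarrow> poly Q z"
    and Q: "poly Q x0 = 0"
  shows "Q = 0"
proof -
  have "poly Q x1 = 0" for x1
  proof -
    \<comment> \<open>A root at distance at least \<open>d\<close> from \<open>x0\<close> is at most \<open>K\<close> times as far from \<open>x1\<close> as from \<open>x0\<close>.\<close>
    define K where "K = 1 + cmod (x1 - x0) / d"
    have K: "1 \<le> K" using d by (simp add: K_def)
    have bound: "cmod (poly (q m) x1) \<le> K ^ D * cmod (poly (q m) x0)" for m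
    proof -
      obtain r where r: "smult (lead_coeff (q m)) (\<Prod>i<degree (q m). [:- r i, 1:]) = q m"
        using complex_poly_decompose' by blast
      have ev: "poly (q m) z = lead_coeff (q m) * (\<Prod>i<degree (q m). z - r i)" for z
        by (subst r[symmetric]) (simp add: poly_prod)
      have step: "cmod (x1 - r i) \<le> K * cmod (x0 - r i)" if "i < degree (q m)" for i
      proof -
        have "poly (q m) (r i) = 0" using that by (auto simp: ev)
        then have "d \<le> cmod (x0 - r i)"
          using nz[of "r i"] by (metis norm_minus_commute not_le)
        then have "cmod (x1 - x0) \<le> cmod (x1 - x0) / d * cmod (x0 - r i)"
          using d mult_left_mono[of d "cmod (x0 - r i)" "cmod (x1 - x0)"] by (simp add: field_simps)
        moreover have "cmod (x1 - r i) \<le> cmod (x1 - x0) + cmod (x0 - r i)"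
          using norm_triangle_ineq[of "x1 - x0" "x0 - r i"] by simp
        ultimately show ?thesis by (simp add: K_def algebra_simps)
      qed
      have "(\<Prod>i<degree (q m). cmod (x1 - r i)) \<le> (\<Prod>i<degree (q m). K * cmod (x0 - r i))"
        by (rule prod_mono) (use step in auto)
      also have "\<dots> = K ^ degree (q m) * (\<Prod>i<degree (q m). cmod (x0 - r i))"
        by (simp add: prod.distrib)
      also have "\<dots> \<le> K ^ D * (\<Prod>i<degree (q m). cmod (x0 - r i))"
        using K deg by (intro mult_right_mono power_increasing prod_nonneg) auto
      finally have "cmod (lead_coeff (q m)) * (\<Prod>i<degree (q m). cmod (x1 - r i)) \<le>
          cmod (lead_coeff (q m)) * (K ^ D * (\<Prod>i<degree (q m). cmod (x0 - r i)))"
        by (rule mult_left_mono) simp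
      then show ?thesis by (simp add: ev norm_mult prod_norm[symmetric] mult_ac)
    qed
    have "(\<lambda>m. cmod (poly (q m) x1)) \<longlonglongrightarrow> cmod (poly Q x1)"
      by (intro tendsto_norm lim)
    moreover have "(\<lambda>m. K ^ D * cmod (poly (q m) x0)) \<longlonglongrightarrow> K ^ D * cmod (poly Q x0)"
      by (intro tendsto_mult tendsto_const tendsto_norm lim)
    ultimately have "cmod (poly Q x1) \<le> K ^ D * cmod (poly Q x0)"
      using bound by (intro LIMSEQ_le) auto
    then show ?thesis using Q by simp
  qed
  then show ?thesis using poly_all_0_iff_0 by blast
qed

abbreviation cpoly :: "real poly \<Rightarrow> complex poly" where
  "cpoly \<equiv> map_poly complex_of_real"

lemma real_rooted_decompose:
  assumes "real_rooted q"
  obtains r where "\<And>x. poly q x = lead_coeff q * (\<Prod>i<degree q. x - r i)"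
proof -
  have deg: "degree (cpoly q) = degree q"
    by (rule degree_map_poly) simp
  have lc: "lead_coeff (cpoly q) = of_real (lead_coeff q)"
    by (simp add: deg coeff_map_poly)
  obtain r where r: "smult (lead_coeff (cpoly q)) (\<Prod>i<degree q. [:- r i, 1:]) = cpoly q"
    using complex_poly_decompose'[of "cpoly q"] unfolding deg by blast
  have ev: "poly (cpoly q) z = of_real (lead_coeff q) * (\<Prod>i<degree q. z - r i)" for z
    by (subst r[symmetric]) (simp add: poly_prod lc)
  have real: "r i = of_real (Re (r i))" if "i < degree q" for i
  proof -
    have "poly (cpoly q) (r i) = 0" using that by (auto simp: ev)
    then have "r i \<in> \<real>" using assms by (auto simp: real_rooted_def)
    then show ?thesis by (simp add: of_real_Re)
  qed
  have "poly q x = lead_coeff q * (\<Prod>i<degree q. x - Re (r i))" for x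
  proof -
    have "complex_of_real (poly q x) = poly (cpoly q) (of_real x)" by simp
    also have "\<dots> = of_real (lead_coeff q) * (\<Prod>i<degree q. of_real x - of_real (Re (r i)))"
      unfolding ev using real by (intro arg_cong2[of _ _ _ _ "(*)"] prod.cong refl) auto
    also have "\<dots> = of_real (lead_coeff q * (\<Prod>i<degree q. x - Re (r i)))" by simp
    finally show ?thesis by (simp only: of_real_eq_iff)
  qed
  then show thesis by (rule that)
qed

text \<open>Where \<open>q\<close> is positive its logarithmic derivative, a sum of terms \<open>1 / (x - r)\<close> with real \<open>r\<close>, is
  decreasing.  A dip at \<open>\<xi>\<close> would make it negative somewhere on the left of \<open>\<xi>\<close> and positive
  somewhere on the right.\<close>

lemma real_rooted_no_dip:
  assumes q: "real_rooted q" and ab: "a < \<xi>" "\<xi> < b"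
    and pos: "\<And>x. a \<le> x \<Longrightarrow> x \<le> b \<Longrightarrow> 0 < poly q x"
    and dip: "poly q \<xi> < poly q a" "poly q \<xi> < poly q b"
  shows False
proof -
  obtain r where r: "\<And>x. poly q x = lead_coeff q * (\<Prod>i<degree q. x - r i)"
    using real_rooted_decompose[OF q] by blast
  let ?n = "degree q"
  define L where "L x = (\<Sum>i<?n. 1 / (x - r i))" for x
  have qeq: "q = smult (lead_coeff q) (\<Prod>i<?n. [:- r i, 1:])"
    by (rule poly_ext) (simp add: r[symmetric] poly_prod)
  have out: "r i < a \<or> b < r i" if "i < ?n" for i
  proof (rule ccontr)
    assume "\<not> (r i < a \<or> b < r i)"
    then have "0 < poly q (r i)" using pos by auto
    moreover have "poly q (r i) = 0" using that by (subst r) auto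
    ultimately show False by simp
  qed
  have deriv: "poly (pderiv q) x = poly q x * L x" if "a \<le> x" "x \<le> b" for x
  proof -
    have "poly (pderiv q) x = lead_coeff q * poly (pderiv (\<Prod>i<?n. [:- r i, 1:])) x"
      using arg_cong[OF qeq, of "\<lambda>p. poly (pderiv p) x"] by (simp add: pderiv_smult)
    also have "\<dots> = lead_coeff q * (poly (\<Prod>i<?n. [:- r i, 1:]) x * L x)"
      unfolding L_def using out that by (subst poly_pderiv_prod_linear) fastforce+
    also have "\<dots> = poly q x * L x"
      using arg_cong[OF qeq, of "\<lambda>p. poly p x"] by simp
    finally show ?thesis .
  qed
  obtain c1 where c1: "a < c1" "c1 < \<xi>" "poly q \<xi> - poly q a = (\<xi> - a) * poly (pderiv q) c1"
    using poly_MVT[OF ab(1)] by blast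
  obtain c2 where c2: "\<xi> < c2" "c2 < b" "poly q b - poly q \<xi> = (b - \<xi>) * poly (pderiv q) c2"
    using poly_MVT[OF ab(2)] by blast
  have "poly (pderiv q) c1 < 0" using c1 dip(1) ab by (smt (verit) mult_nonneg_nonneg)
  then have "L c1 < 0" using deriv[of c1] pos[of c1] c1 ab by (smt (verit) mult_nonneg_nonneg)
  moreover have "0 < poly (pderiv q) c2" using c2 dip(2) ab by (smt (verit) mult_nonneg_nonpos)
  then have "0 < L c2" using deriv[of c2] pos[of c2] c2 ab by (smt (verit) mult_nonneg_nonpos)
  moreover have "L c2 \<le> L c1"
    unfolding L_def
  proof (rule sum_mono)
    fix i assume "i \<in> {..<?n}"
    then consider "r i < a" | "b < r i" using out by auto
    then show "1 / (c2 - r i) \<le> 1 / (c1 - r i)"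
      by cases (use c1 c2 ab in \<open>auto simp: field_simps\<close>)
  qed
  ultimately show False by simp
qed

text \<open>Suppose \<open>f\<close> were positive at \<open>\<beta>\<close>.  Then there is an interval in the region where \<open>g\<close> is
  positive, with \<open>f\<close> positive at both ends but zero at an inner point \<open>\<alpha>\<close>.  Adding just enough of \<open>g\<close> to make
  \<open>f\<close> positive on the whole interval produces a combination with a positive but arbitrarily small
  value inside and values bounded away from zero at the ends, which no real-rooted polynomial has.\<close>

lemma real_rooted_combination_sign:
  fixes f g :: "real poly"
  assumes rr: "\<And>t. 0 < t \<Longrightarrow> real_rooted (f + smult t g)"
    and f: "poly f \<alpha> = 0" and g: "\<And>x. \<beta> < x \<Longrightarrow> 0 < poly g x"
    and c: "\<alpha> < c" "0 < poly f c" and \<beta>: "\<beta> < \<alpha>"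
  shows "poly f \<beta> \<le> 0"
proof (rule ccontr)
  assume "\<not> poly f \<beta> \<le> 0"
  then have "0 < poly f \<beta>" by simp
  have "isCont (poly f) \<beta>" by (rule poly_isCont)
  then obtain s where s: "0 < s" "\<And>x. \<bar>x - \<beta>\<bar> < s \<Longrightarrow> \<bar>poly f x - poly f \<beta>\<bar> < poly f \<beta>"
    using \<open>0 < poly f \<beta>\<close> unfolding isCont_def LIM_eq
    by (metis abs_zero cancel_comm_monoid_add_class.diff_cancel real_norm_def)
  define a where "a = \<beta> + min (s / 2) ((\<alpha> - \<beta>) / 2)"
  have a: "\<beta> < a" "a < \<alpha>" using s \<beta> by (auto simp: a_def min_def field_simps)
  have "\<bar>a - \<beta>\<bar> < s" using s \<beta> by (auto simp: a_def min_def)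
  then have fa: "0 < poly f a" using s(2)[of a] by auto
  have gpos: "0 < poly g x" if "a \<le> x" for x using g a that by simp
  \<comment> \<open>\<open>\<phi> x\<close> is the multiple of \<open>g\<close> that has to be added to \<open>f\<close> to get the value \<open>0\<close> at \<open>x\<close>.\<close>
  define \<phi> where "\<phi> x = - poly f x / poly g x" for x
  have "\<forall>x. a \<le> x \<and> x \<le> c \<longrightarrow> isCont \<phi> x"
  proof (intro allI impI)
    fix x assume "a \<le> x \<and> x \<le> c"
    then show "isCont \<phi> x"
      unfolding \<phi>_def using gpos[of x] by (intro isCont_divide isCont_minus poly_isCont) auto
  qed
  moreover have "a \<le> c" using a c by simp
  ultimately have "\<exists>M. (\<forall>x. a \<le> x \<and> x \<le> c \<longrightarrow> \<phi> x \<le> M) \<and> (\<exists>x\<ge>a. x \<le> c \<and> \<phi> x = M)"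
    by (intro isCont_eq_Ub)
  then obtain M \<xi> where M: "\<And>x. a \<le> x \<Longrightarrow> x \<le> c \<Longrightarrow> \<phi> x \<le> M" and \<xi>: "a \<le> \<xi>" "\<xi> \<le> c" "\<phi> \<xi> = M"
    by metis
  have M0: "0 \<le> M" using M[of \<alpha>] a c f by (simp add: \<phi>_def)
  have f\<xi>: "poly f \<xi> = - M * poly g \<xi>" using \<xi> gpos[of \<xi>] by (simp add: \<phi>_def field_simps)
  then have "poly f \<xi> \<le> 0" using M0 gpos[of \<xi>] \<xi>(1) by simp
  then have ne: "a < \<xi>" "\<xi> < c" using \<xi> fa c(2) by (auto simp: order_le_less)
  \<comment> \<open>The surplus \<open>e\<close> makes the value at \<open>\<xi>\<close> half the smaller of the two end values of \<open>f\<close>.\<close>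
  define e where "e = min (poly f a) (poly f c) / (2 * poly g \<xi>)"
  have e: "0 < e" using fa c(2) gpos[of \<xi>] \<xi> by (simp add: e_def)
  let ?q = "f + smult (M + e) g"
  have "real_rooted ?q" using rr M0 e by simp
  then show False
  proof (rule real_rooted_no_dip[OF _ ne])
    fix x assume x: "a \<le> x" "x \<le> c"
    have "- poly f x \<le> M * poly g x"
      using M[OF x] gpos[OF x(1)] by (simp add: \<phi>_def field_simps)
    moreover have "0 < e * poly g x" using e gpos[OF x(1)] by simp
    ultimately show "0 < poly ?q x" by (simp add: algebra_simps)
  next
    have "poly ?q \<xi> = e * poly g \<xi>" by (simp add: f\<xi> algebra_simps)
    also have "\<dots> = min (poly f a) (poly f c) / 2"
      using gpos[of \<xi>] \<xi> by (simp add: e_def)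
    finally have q\<xi>: "poly ?q \<xi> = min (poly f a) (poly f c) / 2" .
    have "poly f a \<le> poly ?q a" "poly f c \<le> poly ?q c"
      using M0 e gpos[of a] gpos[of c] a c by simp_all
    then show "poly ?q \<xi> < poly ?q a" "poly ?q \<xi> < poly ?q c"
      unfolding q\<xi> using fa c(2) by (auto simp: min_def)
  qed
qed

section \<open>Sums of principal minors of a signed pencil\<close>

text \<open>The real part of the quadratic form only sees the Hermitian part of the matrix, which is here a
  nonnegative diagonal matrix.\<close>

lemma Re_qform_nonneg:
  assumes fin: "finite I"
    and herm: "\<And>i j. i \<in> I \<Longrightarrow> j \<in> I \<Longrightarrow> M i j + cnj (M j i) = (if i = j then of_real (h i) else 0)"
    and h: "\<And>i. i \<in> I \<Longrightarrow> 0 \<le> h i"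
  shows "0 \<le> Re (qform I M v)"
proof -
  have "cnj (qform I M v) = (\<Sum>i\<in>I. \<Sum>j\<in>I. cnj (v j) * cnj (M i j) * v i)"
    by (simp add: mult_ac)
  also have "\<dots> = (\<Sum>i\<in>I. \<Sum>j\<in>I. cnj (v i) * cnj (M j i) * v j)"
    by (rule sum.swap)
  finally have "qform I M v + cnj (qform I M v) = (\<Sum>i\<in>I. \<Sum>j\<in>I. cnj (v i) * (M i j + cnj (M j i)) * v j)"
    by (simp only: ring_distribs sum.distrib)
  also have "\<dots> = (\<Sum>i\<in>I. \<Sum>j\<in>I. cnj (v i) * (if i = j then of_real (h i) else 0) * v j)"
    by (intro sum.cong refl) (use herm in auto)
  also have "\<dots> = (\<Sum>i\<in>I. cnj (v i) * of_real (h i) * v i)"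
    by (rule diag_form[OF fin])
  also have "\<dots> = of_real (\<Sum>i\<in>I. h i * (cmod (v i))\<^sup>2)"
    unfolding of_real_sum of_real_mult complex_norm_square by (intro sum.cong refl) (simp add: mult_ac)
  finally have "2 * Re (qform I M v) = (\<Sum>i\<in>I. h i * (cmod (v i))\<^sup>2)"
    by (simp only: complex_add_cnj of_real_eq_iff)
  moreover have "0 \<le> (\<Sum>i\<in>I. h i * (cmod (v i))\<^sup>2)"
    by (intro sum_nonneg mult_nonneg_nonneg h) auto
  ultimately show ?thesis by linarith
qed

lemma accretive_dissipative_plus_diag:
  assumes fin: "finite I"
    and M: "\<And>v. 0 \<le> Re (qform I M v)" and y: "\<And>i. i \<in> I \<Longrightarrow> 0 < Re (y i)"
  shows "accretive I (\<lambda>i j. M i j + (if i = j then y i else 0))"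
  unfolding accretive_def Re_qform_add_diag[OF fin]
proof (intro allI impI)
  fix v :: "'a \<Rightarrow> complex" assume "\<exists>i\<in>I. v i \<noteq> 0"
  then obtain k where k: "k \<in> I" "v k \<noteq> 0" by blast
  have "0 < (\<Sum>i\<in>I. (cmod (v i))\<^sup>2 * Re (y i))"
  proof (rule sum_pos2[OF fin k(1)])
    show "0 < (cmod (v k))\<^sup>2 * Re (y k)" using k y by simp
    show "0 \<le> (cmod (v i))\<^sup>2 * Re (y i)" if "i \<in> I" for i
      using y[OF that] by (intro mult_nonneg_nonneg) auto
  qed
  then show "0 < Re (qform I M v) + (\<Sum>i\<in>I. (cmod (v i))\<^sup>2 * Re (y i))"
    using M[of v] by (simp only: add_nonneg_pos)
qed

lemma poly_cpoly_idet:
  "poly (cpoly (idet I F)) z = idet I (\<lambda>i j. poly (cpoly (F i j)) z)"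
proof -
  interpret c: map_poly_comm_ring_hom complex_of_real ..
  show ?thesis unfolding idet_def
    by (simp add: c.hom_sum c.hom_prod c.hom_mult c.hom_of_int poly_sum poly_prod)
qed

lemma poly_cpoly_sum: "poly (cpoly (\<Sum>i\<in>A. f i)) z = (\<Sum>i\<in>A. poly (cpoly (f i)) z)"
proof -
  interpret c: map_poly_comm_ring_hom complex_of_real ..
  show ?thesis by (simp add: c.hom_sum poly_sum)
qed

text \<open>The principal minor on \<open>J\<close> of the matrix \<open>\<sigma> H\<close> (rows multiplied by the signs \<open>\<sigma>\<close>) with the
  variable added to the diagonal on \<open>K\<close>.  For \<open>\<sigma> = -1\<close> on \<open>K\<close> this is the principal minor of the
  symmetric pencil \<open>H - x D\<close> up to a sign, so there are two views of it.  The symmetric one gives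
  real roots, and the signed one, whose off-diagonal part is skew-symmetric in the application,
  gives positivity.\<close>

definition pdet :: "('i \<Rightarrow> real) \<Rightarrow> ('i \<Rightarrow> 'i \<Rightarrow> real) \<Rightarrow> 'i set \<Rightarrow> 'i set \<Rightarrow> real poly" where
  "pdet \<sigma> H K J = idet J (\<lambda>i j. [:\<sigma> i * H i j:] + (if i = j \<and> i \<in> K then [:0, 1:] else 0))"

lemma poly_cpoly_const: "poly (cpoly [:c:]) z = of_real c"
  by (cases "c = 0") (auto simp: map_poly_pCons)

lemma cpoly_add: "cpoly (p + q) = cpoly p + cpoly q"
proof -
  interpret c: map_poly_comm_ring_hom complex_of_real ..
  show ?thesis by (simp add: c.hom_add)
qed

lemma poly_cpoly_pdet:
  "poly (cpoly (pdet \<sigma> H K J)) z =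
   idet J (\<lambda>i j. of_real (\<sigma> i * H i j) + (if i = j \<and> i \<in> K then z else 0))"
  unfolding pdet_def poly_cpoly_idet
  by (rule idet_cong) (simp only: cpoly_add poly_add poly_cpoly_const, auto simp: map_poly_pCons)

lemma poly_pdet:
  "poly (pdet \<sigma> H K J) x = idet J (\<lambda>i j. \<sigma> i * H i j + (if i = j \<and> i \<in> K then x else 0))"
  unfolding pdet_def poly_idet by (rule idet_cong) auto

lemma poly_cpoly_pdet_symmetric:
  assumes "\<And>i. i \<in> J \<Longrightarrow> i \<in> K \<Longrightarrow> \<sigma> i = -1"
  shows "poly (cpoly (pdet \<sigma> H K J)) z =
    of_real (\<Prod>i\<in>J. \<sigma> i) * idet J (\<lambda>i j. of_real (H i j) - (if i = j \<and> i \<in> K then z else 0))"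
proof -
  have "idet J (\<lambda>i j. of_real (\<sigma> i * H i j) + (if i = j \<and> i \<in> K then z else 0)) =
    idet J (\<lambda>i j. of_real (\<sigma> i) * (of_real (H i j) - (if i = j \<and> i \<in> K then z else 0)) * 1)"
    by (rule idet_cong) (use assms in auto)
  then show ?thesis unfolding poly_cpoly_pdet idet_scale by simp
qed

lemma inverse_Suc_tendsto_0: "(\<lambda>m. of_real (inverse (real (Suc m))) :: complex) \<longlonglongrightarrow> 0"
  using tendsto_of_real[OF LIMSEQ_inverse_real_of_nat, where 'a = complex] by simp

text \<open>For \<open>z\<close> in one open half-plane bounded by the real line, the matrix \<open>H + \<i> s \<epsilon> - z D\<close> becomes
  accretive after multiplication by \<open>- \<i> s\<close> with the appropriate sign \<open>s\<close>, because the real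
  symmetric part \<open>H\<close> then contributes nothing to the real part of the quadratic form.  All minors in
  the sum have the same size and hence acquire the same factor, so the sum is nonzero; finally
  \<open>\<epsilon>\<close> tends to zero.\<close>

lemma sum_sum_pdet_real_rooted:
  assumes fin: "finite I" and sym: "\<And>i j. i \<in> I \<Longrightarrow> j \<in> I \<Longrightarrow> H i j = H j i"
    and K: "\<And>i. i \<in> I \<Longrightarrow> i \<in> K \<Longrightarrow> \<sigma> i = -1"
    and T: "T1 \<subseteq> I" "T2 \<subseteq> I" "T1 \<inter> T2 = {}"
    and \<sigma>: "\<And>i. i \<in> T1 \<Longrightarrow> \<sigma> i = 1" "\<And>i. i \<in> T2 \<Longrightarrow> \<sigma> i = -1"
    and ab: "a \<le> card T1" "b \<le> card T2"
  defines "Q \<equiv> \<Sum>X | X \<subseteq> T1 \<and> card X = a. \<Sum>Z | Z \<subseteq> T2 \<and> card Z = b. pdet \<sigma> H K (I - X - Z)"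
  shows "Q = 0 \<or> real_rooted Q"
proof (rule disjCI)
  assume "\<not> real_rooted Q"
  show "Q = 0"
  proof (rule ccontr)
    assume "Q \<noteq> 0"
    then obtain z0 where z0: "poly (cpoly Q) z0 = 0" "z0 \<notin> \<real>"
      using \<open>\<not> real_rooted Q\<close> by (auto simp: real_rooted_def)
    have im: "Im z0 \<noteq> 0" using z0(2) complex_is_Real_iff by blast
    have finT: "finite T1" "finite T2" using T fin finite_subset by blast+
    define s :: real where "s = (if Im z0 > 0 then -1 else 1)"
    have s2: "s * s = 1" by (simp add: s_def)
    \<comment> \<open>The perturbed sum, as a function \<open>F \<epsilon>\<close> and as the polynomial \<open>q \<epsilon>\<close> with the same values.\<close>
    define F where "F \<epsilon> z = (\<Sum>X | X \<subseteq> T1 \<and> card X = a. \<Sum>Z | Z \<subseteq> T2 \<and> card Z = b.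
      idet (I - X - Z) (\<lambda>i j. of_real (H i j) + (if i = j then \<i> * of_real s * of_real \<epsilon> else 0)
         - (if i = j \<and> i \<in> K then z else 0)))" for \<epsilon> :: real and z :: complex
    define q where "q \<epsilon> = (\<Sum>X | X \<subseteq> T1 \<and> card X = a. \<Sum>Z | Z \<subseteq> T2 \<and> card Z = b.
      idet (I - X - Z) (\<lambda>i j. [:of_real (H i j) + (if i = j then \<i> * of_real s * of_real \<epsilon> else 0):]
         - (if i = j \<and> i \<in> K then [:0, 1:] else 0)))" for \<epsilon> :: real
    have qF: "poly (q \<epsilon>) z = F \<epsilon> z" for \<epsilon> z
      unfolding q_def F_def poly_sum poly_idet by (intro sum.cong refl idet_cong) auto
    have QF: "poly (cpoly Q) z = of_real ((\<Prod>i\<in>I. \<sigma> i) * (-1) ^ b) * F 0 z" for z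
    proof -
      have pr: "(\<Prod>i\<in>I - X - Z. \<sigma> i) = (\<Prod>i\<in>I. \<sigma> i) * (-1) ^ b"
        if "X \<subseteq> T1" "Z \<subseteq> T2" "card Z = b" for X Z
      proof -
        have sub: "X \<union> Z \<subseteq> I" "X \<inter> Z = {}" using that T by auto
        have "(\<Prod>i\<in>I. \<sigma> i) = (\<Prod>i\<in>I - (X \<union> Z). \<sigma> i) * (\<Prod>i\<in>X \<union> Z. \<sigma> i)"
          by (rule prod.subset_diff[OF sub(1) fin])
        also have "(\<Prod>i\<in>X \<union> Z. \<sigma> i) = (\<Prod>i\<in>X. \<sigma> i) * (\<Prod>i\<in>Z. \<sigma> i)"
          by (rule prod.union_disjoint) (use sub that finT finite_subset in blast)+
        also have "(\<Prod>i\<in>X. \<sigma> i) = 1" using that \<sigma> by (intro prod.neutral) auto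
        also have "(\<Prod>i\<in>Z. \<sigma> i) = (\<Prod>i\<in>Z. -1)" using that \<sigma> by (intro prod.cong) auto
        finally have "(\<Prod>i\<in>I. \<sigma> i) * (-1) ^ b = (\<Prod>i\<in>I - (X \<union> Z). \<sigma> i) * ((-1) ^ b * (-1) ^ b)"
          using that by simp
        also have "(-1) ^ b * (-1) ^ b = (1::real)" by (simp add: power_mult_distrib[symmetric])
        finally show ?thesis by (simp add: Diff_Un Diff_Diff_Int set_diff_eq Int_def conj_assoc)
      qed
      show ?thesis
        unfolding Q_def F_def poly_cpoly_sum sum_distrib_left
      proof (intro sum.cong refl)
        fix X Z assume X: "X \<in> {X. X \<subseteq> T1 \<and> card X = a}" and Z: "Z \<in> {Z. Z \<subseteq> T2 \<and> card Z = b}"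
        have "poly (cpoly (pdet \<sigma> H K (I - X - Z))) z = of_real ((\<Prod>i\<in>I. \<sigma> i) * (-1) ^ b) *
          idet (I - X - Z) (\<lambda>i j. of_real (H i j) - (if i = j \<and> i \<in> K then z else 0))"
          using X Z K by (subst poly_cpoly_pdet_symmetric) (auto simp: pr)
        also have "idet (I - X - Z) (\<lambda>i j. of_real (H i j) - (if i = j \<and> i \<in> K then z else 0)) =
           idet (I - X - Z) (\<lambda>i j. of_real (H i j) + (if i = j then \<i> * of_real s * of_real 0 else 0)
             - (if i = j \<and> i \<in> K then z else 0))"
          by (rule idet_cong) auto
        finally show "poly (cpoly (pdet \<sigma> H K (I - X - Z))) z = of_real ((\<Prod>i\<in>I. \<sigma> i) * (-1) ^ b) *
          idet (I - X - Z) (\<lambda>i j. of_real (H i j) + (if i = j then \<i> * of_real s * of_real 0 else 0)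
             - (if i = j \<and> i \<in> K then z else 0))" .
      qed
    qed
    have nz: "F \<epsilon> z \<noteq> 0" if \<epsilon>: "0 < \<epsilon>" and z: "s * Im z < 0" for \<epsilon> z
    proof -
      let ?c = "- \<i> * of_real s"
      let ?M = "\<lambda>i j. of_real (H i j) + (if i = j then \<i> * of_real s * of_real \<epsilon> else 0)
         - (if i = j \<and> i \<in> K then z else 0)"
      have acc: "accretive I (\<lambda>i j. ?c * of_real (H i j) +
          (if i = j then of_real \<epsilon> + (if i \<in> K then - ?c * z else 0) else 0))"
      proof (rule accretive_dissipative_plus_diag[OF fin])
        show "0 \<le> Re (qform I (\<lambda>i j. ?c * of_real (H i j)) v)" for v
          by (rule Re_qform_nonneg[OF fin, where h = "\<lambda>_. 0"]) (auto simp: sym)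
        show "0 < Re (of_real \<epsilon> + (if i \<in> K then - ?c * z else 0))" if "i \<in> I" for i
          using \<epsilon> z by auto
      qed
      have "(\<Sum>X | X \<subseteq> T1 \<and> card X = a. \<Sum>Z | Z \<subseteq> T2 \<and> card Z = b.
          idet (I - X - Z) (\<lambda>i j. ?c * of_real (H i j) +
          (if i = j then of_real \<epsilon> + (if i \<in> K then - ?c * z else 0) else 0))) =
        (\<Sum>X | X \<subseteq> T1 \<and> card X = a. \<Sum>Z | Z \<subseteq> T2 \<and> card Z = b.
          ?c ^ (card I - a - b) * idet (I - X - Z) ?M)"
      proof (intro sum.cong refl)
        fix X Z assume X: "X \<in> {X. X \<subseteq> T1 \<and> card X = a}" and Z: "Z \<in> {Z. Z \<subseteq> T2 \<and> card Z = b}"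
        have fXZ: "finite X" "finite Z" using X Z finT finite_subset by auto
        have cd: "card (I - X - Z) = card I - a - b"
        proof -
          have "card (I - X) = card I - a"
            using X T fXZ by (subst card_Diff_subset) auto
          moreover have "Z \<subseteq> I - X" using X Z T by auto
          ultimately show ?thesis using Z fXZ by (subst card_Diff_subset) auto
        qed
        have ss: "of_real s * of_real s = (1::complex)" using s2 by (metis of_real_1 of_real_mult)
        have e1: "?c * (\<i> * of_real s * of_real \<epsilon>) = of_real \<epsilon>"
          using ss by (simp add: mult.assoc[symmetric]) (simp add: mult_ac)
        have "idet (I - X - Z) (\<lambda>i j. ?c * of_real (H i j) +
            (if i = j then of_real \<epsilon> + (if i \<in> K then - ?c * z else 0) else 0)) =
          idet (I - X - Z) (\<lambda>i j. ?c * ?M i j * 1)"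
          by (rule idet_cong) (use e1 in \<open>auto simp: algebra_simps\<close>)
        also have "\<dots> = ?c ^ (card I - a - b) * idet (I - X - Z) ?M"
          unfolding idet_scale by (simp add: cd)
        finally show "idet (I - X - Z) (\<lambda>i j. ?c * of_real (H i j) +
            (if i = j then of_real \<epsilon> + (if i \<in> K then - ?c * z else 0) else 0)) =
          ?c ^ (card I - a - b) * idet (I - X - Z) ?M" .
      qed
      also have "\<dots> = ?c ^ (card I - a - b) * F \<epsilon> z"
        by (simp add: F_def sum_distrib_left)
      finally show ?thesis
        using sum_sum_minors_nonzero[OF acc fin T ab] by auto
    qed
    define e where "e m = inverse (real (Suc m))" for m
    have "q 0 = 0"
    proof (rule zero_limit_of_nonvanishing[where q = "\<lambda>m. q (e m)" and D = "card I" and ?x0.0 = z0])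
      show "degree (q (e m)) \<le> card I" for m
        unfolding q_def
      proof (intro degree_sum_le)
        fix X Z
        have "degree (idet (I - X - Z) (\<lambda>i j. [:of_real (H i j) + (if i = j then \<i> * of_real s * of_real (e m) else 0):]
         - (if i = j \<and> i \<in> K then [:0, 1:] else 0))) \<le> card (I - X - Z)"
          by (rule degree_idet_le) (use fin in auto)
        also have "\<dots> \<le> card I" using fin by (intro card_mono) auto
        finally show "degree (idet (I - X - Z) (\<lambda>i j. [:of_real (H i j) + (if i = j then \<i> * of_real s * of_real (e m) else 0):]
         - (if i = j \<and> i \<in> K then [:0, 1:] else 0))) \<le> card I" .
      qed (use finT in auto)
      show "0 < \<bar>Im z0\<bar>" using im by simp
      show "poly (q (e m)) z \<noteq> 0" if "cmod (z - z0) < \<bar>Im z0\<bar>" for m z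
        unfolding qF
      proof (rule nz)
        have "\<bar>Im z - Im z0\<bar> < \<bar>Im z0\<bar>" using abs_Im_le_cmod[of "z - z0"] that by simp
        then show "s * Im z < 0" by (auto simp: s_def abs_if split: if_splits)
      qed (simp add: e_def)
      show "(\<lambda>m. poly (q (e m)) z) \<longlonglongrightarrow> poly (q 0) z" for z
        unfolding qF F_def
      proof (intro tendsto_sum tendsto_idet)
        fix X Z i j
        have "(\<lambda>m. \<i> * of_real s * of_real (e m)) \<longlonglongrightarrow> \<i> * of_real s * of_real 0"
          using inverse_Suc_tendsto_0 unfolding e_def of_real_0 by (intro tendsto_mult tendsto_const)
        then show "(\<lambda>m. of_real (H i j) + (if i = j then \<i> * of_real s * of_real (e m) else 0)
            - (if i = j \<and> i \<in> K then z else 0)) \<longlonglongrightarrow>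
          of_real (H i j) + (if i = j then \<i> * of_real s * of_real 0 else 0)
            - (if i = j \<and> i \<in> K then z else 0)"
          by (intro tendsto_diff tendsto_add tendsto_const) auto
      qed
      have "of_real ((\<Prod>i\<in>I. \<sigma> i) * (-1) ^ b) * F 0 z0 = 0" using z0(1) QF by simp
      \<comment> \<open>The constant factor between \<open>cpoly Q\<close> and \<open>F 0\<close> is not zero, for otherwise \<open>Q\<close> would vanish identically.\<close>
      moreover have "poly (cpoly Q) z = 0" if "F 0 z0 \<noteq> 0" for z
        using calculation that by (simp add: QF)
      then have "F 0 z0 \<noteq> 0 \<Longrightarrow> cpoly Q = 0" using poly_all_0_iff_0 by blast
      ultimately show "poly (q 0) z0 = 0" using \<open>Q \<noteq> 0\<close> by (auto simp: qF)
    qed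
    then have "poly (cpoly Q) z = 0" for z by (simp add: QF qF[symmetric])
    then have "cpoly Q = 0" using poly_all_0_iff_0 by blast
    then show False using \<open>Q \<noteq> 0\<close> by simp
  qed
qed

lemma of_real_idet: "of_real (idet I f) = (idet I (\<lambda>i j. of_real (f i j)) :: complex)"
  by (simp add: idet_def)

lemma idet_diag:
  assumes "finite I"
  shows "idet I (\<lambda>i j. if i = j then y i else 0) = (\<Prod>i\<in>I. y i)"
proof -
  have "idet (I - X) (\<lambda>i j. 0) = (0::'b)" if X: "X \<in> Pow I - {I}" for X
  proof -
    obtain i where "i \<in> I - X" using X by blast
    then have "(\<Prod>i\<in>I - X. 0) = (0::'b)" using assms by (intro prod_zero) auto
    then show ?thesis by (simp add: idet_def)
  qed
  then have "(\<Sum>X\<in>Pow I. (\<Prod>i\<in>X. y i) * idet (I - X) (\<lambda>i j. 0)) =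
      (\<Sum>X\<in>{I}. (\<Prod>i\<in>X. y i) * idet (I - X) (\<lambda>i j. 0))"
    using assms by (intro sum.mono_neutral_right) auto
  then show ?thesis using idet_add_diag[OF assms, of "\<lambda>i j. 0" y] by simp
qed

text \<open>Shrinking \<open>N\<close> to zero keeps the matrix accretive, hence the determinant nonzero, and ends at a
  positive diagonal matrix.\<close>

lemma idet_pos:
  fixes N :: "'i \<Rightarrow> 'i \<Rightarrow> real"
  assumes fin: "finite J"
    and skew: "\<And>i j. i \<in> J \<Longrightarrow> j \<in> J \<Longrightarrow> i \<noteq> j \<Longrightarrow> N i j + N j i = 0"
    and diag: "\<And>i. i \<in> J \<Longrightarrow> 0 \<le> N i i" and y: "\<And>i. i \<in> J \<Longrightarrow> 0 < y i"
  shows "0 < idet J (\<lambda>i j. N i j + (if i = j then y i else 0))"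
proof (rule ccontr)
  define g where "g t = idet J (\<lambda>i j. t * N i j + (if i = j then y i else 0))" for t
  assume "\<not> ?thesis"
  then have "g 1 \<le> 0" by (simp add: g_def)
  moreover have "0 \<le> g 0"
    using y unfolding g_def by (simp add: idet_diag[OF fin] prod_nonneg less_imp_le)
  moreover have "isCont g t" for t
    unfolding isCont_def g_def by (intro tendsto_idet tendsto_intros)
  ultimately obtain t where t: "0 \<le> t" "t \<le> 1" "g t = 0"
    using IVT2[of g 1 0 0] by auto
  have "accretive J (\<lambda>i j. of_real (t * N i j) + (if i = j then of_real (y i) else 0))"
  proof (rule accretive_dissipative_plus_diag[OF fin])
    show "0 \<le> Re (qform J (\<lambda>i j. of_real (t * N i j)) v)" for v
    proof (rule Re_qform_nonneg[OF fin, where h = "\<lambda>i. 2 * t * N i i"])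
      fix i j assume "i \<in> J" "j \<in> J"
      then have "t * N i j + t * N j i = (if i = j then 2 * t * N i i else 0)"
        using skew[of i j] by (auto simp: ring_distribs[symmetric])
      then show "of_real (t * N i j) + cnj (of_real (t * N j i)) =
          (if i = j then complex_of_real (2 * t * N i i) else 0)"
        by (metis complex_cnj_complex_of_real of_real_0 of_real_add)
    qed (use t diag in auto)
  qed (use y in auto)
  from idet_accretive_nonzero[OF this fin] have "complex_of_real (g t) \<noteq> 0"
    unfolding g_def of_real_idet of_real_add if_distrib[of of_real] of_real_0 by simp
  then show False using t by simp
qed

text \<open>Adding a small positive diagonal makes the determinant positive by \<open>idet_pos\<close>.\<close>

lemma poly_pdet_nonneg:
  assumes fin: "finite J"
    and skew: "\<And>i j. i \<in> J \<Longrightarrow> j \<in> J \<Longrightarrow> i \<noteq> j \<Longrightarrow> \<sigma> i * H i j + \<sigma> j * H j i = 0"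
    and diag: "\<And>i. i \<in> J \<Longrightarrow> 0 \<le> \<sigma> i * H i i" and x: "0 \<le> x"
  shows "0 \<le> poly (pdet \<sigma> H K J) x"
proof -
  define e where "e m = inverse (real (Suc m))" for m
  have "(\<lambda>m. idet J (\<lambda>i j. \<sigma> i * H i j + (if i = j then e m + (if i \<in> K then x else 0) else 0)))
    \<longlonglongrightarrow> idet J (\<lambda>i j. \<sigma> i * H i j + (if i = j then 0 + (if i \<in> K then x else 0) else 0))"
  proof (rule tendsto_idet)
    fix i j
    have "(\<lambda>m. e m + (if i \<in> K then x else 0)) \<longlonglongrightarrow> 0 + (if i \<in> K then x else 0)"
      unfolding e_def by (intro tendsto_add tendsto_const LIMSEQ_inverse_real_of_nat)
    then show "(\<lambda>m. \<sigma> i * H i j + (if i = j then e m + (if i \<in> K then x else 0) else 0)) \<longlonglongrightarrow>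
      \<sigma> i * H i j + (if i = j then 0 + (if i \<in> K then x else 0) else 0)"
      by (intro tendsto_add tendsto_const) auto
  qed
  moreover have "0 \<le> idet J (\<lambda>i j. \<sigma> i * H i j + (if i = j then e m + (if i \<in> K then x else 0) else 0))" for m
    by (rule less_imp_le, rule idet_pos[OF fin skew diag]) (use x in \<open>auto simp: e_def add_pos_nonneg\<close>)
  ultimately have "0 \<le> idet J (\<lambda>i j. \<sigma> i * H i j + (if i = j then 0 + (if i \<in> K then x else 0) else 0))"
    by (intro LIMSEQ_le_const) auto
  also have "\<dots> = poly (pdet \<sigma> H K J) x"
    unfolding poly_pdet by (rule idet_cong) auto
  finally show ?thesis .
qed

text \<open>After a small diagonal perturbation the determinant has no zeros in the right half-plane, which
  contains a disc around \<open>x\<close>; the limit therefore vanishes identically if it vanishes at \<open>x\<close>.\<close>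

lemma pdet_eq_0_if_positive_root:
  assumes fin: "finite J"
    and skew: "\<And>i j. i \<in> J \<Longrightarrow> j \<in> J \<Longrightarrow> i \<noteq> j \<Longrightarrow> \<sigma> i * H i j + \<sigma> j * H j i = 0"
    and diag: "\<And>i. i \<in> J \<Longrightarrow> 0 \<le> \<sigma> i * H i i"
    and x: "0 < x" "poly (pdet \<sigma> H K J) x = 0"
  shows "pdet \<sigma> H K J = 0"
proof -
  define e where "e m = inverse (real (Suc m))" for m
  define q where "q m = idet J (\<lambda>i j. [:of_real (\<sigma> i * H i j) + (if i = j then complex_of_real (e m) else 0):]
     + (if i = j \<and> i \<in> K then [:0, 1:] else 0))" for m
  have ev: "poly (q m) z = idet J (\<lambda>i j. of_real (\<sigma> i * H i j) +
     (if i = j then of_real (e m) + (if i \<in> K then z else 0) else 0))" for m z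
    unfolding q_def poly_idet by (rule idet_cong) auto
  have "cpoly (pdet \<sigma> H K J) = 0"
  proof (rule zero_limit_of_nonvanishing[where q = q and D = "card J" and ?x0.0 = "of_real x"])
    show "degree (q m) \<le> card J" for m
      unfolding q_def by (rule degree_idet_le[OF fin]) auto
    show "0 < x" by (rule x)
    show "poly (q m) z \<noteq> 0" if z: "cmod (z - of_real x) < x" for m z
      unfolding ev
    proof (intro idet_accretive_nonzero[OF _ fin] accretive_dissipative_plus_diag[OF fin])
      have "\<bar>Re z - x\<bar> < x" using abs_Re_le_cmod[of "z - of_real x"] z by simp
      then show "0 < Re (of_real (e m) + (if i \<in> K then z else 0))" for i
        by (auto simp: e_def add_pos_pos)
      show "0 \<le> Re (qform J (\<lambda>i j. of_real (\<sigma> i * H i j)) v)" for v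
      proof (rule Re_qform_nonneg[OF fin, where h = "\<lambda>i. 2 * (\<sigma> i * H i i)"])
        fix i j assume "i \<in> J" "j \<in> J"
        then have "\<sigma> i * H i j + \<sigma> j * H j i = (if i = j then 2 * (\<sigma> i * H i i) else 0)"
          using skew[of i j] by auto
        then show "of_real (\<sigma> i * H i j) + cnj (of_real (\<sigma> j * H j i)) =
            (if i = j then complex_of_real (2 * (\<sigma> i * H i i)) else 0)"
          by (metis complex_cnj_complex_of_real of_real_0 of_real_add)
      qed (use diag in auto)
    qed
    show "(\<lambda>m. poly (q m) z) \<longlonglongrightarrow> poly (cpoly (pdet \<sigma> H K J)) z" for z
    proof -
      have "(\<lambda>m. poly (q m) z) \<longlonglongrightarrow> idet J (\<lambda>i j. of_real (\<sigma> i * H i j) +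
          (if i = j then 0 + (if i \<in> K then z else 0) else 0))"
        unfolding ev
      proof (rule tendsto_idet)
        fix i j
        have "(\<lambda>m. of_real (e m) + (if i \<in> K then z else 0)) \<longlonglongrightarrow> 0 + (if i \<in> K then z else 0)"
          unfolding e_def by (intro tendsto_add tendsto_const inverse_Suc_tendsto_0)
        then show "(\<lambda>m. of_real (\<sigma> i * H i j) + (if i = j then of_real (e m) + (if i \<in> K then z else 0) else 0))
          \<longlonglongrightarrow> of_real (\<sigma> i * H i j) + (if i = j then 0 + (if i \<in> K then z else 0) else 0)"
          by (intro tendsto_add tendsto_const) auto
      qed
      also have "idet J (\<lambda>i j. of_real (\<sigma> i * H i j) +
          (if i = j then 0 + (if i \<in> K then z else 0) else 0)) = poly (cpoly (pdet \<sigma> H K J)) z"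
        unfolding poly_cpoly_pdet by (rule idet_cong) auto
      finally show ?thesis .
    qed
    show "poly (cpoly (pdet \<sigma> H K J)) (of_real x) = 0" using x(2) by simp
  qed
  then show ?thesis by simp
qed

section \<open>Selecting a summand by its smallest root\<close>

text \<open>The polynomial \<open>u ^ d * f (1 / u)\<close>.  In contrast to \<^const>\<open>reflect_poly\<close> the exponent is the
  nominal degree \<open>d\<close>, so the map is linear and a drop of the degree shows up as a root at \<open>0\<close>.\<close>

definition rev_poly :: "nat \<Rightarrow> 'a::comm_ring_1 poly \<Rightarrow> 'a poly" where
  "rev_poly d f = (\<Sum>j\<le>d. monom (coeff f j) (d - j))"

lemma rev_poly_add: "rev_poly d (f + g) = rev_poly d f + rev_poly d g"
  by (simp add: rev_poly_def sum.distrib add_monom[symmetric])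

lemma rev_poly_smult: "rev_poly d (smult c f) = smult c (rev_poly d f)"
  by (simp add: rev_poly_def smult_sum2 smult_monom)

lemma cpoly_rev_poly: "cpoly (rev_poly d f) = rev_poly d (cpoly f)"
proof -
  interpret c: map_poly_comm_ring_hom complex_of_real ..
  show ?thesis by (simp add: rev_poly_def c.hom_sum map_poly_monom coeff_map_poly)
qed

lemma poly_rev_poly:
  fixes f :: "'a::field poly"
  assumes "degree f \<le> d" "u \<noteq> 0"
  shows "poly (rev_poly d f) u = u ^ d * poly f (1 / u)"
proof -
  have "poly (rev_poly d f) u = (\<Sum>j\<le>d. coeff f j * u ^ (d - j))"
    by (simp add: rev_poly_def poly_sum poly_monom)
  also have "\<dots> = (\<Sum>j\<le>d. u ^ d * (coeff f j * (1 / u) ^ j))"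
    using assms(2) by (intro sum.cong refl) (simp add: power_diff power_one_over field_simps)
  also have "\<dots> = u ^ d * (\<Sum>j\<le>d. coeff f j * (1 / u) ^ j)"
    by (simp add: sum_distrib_left)
  also have "(\<Sum>j\<le>d. coeff f j * (1 / u) ^ j) = (\<Sum>j\<le>degree f. coeff f j * (1 / u) ^ j)"
    using assms(1) by (intro sum.mono_neutral_right) (auto simp: coeff_eq_0)
  finally show ?thesis by (simp add: poly_altdef)
qed

lemma coeff_rev_poly: "j \<le> d \<Longrightarrow> coeff (rev_poly d f) (d - j) = coeff f j"
proof -
  assume j: "j \<le> d"
  have "coeff (rev_poly d f) (d - j) = (\<Sum>i\<le>d. if d - i = d - j then coeff f i else 0)"
    by (simp add: rev_poly_def coeff_sum)
  also have "\<dots> = (\<Sum>i\<le>d. if i = j then coeff f i else 0)"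
    using j by (intro sum.cong refl) auto
  finally show ?thesis using j by simp
qed

lemma poly_rev_poly_0: "poly (rev_poly d f) 0 = coeff f d"
  using coeff_rev_poly[of d d f] by (simp add: poly_0_coeff_0)

lemma rev_poly_nonzero:
  assumes "degree f \<le> d" "f \<noteq> 0"
  shows "rev_poly d f \<noteq> 0"
  using coeff_rev_poly[OF assms(1), of f] assms(2) by auto

lemma real_rooted_rev_poly:
  assumes "real_rooted f" "degree f \<le> d"
  shows "real_rooted (rev_poly d f)"
  unfolding real_rooted_def
proof (intro conjI allI impI)
  show "rev_poly d f \<noteq> 0"
    using rev_poly_nonzero[OF assms(2)] assms(1) by (simp add: real_rooted_def)
  fix z :: complex assume z: "poly (cpoly (rev_poly d f)) z = 0"
  show "z \<in> \<real>"
  proof (cases "z = 0")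
    case False
    have "degree (cpoly f) \<le> d" using assms(2) by (simp add: degree_map_poly)
    then have "poly (cpoly f) (1 / z) = 0"
      using z False by (simp add: cpoly_rev_poly poly_rev_poly)
    then have "1 / z \<in> \<real>" using assms(1) by (simp add: real_rooted_def)
    then have "inverse (1 / z) \<in> \<real>" by (rule Reals_inverse)
    then show ?thesis by simp
  qed simp
qed

text \<open>A polynomial of degree less than \<open>d\<close> is regarded as having a root at minus infinity; hence the
  condition on the coefficient.\<close>

definition no_root_below :: "nat \<Rightarrow> real \<Rightarrow> real poly \<Rightarrow> bool" where
  "no_root_below d r f \<longleftrightarrow> coeff f d \<noteq> 0 \<and> (\<forall>x<r. poly f x \<noteq> 0)"

lemma largest_root:
  fixes f :: "real poly"
  assumes "f \<noteq> 0" "poly f u = 0"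
  obtains \<alpha> where "u \<le> \<alpha>" "poly f \<alpha> = 0" "\<And>x. \<alpha> < x \<Longrightarrow> poly f x \<noteq> 0"
proof
  have fin: "finite {x. poly f x = 0}" using assms(1) by (rule poly_roots_finite)
  show "u \<le> Max {x. poly f x = 0}" using fin assms(2) by (intro Max_ge) auto
  show "poly f (Max {x. poly f x = 0}) = 0"
    using Max_in[OF fin] assms(2) by auto
  show "poly f x \<noteq> 0" if "Max {x. poly f x = 0} < x" for x
    using Max_ge[OF fin, of x] that by auto
qed

lemma poly_pos_above_roots:
  fixes f :: "real poly"
  assumes "\<And>x. \<alpha> < x \<Longrightarrow> poly f x \<noteq> 0" "\<alpha> < c" "0 < poly f c" "\<alpha> < x"
  shows "0 < poly f x"
proof (rule ccontr)
  assume "\<not> 0 < poly f x"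
  then have neg: "poly f x < 0" using assms(1)[OF assms(4)] by simp
  consider "x < c" | "c < x" using neg assms(3) by (cases x c rule: linorder_cases) auto
  then show False
  proof cases
    case 1
    then show False using poly_IVT_pos[OF 1 neg assms(3)] assms(1,4) by fastforce
  next
    case 2
    then show False using poly_IVT_neg[OF 2 assms(3) neg] assms(1,2) by fastforce
  qed
qed

text \<open>At the largest root \<open>\<beta>\<close> of \<open>g\<close> the polynomial \<open>f\<close> is nonpositive, by
  \<open>real_rooted_combination_sign\<close>, and far to the right the sum is positive.\<close>

lemma sum_root_above_smaller_root:
  fixes f g :: "real poly"
  assumes rr: "\<And>t. 0 < t \<Longrightarrow> real_rooted (f + smult t g)"
    and f: "\<And>x. 0 < x \<Longrightarrow> 0 < poly f x" and g: "\<And>x. 0 < x \<Longrightarrow> 0 < poly g x"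
    and \<alpha>: "poly f \<alpha> = 0"
    and \<beta>: "poly g \<beta> = 0" "\<And>x. \<beta> < x \<Longrightarrow> poly g x \<noteq> 0" and le: "\<beta> \<le> \<alpha>"
  shows "\<exists>w\<ge>\<beta>. w \<le> 0 \<and> poly (f + g) w = 0"
proof -
  have \<alpha>0: "\<alpha> \<le> 0" using f[of \<alpha>] \<alpha> by (cases "0 < \<alpha>") auto
  have "poly f \<beta> \<le> 0"
  proof (cases "\<beta> = \<alpha>")
    case False
    have "0 < poly g x" if "\<beta> < x" for x
      using poly_pos_above_roots[OF \<beta>(2), where c = 1 and x = x] g[of 1] that le \<alpha>0 by simp
    then show ?thesis
      by (intro real_rooted_combination_sign[OF rr \<alpha>, where c = 1]) (use False le \<alpha>0 f[of 1] in auto)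
  qed (use \<alpha> in auto)
  then have le0: "poly (f + g) \<beta> \<le> 0" using \<beta>(1) by simp
  have pos: "0 < poly (f + g) x" if "0 < x" for x using f[OF that] g[OF that] by simp
  have "\<exists>w\<ge>\<beta>. poly (f + g) w = 0"
  proof (cases "poly (f + g) \<beta> = 0")
    case False
    then have "poly (f + g) \<beta> < 0" using le0 by simp
    moreover have "\<beta> < 1" using le \<alpha>0 by simp
    moreover have "0 < poly (f + g) 1" by (rule pos) simp
    ultimately show ?thesis using poly_IVT_pos[of \<beta> 1 "f + g"] less_imp_le by blast
  qed auto
  then show ?thesis using pos by (metis less_irrefl not_le)
qed

text \<open>In the variable \<open>u = 1 / x\<close> the forbidden set, minus infinity together with the points below \<open>r\<close>,
  becomes a set of nonpositive numbers \<open>u\<close> that contains with each element all larger nonpositive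
  numbers.  If both reversed summands had a root in it, then the reversed sum would have a root at
  or above the smaller of their two largest roots, hence also in this set.\<close>

lemma no_root_below_summand:
  fixes f g :: "real poly"
  assumes rr: "\<And>t. 0 < t \<Longrightarrow> real_rooted (f + smult t g)"
    and deg: "degree f \<le> d" "degree g \<le> d"
    and f: "\<And>x. 0 < x \<Longrightarrow> 0 < poly f x" and g: "\<And>x. 0 < x \<Longrightarrow> 0 < poly g x"
    and r: "r \<le> 0" and good: "no_root_below d r (f + g)"
  shows "no_root_below d r f \<or> no_root_below d r g"
proof (rule ccontr)
  assume neg: "\<not> ?thesis"
  let ?V = "\<lambda>u. u \<le> 0 \<and> (u = 0 \<or> 1 / u < r)"
  have V_mono: "?V u'" if "?V u" "u \<le> u'" "u' \<le> 0" for u u' :: real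
  proof (cases "u' = 0")
    case False
    then have "u < 0" "u' < 0" using that by auto
    then have "1 / u' \<le> 1 / u" using that(2) by (simp add: field_simps)
    then show ?thesis using that \<open>u < 0\<close> by auto
  qed auto
  have bad: "\<exists>u. poly (rev_poly d h) u = 0 \<and> ?V u" if bh: "\<not> no_root_below d r h" and dh: "degree h \<le> d" for h
  proof -
    consider "coeff h d = 0" | x where "x < r" "poly h x = 0"
      using bh unfolding no_root_below_def by blast
    then show ?thesis
    proof cases
      case 1
      then show ?thesis by (intro exI[of _ 0]) (simp add: poly_rev_poly_0)
    next
      case 2
      then show ?thesis using r dh
        by (intro exI[of _ "1 / x"]) (auto simp: poly_rev_poly)
    qed
  qed
  have good': "\<not> (poly (rev_poly d f + rev_poly d g) u = 0 \<and> ?V u)" for u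
  proof
    assume u: "poly (rev_poly d f + rev_poly d g) u = 0 \<and> ?V u"
    then have 0: "poly (rev_poly d (f + g)) u = 0" by (simp add: rev_poly_add)
    show False
    proof (cases "u = 0")
      case True
      then show False using 0 good by (simp add: poly_rev_poly_0 no_root_below_def)
    next
      case False
      have "degree (f + g) \<le> d" using deg by (rule degree_add_le)
      from poly_rev_poly[OF this False] have "poly (f + g) (1 / u) = 0"
        using 0 False by (metis mult_eq_0_iff power_not_zero)
      then show False using u False good by (auto simp: no_root_below_def)
    qed
  qed
  have nz: "f \<noteq> 0" "g \<noteq> 0" using f[of 1] g[of 1] by auto
  have pf: "0 < poly (rev_poly d f) u" if "0 < u" for u
    using f[of "1 / u"] that deg by (simp add: poly_rev_poly)
  have pg: "0 < poly (rev_poly d g) u" if "0 < u" for u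
    using g[of "1 / u"] that deg by (simp add: poly_rev_poly)
  obtain u1 where u1: "poly (rev_poly d f) u1 = 0" "?V u1" using bad[of f] neg deg by blast
  obtain u2 where u2: "poly (rev_poly d g) u2 = 0" "?V u2" using bad[of g] neg deg by blast
  obtain \<alpha> where \<alpha>: "u1 \<le> \<alpha>" "poly (rev_poly d f) \<alpha> = 0" "\<And>x. \<alpha> < x \<Longrightarrow> poly (rev_poly d f) x \<noteq> 0"
    using largest_root[OF rev_poly_nonzero[OF deg(1) nz(1)] u1(1)] by blast
  obtain \<beta> where \<beta>: "u2 \<le> \<beta>" "poly (rev_poly d g) \<beta> = 0" "\<And>x. \<beta> < x \<Longrightarrow> poly (rev_poly d g) x \<noteq> 0"
    using largest_root[OF rev_poly_nonzero[OF deg(2) nz(2)] u2(1)] by blast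
  have V: "?V \<alpha>" "?V \<beta>"
    using V_mono[OF u1(2) \<alpha>(1)] V_mono[OF u2(2) \<beta>(1)] \<alpha>(2) \<beta>(2) pf[of \<alpha>] pg[of \<beta>]
    by (metis less_irrefl not_le)+
  have rr1: "real_rooted (rev_poly d f + smult t (rev_poly d g))" if "0 < t" for t
  proof -
    have "degree (f + smult t g) \<le> d"
      using deg degree_smult_le[of t g] by (intro degree_add_le) auto
    from real_rooted_rev_poly[OF rr[OF that] this] show ?thesis
      by (simp add: rev_poly_add rev_poly_smult)
  qed
  have rr2: "real_rooted (rev_poly d g + smult t (rev_poly d f))" if "0 < t" for t
  proof -
    have "rev_poly d g + smult t (rev_poly d f) = smult t (rev_poly d f + smult (1 / t) (rev_poly d g))"
      using that by (simp add: smult_add_right)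
    moreover have "real_rooted (rev_poly d f + smult (1 / t) (rev_poly d g))"
      using rr1[of "1 / t"] that by simp
    ultimately show ?thesis using that
      by (simp add: real_rooted_def of_real_hom.map_poly_hom_smult)
  qed
  show False
  proof (cases "\<beta> \<le> \<alpha>")
    case True
    then obtain w where "\<beta> \<le> w" "w \<le> 0" "poly (rev_poly d f + rev_poly d g) w = 0"
      using sum_root_above_smaller_root[OF rr1 pf pg \<alpha>(2) \<beta>(2,3)] by blast
    then show False using good' V_mono[OF V(2)] by blast
  next
    case False
    then have "\<alpha> \<le> \<beta>" by simp
    then obtain w where "\<alpha> \<le> w" "w \<le> 0" "poly (rev_poly d g + rev_poly d f) w = 0"
      using sum_root_above_smaller_root[OF rr2 pg pf \<beta>(2) \<alpha>(2,3)] by blast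
    then show False using good' V_mono[OF V(1)] by (metis add.commute)
  qed
qed

text \<open>The elements of \<open>E\<close> are decided one at a time: the members of \<open>\<F>\<close> that contain \<open>In\<close> and avoid
  \<open>Out\<close> are split by whether they contain the next element \<open>e\<close>, and \<open>no_root_below_summand\<close> tells
  which of the two halves to keep.\<close>

lemma select_summand:
  fixes p :: "'e set \<Rightarrow> real poly" and \<F> :: "'e set set"
  defines "S \<equiv> \<lambda>In Out. \<Sum>X | X \<in> \<F> \<and> In \<subseteq> X \<and> X \<inter> Out = {}. p X"
  assumes finE: "finite E" and \<F>: "\<F> \<subseteq> Pow E"
    and deg: "\<And>X. X \<in> \<F> \<Longrightarrow> degree (p X) \<le> d"
    and nonneg: "\<And>X x. X \<in> \<F> \<Longrightarrow> 0 < x \<Longrightarrow> 0 \<le> poly (p X) x"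
    and zero: "\<And>X x. X \<in> \<F> \<Longrightarrow> 0 < x \<Longrightarrow> poly (p X) x = 0 \<Longrightarrow> p X = 0"
    and rr: "\<And>In Out e t. In \<subseteq> E \<Longrightarrow> Out \<subseteq> E \<Longrightarrow> In \<inter> Out = {} \<Longrightarrow> e \<in> E - In - Out \<Longrightarrow> 0 < t \<Longrightarrow>
      S (insert e In) Out + smult t (S In (insert e Out)) = 0 \<or>
      real_rooted (S (insert e In) Out + smult t (S In (insert e Out)))"
    and r: "r \<le> 0" and good: "no_root_below d r (\<Sum>X\<in>\<F>. p X)"
  shows "\<exists>X\<in>\<F>. no_root_below d r (p X)"
proof -
  have fin\<F>: "finite \<F>" using \<F> finE finite_subset by blast
  have pos: "0 < poly (S In Out) x" if "S In Out \<noteq> 0" "0 < x" for In Out x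
  proof (rule ccontr)
    assume "\<not> 0 < poly (S In Out) x"
    moreover have "0 \<le> poly (S In Out) x"
      unfolding S_def poly_sum by (rule sum_nonneg) (use nonneg that in auto)
    ultimately have "(\<Sum>X | X \<in> \<F> \<and> In \<subseteq> X \<and> X \<inter> Out = {}. poly (p X) x) = 0"
      by (simp add: S_def poly_sum)
    then have "\<forall>X\<in>{X. X \<in> \<F> \<and> In \<subseteq> X \<and> X \<inter> Out = {}}. poly (p X) x = 0"
      by (subst (asm) sum_nonneg_eq_0_iff) (use fin\<F> nonneg that in auto)
    then have "\<forall>X\<in>{X. X \<in> \<F> \<and> In \<subseteq> X \<and> X \<inter> Out = {}}. p X = 0"
      using zero that by blast
    then have "S In Out = 0" unfolding S_def by (intro sum.neutral)
    then show False using that by simp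
  qed
  have degS: "degree (S In Out) \<le> d" for In Out
    unfolding S_def by (rule degree_sum_le) (use fin\<F> deg in auto)
  have "\<exists>X\<in>\<F>. no_root_below d r (p X)"
    if "In \<subseteq> E" "Out \<subseteq> E" "In \<inter> Out = {}" "no_root_below d r (S In Out)" for In Out
    using that
  proof (induction "card (E - In - Out)" arbitrary: In Out rule: less_induct)
    case less
    show ?case
    proof (cases "E - In - Out = {}")
      case True
      have sub: "{X. X \<in> \<F> \<and> In \<subseteq> X \<and> X \<inter> Out = {}} \<subseteq> {In}"
        using True \<F> by blast
      show ?thesis
      proof (cases "In \<in> \<F>")
        case True
        then have "{X. X \<in> \<F> \<and> In \<subseteq> X \<and> X \<inter> Out = {}} = {In}"
          using sub less.prems by auto
        then have "S In Out = p In" by (simp add: S_def)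
        then show ?thesis using less.prems True by auto
      next
        case False
        then have "{X. X \<in> \<F> \<and> In \<subseteq> X \<and> X \<inter> Out = {}} = {}" using sub by blast
        then have "S In Out = 0" unfolding S_def by (simp only: sum.empty)
        then show ?thesis using less.prems by (simp add: no_root_below_def)
      qed
    next
      case False
      then obtain e where e: "e \<in> E - In - Out" by blast
      let ?f = "S (insert e In) Out" and ?g = "S In (insert e Out)"
      have split: "S In Out = ?f + ?g"
      proof -
        have "{X. X \<in> \<F> \<and> In \<subseteq> X \<and> X \<inter> Out = {}} =
          {X. X \<in> \<F> \<and> insert e In \<subseteq> X \<and> X \<inter> Out = {}} \<union> {X. X \<in> \<F> \<and> In \<subseteq> X \<and> X \<inter> insert e Out = {}}"
          by blast
        then show ?thesis unfolding S_def
          by (simp only:) (rule sum.union_disjoint, use fin\<F> in auto)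
      qed
      have "no_root_below d r ?f \<or> no_root_below d r ?g"
      proof (cases "?f = 0 \<or> ?g = 0")
        case True
        then show ?thesis using less.prems(4) split by auto
      next
        case False
        then have nz: "?f \<noteq> 0" "?g \<noteq> 0" by auto
        have "real_rooted (?f + smult t ?g)" if t: "0 < t" for t
        proof -
          have "0 < poly (?f + smult t ?g) 1"
            using pos[OF nz(1), of 1] pos[OF nz(2), of 1] t by (simp add: add_pos_pos)
          then have "?f + smult t ?g \<noteq> 0" by force
          then show ?thesis using rr[OF less.prems(1-3) e t] by blast
        qed
        then show ?thesis
          using no_root_below_summand[OF _ degS degS pos[OF nz(1)] pos[OF nz(2)] r] less.prems(4) split
          by (simp only:)
      qed
      moreover have "card (E - insert e In - Out) < card (E - In - Out)"
        "card (E - In - insert e Out) < card (E - In - Out)"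
        using e finE by (intro psubset_card_mono; force)+
      ultimately show ?thesis
        using less.hyps[of "insert e In" Out] less.hyps[of In "insert e Out"] less.prems e by blast
    qed
  qed
  from this[of "{}" "{}"] good show ?thesis by (simp add: S_def)
qed

section \<open>Selection among principal minors\<close>

lemma idet_const_poly: "idet I (\<lambda>i j. [:f i j :: real:]) = [:idet I f:]"
  by (rule poly_ext) (simp add: poly_idet)

lemma pdet_expand:
  assumes "finite J"
  shows "pdet \<sigma> H K J = (\<Sum>Y\<in>Pow (J \<inter> K). monom (idet (J - Y) (\<lambda>i j. \<sigma> i * H i j)) (card Y))"
proof -
  have "pdet \<sigma> H K J = idet J (\<lambda>i j. [:\<sigma> i * H i j:] + (if i = j \<and> i \<in> J \<inter> K then [:0, 1:] else 0))"
    unfolding pdet_def by (rule idet_cong) auto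
  also have "\<dots> = (\<Sum>Y\<in>Pow (J \<inter> K). [:0, 1:] ^ card Y * [:idet (J - Y) (\<lambda>i j. \<sigma> i * H i j):])"
    by (subst idet_add_diag_on) (use assms in \<open>auto simp: idet_const_poly\<close>)
  finally show ?thesis by (simp add: monom_altdef)
qed

lemma degree_pdet_le:
  assumes "finite J"
  shows "degree (pdet \<sigma> H K J) \<le> card (J \<inter> K)"
  unfolding pdet_expand[OF assms]
proof (rule degree_sum_le)
  fix Y assume "Y \<in> Pow (J \<inter> K)"
  then have "card Y \<le> card (J \<inter> K)" using assms by (intro card_mono) auto
  then show "degree (monom (idet (J - Y) (\<lambda>i j. \<sigma> i * H i j)) (card Y)) \<le> card (J \<inter> K)"
    using degree_monom_le order_trans by blast
qed (use assms in auto)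

lemma coeff_pdet_top:
  assumes "finite J"
  shows "coeff (pdet \<sigma> H K J) (card (J \<inter> K)) = idet (J - K) (\<lambda>i j. \<sigma> i * H i j)"
proof -
  have "coeff (pdet \<sigma> H K J) (card (J \<inter> K)) =
     (\<Sum>Y\<in>Pow (J \<inter> K). if card Y = card (J \<inter> K) then idet (J - Y) (\<lambda>i j. \<sigma> i * H i j) else 0)"
    unfolding pdet_expand[OF assms] by (simp add: coeff_sum)
  also have "\<dots> = (\<Sum>Y\<in>Pow (J \<inter> K). if Y = J \<inter> K then idet (J - Y) (\<lambda>i j. \<sigma> i * H i j) else 0)"
    using assms card_subset_eq[of "J \<inter> K"] by (intro sum.cong refl) auto
  also have "\<dots> = idet (J - K) (\<lambda>i j. \<sigma> i * H i j)"
    using assms by (simp add: Diff_Int)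
  finally show ?thesis .
qed

text \<open>Scaling rows and columns by the same factors leaves the diagonal entries with the variable
  unchanged as long as the factors are \<open>1\<close> on \<open>K\<close>.\<close>

lemma pdet_scale:
  assumes "finite J" "\<And>i. i \<in> K \<Longrightarrow> s i = 1"
  shows "pdet \<sigma> (\<lambda>i j. s i * H i j * s j) K J = smult ((\<Prod>i\<in>J. s i)\<^sup>2) (pdet \<sigma> H K J)"
proof (rule poly_ext)
  fix x
  have "poly (pdet \<sigma> (\<lambda>i j. s i * H i j * s j) K J) x =
    idet J (\<lambda>i j. s i * (\<sigma> i * H i j + (if i = j \<and> i \<in> K then x else 0)) * s j)"
    unfolding poly_pdet by (rule idet_cong) (use assms in \<open>auto simp: mult_ac\<close>)
  then show "poly (pdet \<sigma> (\<lambda>i j. s i * H i j * s j) K J) x = poly (smult ((\<Prod>i\<in>J. s i)\<^sup>2) (pdet \<sigma> H K J)) x"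
    by (simp add: idet_scale poly_pdet power2_eq_square)
qed

text \<open>Forcing the indices in \<open>In\<close> means never removing them, and forbidding those in \<open>Out\<close> means
  deleting them from the matrix.  The remaining sum ranges over the removal of a fixed number of
  indices from each of the two blocks of undecided indices.\<close>

lemma restricted_sum_real_rooted:
  fixes k :: nat
  assumes fin: "finite B" "finite E1" "finite E2"
    and disj: "B \<inter> E1 = {}" "B \<inter> E2 = {}" "E1 \<inter> E2 = {}"
    and sym: "\<And>i j. i \<in> B \<union> E1 \<union> E2 \<Longrightarrow> j \<in> B \<union> E1 \<union> E2 \<Longrightarrow> H i j = H j i"
    and K: "\<And>i. i \<in> K \<Longrightarrow> \<sigma> i = -1"
    and \<sigma>: "\<And>i. i \<in> E1 \<Longrightarrow> \<sigma> i = 1" "\<And>i. i \<in> E2 \<Longrightarrow> \<sigma> i = -1"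
    and InOut: "In \<subseteq> E1 \<union> E2" "Out \<subseteq> E1 \<union> E2" "In \<inter> Out = {}"
  defines "Q \<equiv> \<Sum>X | (X \<subseteq> E1 \<union> E2 \<and> card (X \<inter> E1) = k \<and> card (X \<inter> E2) = k) \<and> In \<subseteq> X \<and> X \<inter> Out = {}.
      pdet \<sigma> H K (B \<union> X)"
  shows "Q = 0 \<or> real_rooted Q"
proof -
  define I where "I = B \<union> (E1 \<union> E2 - Out)"
  define T1 where "T1 = E1 - In - Out"
  define T2 where "T2 = E2 - In - Out"
  \<comment> \<open>The numbers of indices to be removed from the two blocks.\<close>
  define a where "a = card (E1 - Out) - k"
  define b where "b = card (E2 - Out) - k"
  let ?\<X> = "{X. (X \<subseteq> E1 \<union> E2 \<and> card (X \<inter> E1) = k \<and> card (X \<inter> E2) = k) \<and> In \<subseteq> X \<and> X \<inter> Out = {}}"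
  let ?A = "{X. X \<subseteq> T1 \<and> card X = a}" and ?B = "{Z. Z \<subseteq> T2 \<and> card Z = b}"
  have finT: "finite T1" "finite T2" using fin by (auto simp: T1_def T2_def)
  show ?thesis
  proof (cases "k \<le> card (E1 - Out) \<and> k \<le> card (E2 - Out) \<and> a \<le> card T1 \<and> b \<le> card T2")
    case False
    have "?\<X> = {}"
    proof (rule ccontr)
      assume "?\<X> \<noteq> {}"
      then obtain X where X: "X \<subseteq> E1 \<union> E2" "card (X \<inter> E1) = k" "card (X \<inter> E2) = k" "In \<subseteq> X" "X \<inter> Out = {}"
        by blast
      have k1: "k \<le> card (E1 - Out)" unfolding X(2)[symmetric] using X fin by (intro card_mono) auto
      have k2: "k \<le> card (E2 - Out)" unfolding X(3)[symmetric] using X fin by (intro card_mono) auto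
      have "a = card (E1 - Out - (X \<inter> E1))"
        unfolding a_def X(2)[symmetric] using X fin by (intro card_Diff_subset[symmetric]) auto
      also have "\<dots> \<le> card T1" using X fin by (intro card_mono) (auto simp: T1_def)
      finally have a1: "a \<le> card T1" .
      have "b = card (E2 - Out - (X \<inter> E2))"
        unfolding b_def X(3)[symmetric] using X fin by (intro card_Diff_subset[symmetric]) auto
      also have "\<dots> \<le> card T2" using X fin by (intro card_mono) (auto simp: T2_def)
      finally show False using False k1 k2 a1 by blast
    qed
    then have "Q = 0" unfolding Q_def by (simp only: sum.empty)
    then show ?thesis ..
  next
    case True
    have "Q = (\<Sum>XZ\<in>?A \<times> ?B. pdet \<sigma> H K (I - fst XZ - snd XZ))"
      unfolding Q_def
    proof (rule sum.reindex_bij_witness[where j = "\<lambda>X. (E1 - Out - X, E2 - Out - X)"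
          and i = "\<lambda>XZ. E1 \<union> E2 - Out - fst XZ - snd XZ"])
      fix X assume "X \<in> ?\<X>"
      then have X: "X \<subseteq> E1 \<union> E2" "card (X \<inter> E1) = k" "card (X \<inter> E2) = k" "In \<subseteq> X" "X \<inter> Out = {}"
        by auto
      show "E1 \<union> E2 - Out - fst (E1 - Out - X, E2 - Out - X) - snd (E1 - Out - X, E2 - Out - X) = X"
        using X by auto
      have e: "E1 - Out - X = E1 - Out - (X \<inter> E1)" "E2 - Out - X = E2 - Out - (X \<inter> E2)" by auto
      have le: "X \<inter> E1 \<subseteq> E1 - Out" "X \<inter> E2 \<subseteq> E2 - Out" using X by auto
      have "card (E1 - Out - X) = a" "card (E2 - Out - X) = b"
        unfolding a_def b_def e using card_Diff_subset[OF _ le(1)] card_Diff_subset[OF _ le(2)] X(2,3) fin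
        by simp_all
      then show "(E1 - Out - X, E2 - Out - X) \<in> ?A \<times> ?B"
        using X by (auto simp: T1_def T2_def)
      have "I - (E1 - Out - X) - (E2 - Out - X) = B \<union> X"
        unfolding I_def using X disj by auto
      then show "pdet \<sigma> H K (I - fst (E1 - Out - X, E2 - Out - X) - snd (E1 - Out - X, E2 - Out - X)) =
          pdet \<sigma> H K (B \<union> X)" by simp
    next
      fix XZ assume "XZ \<in> ?A \<times> ?B"
      then obtain X Z where XZ: "XZ = (X, Z)" "X \<subseteq> T1" "card X = a" "Z \<subseteq> T2" "card Z = b" by auto
      let ?X = "E1 \<union> E2 - Out - X - Z"
      have "E1 - Out - ?X = X" "E2 - Out - ?X = Z"
        using XZ disj by (auto simp: T1_def T2_def)
      then show "(E1 - Out - (E1 \<union> E2 - Out - fst XZ - snd XZ), E2 - Out - (E1 \<union> E2 - Out - fst XZ - snd XZ)) = XZ"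
        by (simp add: XZ(1))
      have e: "?X \<inter> E1 = E1 - Out - X" "?X \<inter> E2 = E2 - Out - Z"
        using XZ disj by (auto simp: T1_def T2_def)
      have "X \<subseteq> E1 - Out" "Z \<subseteq> E2 - Out" using XZ by (auto simp: T1_def T2_def)
      then have "card (?X \<inter> E1) = k" "card (?X \<inter> E2) = k"
        unfolding e using XZ True finT finite_subset[OF XZ(2)] finite_subset[OF XZ(4)]
        by (auto simp: card_Diff_subset a_def b_def)
      moreover have "In \<subseteq> ?X" "?X \<inter> Out = {}" "?X \<subseteq> E1 \<union> E2"
        using XZ InOut by (auto simp: T1_def T2_def)
      ultimately show "E1 \<union> E2 - Out - fst XZ - snd XZ \<in> ?\<X>" by (simp add: XZ(1))
    qed
    also have "\<dots> = (\<Sum>X\<in>?A. \<Sum>Z\<in>?B. pdet \<sigma> H K (I - X - Z))"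
      by (subst sum.cartesian_product) (simp add: case_prod_unfold)
    finally show ?thesis
      using True fin disj \<sigma> K sym
      by (simp only:) (intro sum_sum_pdet_real_rooted; auto simp: I_def T1_def T2_def)
  qed
qed

text \<open>The positive combinations required by \<open>select_summand\<close> are sums of the same kind for a rescaled
  matrix, because a factor \<open>s\<close> on the row and the column of \<open>e\<close> multiplies exactly the minors that
  contain \<open>e\<close> by \<open>s\<^sup>2\<close>.\<close>

lemma select_pdet:
  fixes k :: nat
  assumes fin: "finite B" "finite E1" "finite E2"
    and disj: "B \<inter> E1 = {}" "B \<inter> E2 = {}" "E1 \<inter> E2 = {}"
    and sym: "\<And>i j. H i j = H j i"
    and K: "\<And>i. i \<in> K \<Longrightarrow> \<sigma> i = -1" "K \<subseteq> B"
    and \<sigma>: "\<And>i. i \<in> E1 \<Longrightarrow> \<sigma> i = 1" "\<And>i. i \<in> E2 \<Longrightarrow> \<sigma> i = -1"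
    and skew: "\<And>i j. i \<noteq> j \<Longrightarrow> \<sigma> i * H i j + \<sigma> j * H j i = 0"
    and diag: "\<And>i. 0 \<le> \<sigma> i * H i i"
    and r: "r \<le> 0"
  defines "\<F> \<equiv> {X. X \<subseteq> E1 \<union> E2 \<and> card (X \<inter> E1) = k \<and> card (X \<inter> E2) = k}"
  assumes good: "no_root_below (card K) r (\<Sum>X\<in>\<F>. pdet \<sigma> H K (B \<union> X))"
  shows "\<exists>X\<in>\<F>. no_root_below (card K) r (pdet \<sigma> H K (B \<union> X)) \<and> real_rooted (pdet \<sigma> H K (B \<union> X))"
proof -
  have fJ: "finite (B \<union> X)" if "X \<in> \<F>" for X
    using that fin finite_subset[of X "E1 \<union> E2"] by (auto simp: \<F>_def)
  have JK: "(B \<union> X) \<inter> K = K" for X using K(2) by auto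
  have "\<exists>X\<in>\<F>. no_root_below (card K) r (pdet \<sigma> H K (B \<union> X))"
  proof (rule select_summand[where E = "E1 \<union> E2"])
    show "degree (pdet \<sigma> H K (B \<union> X)) \<le> card K" if "X \<in> \<F>" for X
      using degree_pdet_le[OF fJ[OF that], of \<sigma> H K] by (simp add: JK)
    show "0 \<le> poly (pdet \<sigma> H K (B \<union> X)) x" if "X \<in> \<F>" "0 < x" for X x
      using that by (intro poly_pdet_nonneg fJ skew diag) auto
    show "pdet \<sigma> H K (B \<union> X) = 0" if "X \<in> \<F>" "0 < x" "poly (pdet \<sigma> H K (B \<union> X)) x = 0" for X x
      by (rule pdet_eq_0_if_positive_root[OF fJ skew diag]) (use that in auto)
    fix In Out e and t :: real
    assume InOut: "In \<subseteq> E1 \<union> E2" "Out \<subseteq> E1 \<union> E2" "In \<inter> Out = {}" and e: "e \<in> E1 \<union> E2 - In - Out"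
      and t: "0 < t"
    \<comment> \<open>The scaling gives weight \<open>1 / t\<close> to the minors with \<open>e\<close>; a global factor \<open>t\<close> moves the weight
       to the others.\<close>
    define s where "s i = (if i = e then sqrt (1 / t) else 1)" for i
    let ?p = "\<lambda>X. pdet \<sigma> H K (B \<union> X)" and ?q = "\<lambda>X. pdet \<sigma> (\<lambda>i j. s i * H i j * s j) K (B \<union> X)"
    let ?S = "\<lambda>In Out. {X. X \<in> \<F> \<and> In \<subseteq> X \<and> X \<inter> Out = {}}"
    have eB: "e \<notin> B" using e disj by auto
    have pq: "?q X = smult (if e \<in> X then 1 / t else 1) (?p X)" if "X \<in> \<F>" for X
    proof -
      have "(\<Prod>i\<in>B \<union> X. s i) = (if e \<in> B \<union> X then sqrt (1 / t) else 1)"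
        unfolding s_def using fJ[OF that] by simp
      then have "(\<Prod>i\<in>B \<union> X. s i)\<^sup>2 = (if e \<in> X then 1 / t else 1)" using eB t by simp
      moreover have "s i = 1" if "i \<in> K" for i using that eB K(2) by (auto simp: s_def)
      ultimately show ?thesis using pdet_scale[OF fJ[OF that], of K s \<sigma> H] by (simp only:)
    qed
    have fin\<F>: "finite \<F>" unfolding \<F>_def
      by (rule finite_subset[of _ "Pow (E1 \<union> E2)"]) (use fin in auto)
    have "smult t (\<Sum>X\<in>?S In Out. ?q X) =
        (\<Sum>X\<in>?S (insert e In) Out. smult t (?q X)) + (\<Sum>X\<in>?S In (insert e Out). smult t (?q X))"
    proof -
      have "?S In Out = ?S (insert e In) Out \<union> ?S In (insert e Out)" by blast
      then show ?thesis unfolding smult_sum2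
        by (simp only:) (rule sum.union_disjoint, use fin\<F> in auto)
    qed
    also have "(\<Sum>X\<in>?S (insert e In) Out. smult t (?q X)) = (\<Sum>X\<in>?S (insert e In) Out. ?p X)"
      by (intro sum.cong refl) (use t pq in auto)
    also have "(\<Sum>X\<in>?S In (insert e Out). smult t (?q X)) = smult t (\<Sum>X\<in>?S In (insert e Out). ?p X)"
      unfolding smult_sum2 by (intro sum.cong refl) (use pq in auto)
    finally have eq: "(\<Sum>X\<in>?S (insert e In) Out. ?p X) + smult t (\<Sum>X\<in>?S In (insert e Out). ?p X) =
      smult t (\<Sum>X\<in>?S In Out. ?q X)" by (rule HOL.sym)
    have "(\<Sum>X\<in>?S In Out. ?q X) = 0 \<or> real_rooted (\<Sum>X\<in>?S In Out. ?q X)"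
      unfolding \<F>_def mem_Collect_eq
      by (rule restricted_sum_real_rooted[OF fin disj _ K(1) \<sigma> InOut]) (simp_all add: sym mult_ac)
    then show "(\<Sum>X\<in>?S (insert e In) Out. ?p X) + smult t (\<Sum>X\<in>?S In (insert e Out). ?p X) = 0 \<or>
       real_rooted ((\<Sum>X\<in>?S (insert e In) Out. ?p X) + smult t (\<Sum>X\<in>?S In (insert e Out). ?p X))"
      unfolding eq using t by (auto simp: real_rooted_def of_real_hom.map_poly_hom_smult)
  qed (use fin r good in \<open>auto simp: \<F>_def\<close>)
  then obtain X where X: "X \<in> \<F>" "no_root_below (card K) r (pdet \<sigma> H K (B \<union> X))" by blast
  have "{Y. (Y \<subseteq> E1 \<union> E2 \<and> card (Y \<inter> E1) = k \<and> card (Y \<inter> E2) = k) \<and> X \<subseteq> Y \<and> Y \<inter> (E1 \<union> E2 - X) = {}} = {X}"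
    using X(1) by (auto simp: \<F>_def)
  then have "pdet \<sigma> H K (B \<union> X) = 0 \<or> real_rooted (pdet \<sigma> H K (B \<union> X))"
    using restricted_sum_real_rooted[OF fin disj _ K(1) \<sigma>, where In = X and Out = "E1 \<union> E2 - X" and H = H and k = k]
      X(1) sym by (auto simp: \<F>_def)
  moreover have "pdet \<sigma> H K (B \<union> X) \<noteq> 0" using X(2) by (auto simp: no_root_below_def)
  ultimately show ?thesis using X by blast
qed

section \<open>Nonsingular minors and the Rayleigh quotient\<close>

text \<open>Padding with zero rows gives a square matrix with vanishing determinant.\<close>

lemma underdetermined_solution:
  fixes f :: "'r \<Rightarrow> 'c \<Rightarrow> real"
  assumes fin: "finite I" "finite J" and less: "card I < card J"
  shows "\<exists>c. (\<exists>j\<in>J. c j \<noteq> 0) \<and> (\<forall>i\<in>I. (\<Sum>j\<in>J. f i j * c j) = 0)"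
proof -
  obtain g where g: "g ` I \<subseteq> J" "inj_on g I"
    using card_le_inj[OF fin less_imp_le[OF less]] by blast
  define M where "M j l = (if j \<in> g ` I then f (inv_into I g j) l else 0)" for j l
  have "g ` I \<noteq> J" using less card_image[OF g(2)] by auto
  then have "g ` I \<subset> J" using g(1) by (rule psubsetI[rotated])
  then obtain j0 where j0: "j0 \<in> J" "j0 \<notin> g ` I" by (elim psubsetE) blast
  have "idet J M = 0"
    unfolding idet_def
  proof (rule sum.neutral, rule ballI)
    fix p
    have "(\<Prod>j\<in>J. M j (p j)) = 0" using fin j0 by (intro prod_zero) (auto simp: M_def)
    then show "of_int (sign p) * (\<Prod>j\<in>J. M j (p j)) = 0" by simp
  qed
  then obtain c where c: "\<exists>j\<in>J. c j \<noteq> 0" "\<forall>j\<in>J. (\<Sum>l\<in>J. M j l * c l) = 0"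
    using idet_eq_0_iff_kernel[OF fin(2)] by blast
  have "(\<Sum>j\<in>J. f i j * c j) = 0" if "i \<in> I" for i
  proof -
    have "(\<Sum>l\<in>J. M (g i) l * c l) = 0" using c(2) g(1) that by blast
    then show ?thesis using that g(2) by (simp add: M_def)
  qed
  then show ?thesis using c(1) by blast
qed

definition ker_trivial :: "('r \<Rightarrow> 'c \<Rightarrow> real) \<Rightarrow> 'r set \<Rightarrow> 'c set \<Rightarrow> bool" where
  "ker_trivial f I J \<longleftrightarrow> (\<forall>c. (\<forall>i\<in>I. (\<Sum>j\<in>J. f i j * c j) = 0) \<longrightarrow> (\<forall>j\<in>J. c j = 0))"

text \<open>From a nonzero kernel vector \<open>c\<close> with \<open>c j0 \<noteq> 0\<close> one obtains a nonzero vector in the left kernel: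
  solve all equations of the transposed system except the one for \<open>j0\<close>, which is an
  underdetermined system; the missing equation follows by pairing with \<open>c\<close>.\<close>

lemma ker_trivial_transpose:
  assumes fin: "finite I" "finite J" and card: "card I = card J"
    and tr: "ker_trivial (\<lambda>j i. f i j) J I"
  shows "ker_trivial f I J"
  unfolding ker_trivial_def
proof (intro allI impI ballI, rule ccontr)
  fix c j0 assume c: "\<forall>i\<in>I. (\<Sum>j\<in>J. f i j * c j) = 0" and j0: "j0 \<in> J" "c j0 \<noteq> 0"
  have "card (J - {j0}) < card I" using fin j0 card card_Diff1_less[of J j0] by simp
  then obtain b where b: "\<exists>i\<in>I. b i \<noteq> 0" "\<forall>j\<in>J - {j0}. (\<Sum>i\<in>I. f i j * b i) = 0"
    using underdetermined_solution[of "J - {j0}" I "\<lambda>j i. f i j"] fin by blast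
  have "0 = (\<Sum>i\<in>I. b i * (\<Sum>j\<in>J. f i j * c j))" using c by simp
  also have "\<dots> = (\<Sum>i\<in>I. \<Sum>j\<in>J. c j * (f i j * b i))"
    by (simp add: sum_distrib_left mult_ac)
  also have "\<dots> = (\<Sum>j\<in>J. c j * (\<Sum>i\<in>I. f i j * b i))"
    by (subst sum.swap) (simp add: sum_distrib_left)
  also have "\<dots> = c j0 * (\<Sum>i\<in>I. f i j0 * b i) + (\<Sum>j\<in>J - {j0}. c j * (\<Sum>i\<in>I. f i j * b i))"
    by (rule sum.remove[OF fin(2) j0(1)])
  also have "(\<Sum>j\<in>J - {j0}. c j * (\<Sum>i\<in>I. f i j * b i)) = 0"
    using b(2) by (intro sum.neutral) simp
  finally have "(\<Sum>i\<in>I. f i j0 * b i) = 0" using j0(2) by simp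
  then have "\<forall>j\<in>J. (\<Sum>i\<in>I. f i j * b i) = 0" using b(2) by blast
  then show False using tr b(1) unfolding ker_trivial_def by blast
qed

text \<open>A minimal set of rows with trivial kernel cannot be too small, as the system would be
  underdetermined, nor too large, as a row that depends on the others could be dropped.\<close>

lemma ker_trivial_square_subrows:
  assumes fin: "finite I" "finite J" and tr: "ker_trivial f I J"
  shows "\<exists>S\<subseteq>I. card S = card J \<and> ker_trivial f S J"
proof -
  obtain S where S: "S \<subseteq> I" "ker_trivial f S J"
    and least: "\<And>S'. S' \<subseteq> I \<Longrightarrow> ker_trivial f S' J \<Longrightarrow> card S \<le> card S'"
    using ex_has_least_nat[of "\<lambda>S. S \<subseteq> I \<and> ker_trivial f S J" I card] tr by blast
  have finS: "finite S" using S(1) fin(1) finite_subset by blast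
  have "card J \<le> card S"
  proof (rule ccontr)
    assume "\<not> card J \<le> card S"
    then obtain c where "\<exists>j\<in>J. c j \<noteq> 0" "\<forall>i\<in>S. (\<Sum>j\<in>J. f i j * c j) = 0"
      using underdetermined_solution[OF finS fin(2), of f] by auto
    then show False using S(2) unfolding ker_trivial_def by blast
  qed
  moreover have "card S \<le> card J"
  proof (rule ccontr)
    assume "\<not> card S \<le> card J"
    then obtain b s where b: "s \<in> S" "b s \<noteq> 0" "\<forall>j\<in>J. (\<Sum>i\<in>S. f i j * b i) = 0"
      using underdetermined_solution[OF fin(2) finS, of "\<lambda>j i. f i j"] by auto
    have "ker_trivial f (S - {s}) J"
      unfolding ker_trivial_def
    proof (rule allI, rule impI)
      fix c assume c: "\<forall>i\<in>S - {s}. (\<Sum>j\<in>J. f i j * c j) = 0"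
      have "0 = (\<Sum>j\<in>J. c j * (\<Sum>i\<in>S. f i j * b i))" using b(3) by simp
      also have "\<dots> = (\<Sum>j\<in>J. \<Sum>i\<in>S. b i * (f i j * c j))"
        by (simp add: sum_distrib_left mult_ac)
      also have "\<dots> = (\<Sum>i\<in>S. b i * (\<Sum>j\<in>J. f i j * c j))"
        by (subst sum.swap) (simp add: sum_distrib_left)
      also have "\<dots> = b s * (\<Sum>j\<in>J. f s j * c j) + (\<Sum>i\<in>S - {s}. b i * (\<Sum>j\<in>J. f i j * c j))"
        by (rule sum.remove[OF finS b(1)])
      also have "(\<Sum>i\<in>S - {s}. b i * (\<Sum>j\<in>J. f i j * c j)) = 0"
        using c by (intro sum.neutral) simp
      finally have "(\<Sum>j\<in>J. f s j * c j) = 0" using b(2) by simp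
      then have "\<forall>i\<in>S. (\<Sum>j\<in>J. f i j * c j) = 0" using c by blast
      then show "\<forall>j\<in>J. c j = 0" using S(2) unfolding ker_trivial_def by blast
    qed
    then have "card S \<le> card (S - {s})" using least[of "S - {s}"] S(1) by blast
    then show False using card_Diff1_less[OF finS b(1)] by simp
  qed
  ultimately show ?thesis using S by auto
qed

text \<open>Any \<open>k\<close> linearly independent columns have trivial kernel, and suitable \<open>k\<close> of the rows suffice
  for that.\<close>

lemma rank_ge_nonsingular_minor:
  fixes U :: "real mat"
  assumes U: "U \<in> carrier_mat m l" and k: "k \<le> vec_space.rank m U"
  shows "\<exists>S W. S \<subseteq> {..<m} \<and> W \<subseteq> {..<l} \<and> card S = k \<and> card W = k \<and>
    ker_trivial (\<lambda>i j. U $$ (i, j)) S W"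
proof -
  interpret V: vec_space "TYPE(real)" m .
  have cols: "set (cols U) \<subseteq> carrier_vec m" using cols_dim[of U] U by simp
  have li0: "V.lin_indpt {}" by (rule V.finite_lin_indpt2) auto
  have "\<exists>X. finite X \<and> maximal X (\<lambda>T. T \<subseteq> set (cols U) \<and> V.lin_indpt T) \<and> {} \<subseteq> X"
    by (rule maximal_exists_superset[of "set (cols U)"]) (use li0 in auto)
  then obtain X where X: "maximal X (\<lambda>T. T \<subseteq> set (cols U) \<and> V.lin_indpt T)" by blast
  then have X': "X \<subseteq> set (cols U)" "V.lin_indpt X" unfolding maximal_def by blast+
  have "k \<le> card X" using V.rank_card_indpt[OF U X] k by simp
  then obtain Y where Y: "Y \<subseteq> X" "card Y = k" "finite Y"
    by (rule obtain_subset_with_card_n)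
  have liY: "V.lin_indpt Y" by (rule V.subset_li_is_li[OF X'(2) Y(1)])
  have "\<forall>y\<in>Y. \<exists>j<l. col U j = y"
  proof
    fix y assume "y \<in> Y"
    then have "y \<in> set (cols U)" using Y(1) X'(1) by blast
    then show "\<exists>j<l. col U j = y" using U by (auto simp: cols_def)
  qed
  then obtain g where g: "\<And>y. y \<in> Y \<Longrightarrow> g y < l \<and> col U (g y) = y" by metis
  have inj: "inj_on g Y" by (rule inj_onI) (metis g)
  have tr: "ker_trivial (\<lambda>i j. U $$ (i, j)) {..<m} (g ` Y)"
    unfolding ker_trivial_def
  proof (intro allI impI ballI, rule ccontr)
    fix c j assume c: "\<forall>i\<in>{..<m}. (\<Sum>j\<in>g ` Y. U $$ (i, j) * c j) = 0" and j: "j \<in> g ` Y" "c j \<noteq> 0"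
    obtain y where y: "y \<in> Y" "j = g y" using j(1) by blast
    have YV: "Y \<subseteq> carrier_vec m" using Y(1) X'(1) cols by blast
    have "V.lincomb (\<lambda>y. c (g y)) Y = 0\<^sub>v m"
    proof (rule eq_vecI)
      fix i assume "i < dim_vec (0\<^sub>v m)"
      then have i: "i < m" by simp
      have "V.lincomb (\<lambda>y. c (g y)) Y $ i = (\<Sum>y\<in>Y. c (g y) * y $ i)"
        by (rule V.lincomb_index[OF i YV])
      also have "\<dots> = (\<Sum>y\<in>Y. U $$ (i, g y) * c (g y))"
      proof (rule sum.cong[OF refl])
        fix y assume "y \<in> Y"
        then have "y $ i = U $$ (i, g y)" using g[of y] i U by (metis carrier_matD index_col)
        then show "c (g y) * y $ i = U $$ (i, g y) * c (g y)" by simp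
      qed
      also have "\<dots> = (\<Sum>j\<in>g ` Y. U $$ (i, j) * c j)"
        by (simp add: sum.reindex[OF inj])
      also have "\<dots> = 0" using c i by simp
      finally show "V.lincomb (\<lambda>y. c (g y)) Y $ i = 0\<^sub>v m $ i" using i by simp
    qed (use V.lincomb_dim[OF Y(3) YV] in simp)
    then have "V.lin_dep Y"
      using V.lin_dep_crit[OF Y(3) subset_refl _ y(1), of "\<lambda>y. c (g y)"] j(2) y(2) by simp
    then show False using liY by simp
  qed
  have "finite (g ` Y)" "card (g ` Y) = k" using Y inj by (auto simp: card_image)
  with ker_trivial_square_subrows[OF _ _ tr] obtain S where
    "S \<subseteq> {..<m}" "card S = k" "ker_trivial (\<lambda>i j. U $$ (i, j)) S (g ` Y)" by auto
  then show ?thesis using g \<open>card (g ` Y) = k\<close> by (intro exI[of _ S] exI[of _ "g ` Y"]) auto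
qed

lemma coordinatewise_convergent_subsequence:
  fixes f :: "nat \<Rightarrow> 'i \<Rightarrow> real"
  assumes "finite I" "\<And>m i. i \<in> I \<Longrightarrow> \<bar>f m i\<bar> \<le> b"
  shows "\<exists>r::nat\<Rightarrow>nat. strict_mono r \<and> (\<forall>i\<in>I. convergent (\<lambda>m. f (r m) i))"
  using assms
proof (induction I rule: finite_induct)
  case empty
  then show ?case using strict_mono_id by blast
next
  case (insert k I)
  then obtain r :: "nat \<Rightarrow> nat" where r: "strict_mono r" "\<And>i. i \<in> I \<Longrightarrow> convergent (\<lambda>m. f (r m) i)"
    by blast
  obtain q where q: "strict_mono q" "monoseq (\<lambda>m. f (r (q m)) k)"
    using seq_monosub[of "\<lambda>m. f (r m) k"] by blast
  have "Bseq (\<lambda>m. f (r (q m)) k)"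
    by (rule BseqI'[of _ b]) (use insert.prems in auto)
  then have "convergent (\<lambda>m. f (r (q m)) k)" using q(2) by (rule Bseq_monoseq_convergent)
  moreover have "convergent (\<lambda>m. f (r (q m)) i)" if "i \<in> I" for i
    using convergent_subseq_convergent[OF r(2)[OF that] q(1)] by (simp add: o_def)
  ultimately show ?case
    using strict_mono_o[OF r(1) q(1)] by (intro exI[of _ "r \<circ> q"]) (auto simp: o_def)
qed

text \<open>The quadratic form attains its maximum \<open>t\<close> on the unit sphere.  At a maximizer \<open>v\<close>, varying one
  coordinate at a time gives the eigenvector equation as the first-order condition.\<close>

lemma rayleigh_maximum:
  fixes G :: "'i \<Rightarrow> 'i \<Rightarrow> real"
  assumes fin: "finite I" "I \<noteq> {}" and sym: "\<And>i j. i \<in> I \<Longrightarrow> j \<in> I \<Longrightarrow> G i j = G j i"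
  shows "\<exists>v t. (\<exists>i\<in>I. v i \<noteq> 0) \<and> (\<forall>i\<in>I. (\<Sum>j\<in>I. G i j * v j) = t * v i) \<and>
    (\<forall>w. (\<Sum>i\<in>I. \<Sum>j\<in>I. w i * G i j * w j) \<le> t * (\<Sum>i\<in>I. (w i)\<^sup>2))"
proof -
  define q where "q w = (\<Sum>i\<in>I. \<Sum>j\<in>I. w i * G i j * w j)" for w
  define \<nu> where "\<nu> w = (\<Sum>i\<in>I. (w i)\<^sup>2)" for w :: "'i \<Rightarrow> real"
  let ?A = "q ` {w. \<nu> w = 1}"
  have coord: "\<bar>w i\<bar> \<le> 1" if "\<nu> w = 1" "i \<in> I" for w i
  proof -
    have "(w i)\<^sup>2 \<le> \<nu> w" unfolding \<nu>_def using that fin by (intro member_le_sum) auto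
    then show ?thesis using that by (simp add: abs_square_le_1)
  qed
  have bdd: "bdd_above ?A"
  proof (rule bdd_aboveI2)
    fix w assume "w \<in> {w. \<nu> w = 1}"
    then have w: "\<nu> w = 1" by simp
    show "q w \<le> (\<Sum>i\<in>I. \<Sum>j\<in>I. \<bar>G i j\<bar>)"
      unfolding q_def
    proof (intro sum_mono)
      fix i j assume ij: "i \<in> I" "j \<in> I"
      have "w i * G i j * w j \<le> \<bar>w i\<bar> * \<bar>G i j\<bar> * \<bar>w j\<bar>"
        by (metis abs_ge_self abs_mult)
      also have "\<dots> \<le> 1 * \<bar>G i j\<bar> * 1"
        using coord[OF w] ij by (intro mult_mono) auto
      finally show "w i * G i j * w j \<le> \<bar>G i j\<bar>" by simp
    qed
  qed
  obtain k where k: "k \<in> I" using fin by blast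
  have "\<nu> (\<lambda>i. if i = k then 1 else 0) = 1"
    using fin k by (simp add: \<nu>_def if_distrib[of "\<lambda>x. x\<^sup>2"] cong: if_cong)
  then have ne: "?A \<noteq> {}" by blast
  define t where "t = Sup ?A"
  have "\<exists>w. \<nu> w = 1 \<and> t - inverse (real (Suc m)) < q w" for m
    using less_cSup_iff[OF ne bdd, of "t - inverse (real (Suc m))"] by (auto simp: t_def)
  then obtain f where f: "\<And>m. \<nu> (f m) = 1" "\<And>m. t - inverse (real (Suc m)) < q (f m)" by metis
  obtain r :: "nat \<Rightarrow> nat" where r: "strict_mono r" "\<And>i. i \<in> I \<Longrightarrow> convergent (\<lambda>m. f (r m) i)"
    using coordinatewise_convergent_subsequence[OF fin(1), of f 1] coord f(1) by blast
  define v where "v i = lim (\<lambda>m. f (r m) i)" for i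
  have lim: "(\<lambda>m. f (r m) i) \<longlonglongrightarrow> v i" if "i \<in> I" for i
    using r(2)[OF that] by (simp add: v_def convergent_LIMSEQ_iff)
  have "(\<lambda>m. \<nu> (f (r m))) \<longlonglongrightarrow> \<nu> v"
    unfolding \<nu>_def by (intro tendsto_sum tendsto_power lim)
  then have \<nu>v: "\<nu> v = 1" using f(1) by (simp add: LIMSEQ_const_iff)
  have "(\<lambda>m. q (f (r m))) \<longlonglongrightarrow> q v"
    unfolding q_def by (intro tendsto_sum tendsto_mult tendsto_const lim)
  moreover have "(\<lambda>m. t - inverse (real (Suc (r m)))) \<longlonglongrightarrow> t - 0"
    using LIMSEQ_subseq_LIMSEQ[OF LIMSEQ_inverse_real_of_nat r(1)]
    by (intro tendsto_diff tendsto_const) (simp add: o_def)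
  ultimately have "t \<le> q v"
    using f(2) by (intro LIMSEQ_le[of "\<lambda>m. t - inverse (real (Suc (r m)))"]) (auto intro: less_imp_le)
  have max: "q w \<le> t * \<nu> w" for w
  proof (cases "\<nu> w = 0")
    case True
    then have "\<forall>i\<in>I. w i = 0" unfolding \<nu>_def using fin by (subst (asm) sum_nonneg_eq_0_iff) auto
    then show ?thesis using True by (simp add: q_def)
  next
    case False
    moreover have "0 \<le> \<nu> w" unfolding \<nu>_def by (intro sum_nonneg) auto
    ultimately have pos: "0 < \<nu> w" by simp
    define u where "u i = w i / sqrt (\<nu> w)" for i
    have "\<nu> u = 1" using pos by (simp add: u_def \<nu>_def power_divide sum_divide_distrib[symmetric])
    then have "q u \<le> t" unfolding t_def by (intro cSup_upper bdd) auto
    moreover have "q w = \<nu> w * q u"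
    proof -
      have "q w = (\<Sum>i\<in>I. \<Sum>j\<in>I. (sqrt (\<nu> w) * sqrt (\<nu> w)) * (u i * G i j * u j))"
        unfolding q_def using pos by (intro sum.cong refl) (simp add: u_def)
      then show ?thesis using pos by (simp add: q_def sum_distrib_left)
    qed
    ultimately show ?thesis using pos by (simp add: mult.commute)
  qed
  have tv: "q v = t" using max[of v] \<open>t \<le> q v\<close> \<nu>v by simp
  have eig: "(\<Sum>j\<in>I. G i j * v j) = t * v i" if i: "i \<in> I" for i
  proof -
    define D where "D = (\<Sum>j\<in>I. G i j * v j) - t * v i"
    \<comment> \<open>Maximality of \<open>t\<close>, applied to \<open>v\<close> with \<open>s\<close> added to its coordinate \<open>i\<close>.\<close>
    have ineq: "2 * s * D \<le> s\<^sup>2 * (t - G i i)" for s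
    proof -
      let ?d = "\<lambda>j. if j = i then s else 0"
      let ?w = "\<lambda>j. v j + ?d j"
      have "q ?w = q v + (\<Sum>a\<in>I. \<Sum>b\<in>I. v a * G a b * ?d b) + (\<Sum>a\<in>I. \<Sum>b\<in>I. ?d a * G a b * v b)
          + (\<Sum>a\<in>I. \<Sum>b\<in>I. ?d a * G a b * ?d b)"
        unfolding q_def by (simp only: ring_distribs sum.distrib add_ac)
      also have "(\<Sum>a\<in>I. \<Sum>b\<in>I. v a * G a b * ?d b) = s * (\<Sum>j\<in>I. G i j * v j)"
        using fin i sym by (simp add: if_distrib[of "\<lambda>x. _ * x"] sum_distrib_left mult_ac cong: if_cong)
      also have "(\<Sum>a\<in>I. \<Sum>b\<in>I. ?d a * G a b * v b) = s * (\<Sum>j\<in>I. G i j * v j)"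
      proof -
        have "(\<Sum>a\<in>I. \<Sum>b\<in>I. ?d a * G a b * v b) = (\<Sum>a\<in>I. if a = i then s * (\<Sum>b\<in>I. G i b * v b) else 0)"
          by (intro sum.cong refl) (simp add: sum_distrib_left mult_ac)
        then show ?thesis using fin i by simp
      qed
      also have "(\<Sum>a\<in>I. \<Sum>b\<in>I. ?d a * G a b * ?d b) = s\<^sup>2 * G i i"
      proof -
        have "(\<Sum>a\<in>I. \<Sum>b\<in>I. ?d a * G a b * ?d b) = (\<Sum>a\<in>I. if a = i then s\<^sup>2 * G i i else 0)"
        proof (intro sum.cong refl)
          fix a assume "a \<in> I"
          have "(\<Sum>b\<in>I. ?d a * G a b * ?d b) = (\<Sum>b\<in>I. if b = i then ?d a * G a i * s else 0)"
            by (intro sum.cong refl) auto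
          then show "(\<Sum>b\<in>I. ?d a * G a b * ?d b) = (if a = i then s\<^sup>2 * G i i else 0)"
            using fin i by (auto simp: power2_eq_square)
        qed
        then show ?thesis using fin i by simp
      qed
      finally have qw: "q ?w = t + 2 * s * (\<Sum>j\<in>I. G i j * v j) + s\<^sup>2 * G i i" by (simp add: tv)
      have "\<nu> ?w = \<nu> v + (\<Sum>a\<in>I. if a = i then 2 * s * v i + s\<^sup>2 else 0)"
        unfolding \<nu>_def sum.distrib[symmetric] by (intro sum.cong refl) (auto simp: power2_sum)
      then have "\<nu> ?w = 1 + 2 * s * v i + s\<^sup>2" using fin i by (simp add: \<nu>v)
      then show ?thesis using max[of ?w] qw by (simp add: D_def algebra_simps)
    qed
    have "D = 0"
    proof (rule ccontr)
      assume D: "D \<noteq> 0"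
      \<comment> \<open>With \<open>s = D / h\<close> the linear term dominates the quadratic one.\<close>
      define h where "h = \<bar>t - G i i\<bar> + 1"
      have h: "0 < h" by (simp add: h_def)
      have "2 * (D / h) * D \<le> (D / h)\<^sup>2 * (t - G i i)" by (rule ineq)
      also have "\<dots> \<le> (D / h)\<^sup>2 * h" by (intro mult_left_mono) (auto simp: h_def)
      also have "\<dots> = D\<^sup>2 / h" using h by (simp add: power2_eq_square)
      finally have "2 * (D\<^sup>2 / h) \<le> D\<^sup>2 / h" by (simp add: power2_eq_square)
      then show False using D h by (simp add: field_simps)
    qed
    then show ?thesis by (simp add: D_def)
  qed
  have "\<exists>i\<in>I. v i \<noteq> 0"
  proof (rule ccontr)
    assume "\<not> ?thesis"
    then have "\<nu> v = 0" by (simp add: \<nu>_def)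
    then show False using \<nu>v by simp
  qed
  then show ?thesis using eig max unfolding q_def \<nu>_def by blast
qed

section \<open>The block matrix as a signed pencil\<close>

text \<open>The indices of the block matrix: rows of \<open>A\<close>, rows of \<open>U\<close>, columns of \<open>U\<close>, columns of \<open>A\<close>.
  Keeping all rows and columns of \<open>U\<close> as indices lets every choice of \<open>S\<close> and \<open>W\<close> be a set of
  indices of the same matrix.\<close>

datatype cidx = Obs nat | Row nat | Col nat | Var nat

fun cur_sign :: "cidx \<Rightarrow> real" where
  "cur_sign (Obs i) = 1"
| "cur_sign (Row i) = 1"
| "cur_sign (Col i) = -1"
| "cur_sign (Var i) = -1"

fun cur_entry :: "real mat \<Rightarrow> real mat \<Rightarrow> real mat \<Rightarrow> real mat \<Rightarrow> cidx \<Rightarrow> cidx \<Rightarrow> real" where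
  "cur_entry A C U R (Obs i) (Obs j) = (if i = j then 1 else 0)"
| "cur_entry A C U R (Obs i) (Col w) = C $$ (i, w)"
| "cur_entry A C U R (Col w) (Obs i) = C $$ (i, w)"
| "cur_entry A C U R (Obs i) (Var j) = A $$ (i, j)"
| "cur_entry A C U R (Var j) (Obs i) = A $$ (i, j)"
| "cur_entry A C U R (Row s) (Col w) = U $$ (s, w)"
| "cur_entry A C U R (Col w) (Row s) = U $$ (s, w)"
| "cur_entry A C U R (Row s) (Var j) = R $$ (s, j)"
| "cur_entry A C U R (Var j) (Row s) = R $$ (s, j)"
| "cur_entry A C U R _ _ = 0"

lemma cur_entry_sym: "cur_entry A C U R i j = cur_entry A C U R j i"
  by (cases i; cases j) auto

lemma cur_entry_skew: "i \<noteq> j \<Longrightarrow> cur_sign i * cur_entry A C U R i j + cur_sign j * cur_entry A C U R j i = 0"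
  by (cases i; cases j) auto

lemma cur_entry_diag: "0 \<le> cur_sign i * cur_entry A C U R i i"
  by (cases i) auto

definition cur_index :: "nat \<Rightarrow> nat set \<Rightarrow> nat set \<Rightarrow> nat \<Rightarrow> cidx set" where
  "cur_index n S W d = Obs ` {..<n} \<union> Row ` S \<union> Col ` W \<union> Var ` {..<d}"

lemma sum_cur_index:
  assumes "finite S" "finite W"
  shows "(\<Sum>i\<in>cur_index n S W d. f i) = (\<Sum>i<n. f (Obs i)) + (\<Sum>i\<in>S. f (Row i)) + (\<Sum>i\<in>W. f (Col i)) + (\<Sum>i<d. f (Var i))"
  unfolding cur_index_def
  by (subst sum.union_disjoint, use assms in \<open>auto simp: sum.reindex inj_on_def\<close>)+

lemma prod_cur_index:
  assumes "finite S" "finite W"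
  shows "(\<Prod>i\<in>cur_index n S W d. f i) = (\<Prod>i<n. f (Obs i)) * (\<Prod>i\<in>S. f (Row i)) * (\<Prod>i\<in>W. f (Col i)) * (\<Prod>i<d. f (Var i))"
  unfolding cur_index_def
  by (subst prod.union_disjoint, use assms in \<open>auto simp: prod.reindex inj_on_def\<close>)+

lemma finite_cur_index [simp]: "finite S \<Longrightarrow> finite W \<Longrightarrow> finite (cur_index n S W d)"
  by (simp add: cur_index_def)

lemma bij_betw_pick:
  assumes "finite S"
  shows "bij_betw (pick S) {..<card S} S"
proof -
  have inj: "inj_on (pick S) {..<card S}"
    by (rule linorder_inj_onI) (use pick_mono_le in \<open>fastforce+\<close>)
  have "pick S ` {..<card S} \<subseteq> S" using pick_in_set_le by auto
  then have "pick S ` {..<card S} = S"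
    using assms inj by (intro card_subset_eq) (auto simp: card_image)
  then show ?thesis using inj by (simp add: bij_betw_def)
qed

text \<open>The position of each index in the block matrix for \<open>S\<close> and \<open>W\<close>; \<^const>\<open>pick\<close> enumerates a set
  of natural numbers in increasing order.\<close>

definition cur_enum :: "nat \<Rightarrow> nat \<Rightarrow> nat set \<Rightarrow> nat set \<Rightarrow> nat \<Rightarrow> cidx" where
  "cur_enum n k S W i = (if i < n then Obs i else if i < n + k then Row (pick S (i - n))
     else if i < n + k + k then Col (pick W (i - n - k)) else Var (i - n - k - k))"

lemma bij_betw_cur_enum:
  assumes "finite S" "card S = k" "finite W" "card W = k"
  shows "bij_betw (cur_enum n k S W) {..<n + k + k + d} (cur_index n S W d)"
proof -
  have bS: "inj_on (pick S) {..<k}" "pick S ` {..<k} = S" and bW: "inj_on (pick W) {..<k}" "pick W ` {..<k} = W"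
    using bij_betw_pick[OF assms(1)] bij_betw_pick[OF assms(3)] assms by (auto simp: bij_betw_def)
  have "inj_on (cur_enum n k S W) {..<n + k + k + d}"
  proof (rule inj_onI)
    fix i j assume "cur_enum n k S W i = cur_enum n k S W j"
    moreover have "i - n = j - n" if "n \<le> i" "n \<le> j" "i < n + k" "j < n + k" "pick S (i - n) = pick S (j - n)"
      using inj_onD[OF bS(1) that(5)] that by auto
    moreover have "i - n - k = j - n - k" if "n + k \<le> i" "n + k \<le> j" "i < n + k + k" "j < n + k + k"
      "pick W (i - n - k) = pick W (j - n - k)"
      using inj_onD[OF bW(1) that(5)] that by auto
    ultimately show "i = j" by (auto simp: cur_enum_def not_less split: if_splits)
  qed
  moreover have "cur_enum n k S W ` {..<n + k + k + d} = cur_index n S W d"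
  proof (intro equalityI subsetI)
    fix x assume "x \<in> cur_enum n k S W ` {..<n + k + k + d}"
    then obtain i where i: "i < n + k + k + d" "x = cur_enum n k S W i" by auto
    have "pick S (i - n) \<in> S" if "n \<le> i" "i < n + k" using bS(2) that by auto
    moreover have "pick W (i - n - k) \<in> W" if "n + k \<le> i" "i < n + k + k" using bW(2) that by auto
    ultimately show "x \<in> cur_index n S W d"
      using i by (auto simp: cur_enum_def cur_index_def not_less)
  next
    fix x assume "x \<in> cur_index n S W d"
    then consider i where "i < n" "x = Obs i" | s where "s \<in> S" "x = Row s" | w where "w \<in> W" "x = Col w"
      | j where "j < d" "x = Var j" by (auto simp: cur_index_def)
    then show "x \<in> cur_enum n k S W ` {..<n + k + k + d}"
    proof cases
      case 1
      then show ?thesis by (intro image_eqI[of _ _ i]) (auto simp: cur_enum_def)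
    next
      case 2
      then obtain a where "a < k" "s = pick S a" using bS(2) by auto
      then show ?thesis using 2 by (intro image_eqI[of _ _ "n + a"]) (auto simp: cur_enum_def)
    next
      case 3
      then obtain a where "a < k" "w = pick W a" using bW(2) by auto
      then show ?thesis using 3 by (intro image_eqI[of _ _ "n + k + a"]) (auto simp: cur_enum_def)
    next
      case 4
      then show ?thesis by (intro image_eqI[of _ _ "n + k + k + j"]) (auto simp: cur_enum_def)
    qed
  qed
  ultimately show ?thesis by (simp add: bij_betw_def)
qed

lemma submatrix_carrier:
  assumes "M \<in> carrier_mat m l" "S \<subseteq> {..<m}" "W \<subseteq> {..<l}"
  shows "submatrix M S W \<in> carrier_mat (card S) (card W)"
    "submatrix M UNIV W \<in> carrier_mat m (card W)"
    "submatrix M S UNIV \<in> carrier_mat (card S) l"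
proof -
  have "{i. i < m \<and> i \<in> S} = S" "{i. i < l \<and> i \<in> W} = W" using assms by auto
  then show "submatrix M S W \<in> carrier_mat (card S) (card W)"
    "submatrix M UNIV W \<in> carrier_mat m (card W)"
    "submatrix M S UNIV \<in> carrier_mat (card S) l"
    using carrier_matD[OF assms(1)] by (intro carrier_matI; simp add: dim_submatrix)+
qed

lemma submatrix_entry:
  assumes "M \<in> carrier_mat m l" "S \<subseteq> {..<m}" "W \<subseteq> {..<l}"
  shows "i < card S \<Longrightarrow> j < card W \<Longrightarrow> submatrix M S W $$ (i, j) = M $$ (pick S i, pick W j)"
    "i < m \<Longrightarrow> j < card W \<Longrightarrow> submatrix M UNIV W $$ (i, j) = M $$ (i, pick W j)"
    "i < card S \<Longrightarrow> j < l \<Longrightarrow> submatrix M S UNIV $$ (i, j) = M $$ (pick S i, j)"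
proof -
  have "{i. i < m \<and> i \<in> S} = S" "{i. i < l \<and> i \<in> W} = W" using assms by auto
  then show "i < card S \<Longrightarrow> j < card W \<Longrightarrow> submatrix M S W $$ (i, j) = M $$ (pick S i, pick W j)"
    "i < m \<Longrightarrow> j < card W \<Longrightarrow> submatrix M UNIV W $$ (i, j) = M $$ (i, pick W j)"
    "i < card S \<Longrightarrow> j < l \<Longrightarrow> submatrix M S UNIV $$ (i, j) = M $$ (pick S i, j)"
    using carrier_matD[OF assms(1)] by (simp_all add: submatrix_index pick_UNIV)
qed

locale cur_data =
  fixes A C U R :: "real mat" and n d m l k :: nat
  assumes A: "A \<in> carrier_mat n d" and C: "C \<in> carrier_mat n l"
    and U: "U \<in> carrier_mat m l" and R: "R \<in> carrier_mat m d"
begin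

lemma cur_block_carrier:
  assumes "S \<in> ksubsets m k" "W \<in> ksubsets l k"
  shows "cur_block_mat S W A C U R \<in> carrier_mat (n + k + k + d) (n + k + k + d)"
proof -
  have "card S = k" "dim_row A = n" "dim_col A = d" using assms A by (auto simp: ksubsets_def)
  then show ?thesis unfolding cur_block_mat_def Let_def
    by (intro carrier_matI)
      (simp_all only: index_mat_four_block index_one_mat index_smult_mat index_zero_mat)
qed

lemma cur_block_entry:
  assumes S: "S \<in> ksubsets m k" and W: "W \<in> ksubsets l k"
    and ij: "i < n + k + k + d" "j < n + k + k + d"
  defines "h \<equiv> cur_enum n k S W"
  shows "cur_block_mat S W A C U R $$ (i, j) =
     [:cur_entry A C U R (h i) (h j):] - (if h i = h j \<and> h i \<in> range Var then [:0, 1:] else 0)"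
proof -
  have SW: "S \<subseteq> {..<m}" "card S = k" "W \<subseteq> {..<l}" "card W = k"
    using S W by (auto simp: ksubsets_def)
  note carr = submatrix_carrier(2)[OF C subset_refl SW(3)] submatrix_carrier(1)[OF U SW(1,3)]
    submatrix_carrier(3)[OF R SW(1) subset_refl] A
  note dims = carr[THEN carrier_matD(1), unfolded SW(2,4)] carr[THEN carrier_matD(2), unfolded SW(2,4)]
  note ent = submatrix_entry(2)[OF C subset_refl SW(3), unfolded SW(2,4)]
    submatrix_entry(1)[OF U SW(1,3), unfolded SW(2,4)]
    submatrix_entry(3)[OF R SW(1) subset_refl, unfolded SW(2,4)]
  have ci: "i < n \<or> (n \<le> i \<and> i < n + k) \<or> (n + k \<le> i \<and> i < n + k + k) \<or> n + k + k \<le> i" by linarith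
  have cj: "j < n \<or> (n \<le> j \<and> j < n + k) \<or> (n + k \<le> j \<and> j < n + k + k) \<or> n + k + k \<le> j" by linarith
  show ?thesis
    using ci cj ij unfolding cur_block_mat_def Let_def SW(2) dims h_def cur_enum_def
    by (elim disjE conjE) (simp_all add: dims ent image_iff less_diff_conv2, auto)
qed

text \<open>The \<open>k + d\<close> negative signs of \<^const>\<open>cur_sign\<close> account for the sign in the definition of
  \<^const>\<open>cur_poly\<close>, since \<open>d - k\<close> and \<open>k + d\<close> have the same parity.\<close>

lemma cur_poly_eq_pdet:
  assumes S: "S \<in> ksubsets m k" and W: "W \<in> ksubsets l k"
  shows "cur_poly S W A C U R = pdet cur_sign (cur_entry A C U R) (range Var) (cur_index n S W d)"
proof (rule poly_ext)
  fix x
  have SW: "finite S" "card S = k" "finite W" "card W = k"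
    using S W finite_subset[OF _ finite_lessThan] by (auto simp: ksubsets_def)
  let ?H = "cur_entry A C U R" and ?J = "cur_index n S W d"
  let ?F = "\<lambda>i j. [:?H i j:] - (if i = j \<and> i \<in> range Var then [:0, 1:] else 0)"
  have "det (cur_block_mat S W A C U R) = idet ?J ?F"
    unfolding det_eq_idet[OF cur_block_carrier[OF S W]] idet_reindex[OF bij_betw_cur_enum[OF SW] finite_lessThan]
    by (rule idet_cong) (simp add: cur_block_entry[OF S W])
  then have 1: "poly (det (cur_block_mat S W A C U R)) x =
      idet ?J (\<lambda>i j. ?H i j - (if i = j \<and> i \<in> range Var then x else 0))"
    by (simp only: poly_idet) (rule idet_cong, auto)
  have "poly (pdet cur_sign ?H (range Var) ?J) x =
      idet ?J (\<lambda>i j. cur_sign i * (?H i j - (if i = j \<and> i \<in> range Var then x else 0)) * 1)"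
    unfolding poly_pdet by (rule idet_cong) (auto simp: right_diff_distrib)
  also have "\<dots> = (-1) ^ (k + d) * idet ?J (\<lambda>i j. ?H i j - (if i = j \<and> i \<in> range Var then x else 0))"
    unfolding idet_scale by (simp add: prod_cur_index SW power_add)
  also have "(-1) ^ (k + d) = ((-1) powi (int d - int k) :: real)"
    by (cases "even (k + d)") (auto simp: power_int_minus_left)
  finally show "poly (cur_poly S W A C U R) x = poly (pdet cur_sign ?H (range Var) ?J) x"
    using 1 A SW by (simp add: cur_poly_def)
qed
end

lemma pdet_cong_diag: "J \<inter> K = J \<inter> K' \<Longrightarrow> pdet \<sigma> H K J = pdet \<sigma> H K' J"
  unfolding pdet_def by (rule idet_cong) auto

context cur_data
begin

abbreviation H where "H \<equiv> cur_entry A C U R"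
abbreviation B where "B \<equiv> Obs ` {..<n} \<union> Var ` {..<d}"
abbreviation K where "K \<equiv> Var ` {..<d}"

definition choices :: "cidx set set" where
  "choices = {X. X \<subseteq> Row ` {..<m} \<union> Col ` {..<l} \<and> card (X \<inter> Row ` {..<m}) = k \<and> card (X \<inter> Col ` {..<l}) = k}"

lemma choice_of_pair:
  assumes "S \<in> ksubsets m k" "W \<in> ksubsets l k"
  shows "Row ` S \<union> Col ` W \<in> choices" "cur_index n S W d = B \<union> (Row ` S \<union> Col ` W)"
    "cur_poly S W A C U R = pdet cur_sign H K (B \<union> (Row ` S \<union> Col ` W))"
proof -
  have SW: "S \<subseteq> {..<m}" "card S = k" "W \<subseteq> {..<l}" "card W = k"
    using assms by (auto simp: ksubsets_def)
  have "(Row ` S \<union> Col ` W) \<inter> Row ` {..<m} = Row ` S" "(Row ` S \<union> Col ` W) \<inter> Col ` {..<l} = Col ` W"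
    using SW by auto
  then show "Row ` S \<union> Col ` W \<in> choices"
    using SW unfolding choices_def by (auto simp: card_image inj_on_def)
  show e: "cur_index n S W d = B \<union> (Row ` S \<union> Col ` W)" by (auto simp: cur_index_def)
  show "cur_poly S W A C U R = pdet cur_sign H K (B \<union> (Row ` S \<union> Col ` W))"
    unfolding cur_poly_eq_pdet[OF assms] e by (rule pdet_cong_diag) auto
qed

lemma pair_of_choice:
  assumes "X \<in> choices"
  obtains S W where "S \<in> ksubsets m k" "W \<in> ksubsets l k" "X = Row ` S \<union> Col ` W"
proof
  define S where "S = {s. Row s \<in> X}"
  define W where "W = {w. Col w \<in> X}"
  have X: "X \<inter> Row ` {..<m} = Row ` S" "X \<inter> Col ` {..<l} = Col ` W" "S \<subseteq> {..<m}" "W \<subseteq> {..<l}"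
    "X = Row ` S \<union> Col ` W"
    using assms by (auto simp: choices_def S_def W_def)
  show "X = Row ` S \<union> Col ` W" by (rule X(5))
  have "card (Row ` S) = card S" "card (Col ` W) = card W" by (auto intro!: card_image simp: inj_on_def)
  then show "S \<in> ksubsets m k" "W \<in> ksubsets l k"
    using assms X unfolding choices_def ksubsets_def by auto
qed

lemma cur_sum_poly_eq: "cur_sum_poly k A C U R = (\<Sum>X\<in>choices. pdet cur_sign H K (B \<union> X))"
proof -
  have "cur_sum_poly k A C U R =
      (\<Sum>(S, W)\<in>ksubsets m k \<times> ksubsets l k. cur_poly S W A C U R)"
    using U by (simp add: cur_sum_poly_def sum.cartesian_product)
  also have "\<dots> = (\<Sum>X\<in>choices. pdet cur_sign H K (B \<union> X))"
  proof (rule sum.reindex_bij_witness[where i = "\<lambda>X. ({s. Row s \<in> X}, {w. Col w \<in> X})"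
        and j = "\<lambda>(S, W). Row ` S \<union> Col ` W"])
    fix X assume "X \<in> choices"
    then obtain S W where SW: "S \<in> ksubsets m k" "W \<in> ksubsets l k" "X = Row ` S \<union> Col ` W"
      using pair_of_choice by blast
    then have e: "({s. Row s \<in> X}, {w. Col w \<in> X}) = (S, W)" by auto
    show "(case ({s. Row s \<in> X}, {w. Col w \<in> X}) of (S, W) \<Rightarrow> Row ` S \<union> Col ` W) = X"
      "({s. Row s \<in> X}, {w. Col w \<in> X}) \<in> ksubsets m k \<times> ksubsets l k"
      unfolding e using SW by auto
  qed (use choice_of_pair in auto)
  finally show ?thesis .
qed

lemma index_diff: "cur_index n S W d - K = cur_index n S W 0" "card (cur_index n S W d \<inter> K) = d"
proof -
  show "cur_index n S W d - K = cur_index n S W 0" by (auto simp: cur_index_def)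
  have "cur_index n S W d \<inter> K = K" by (auto simp: cur_index_def)
  then show "card (cur_index n S W d \<inter> K) = d" by (simp add: card_image inj_on_def)
qed

text \<open>The coefficient is, up to sign, the determinant of the blocks \<open>(I, 0, C; 0, 0, U; C\<^sup>T, U\<^sup>T, 0)\<close>.
  A kernel vector \<open>(a, b, c)\<close> satisfies \<open>U c = 0\<close>, \<open>a = - C c\<close> and \<open>U\<^sup>T b = - C\<^sup>T a\<close>; so it vanishes
  if \<open>U\<close> is nonsingular on the chosen rows and columns, and otherwise \<open>(0, b, 0)\<close> with
  \<open>U\<^sup>T b = 0\<close> is a nonzero one.\<close>

lemma coeff_cur_poly_nonzero_iff:
  assumes S: "S \<in> ksubsets m k" and W: "W \<in> ksubsets l k"
  shows "coeff (cur_poly S W A C U R) d \<noteq> 0 \<longleftrightarrow> ker_trivial (\<lambda>i j. U $$ (i, j)) S W"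
proof -
  have SW: "finite S" "card S = k" "finite W" "card W = k"
    using S W finite_subset[OF _ finite_lessThan] by (auto simp: ksubsets_def)
  let ?I = "cur_index n S W 0"
  have fI: "finite ?I" using SW by simp
  have "coeff (cur_poly S W A C U R) d = idet ?I (\<lambda>i j. cur_sign i * H i j)"
    using coeff_pdet_top[of "cur_index n S W d" cur_sign H K] SW
    unfolding index_diff choice_of_pair(3)[OF S W] choice_of_pair(2)[OF S W, symmetric] by simp
  then have iff: "coeff (cur_poly S W A C U R) d \<noteq> 0 \<longleftrightarrow>
     \<not> (\<exists>v. (\<exists>i\<in>?I. v i \<noteq> 0) \<and> (\<forall>i\<in>?I. (\<Sum>j\<in>?I. cur_sign i * H i j * v j) = 0))"
    using idet_eq_0_iff_kernel[OF fI, of "\<lambda>i j. cur_sign i * H i j"] by simp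
  have rows: "i < n \<Longrightarrow> (\<Sum>j\<in>?I. cur_sign (Obs i) * H (Obs i) j * v j) =
      v (Obs i) + (\<Sum>w\<in>W. C $$ (i, w) * v (Col w))"
    "(\<Sum>j\<in>?I. cur_sign (Row s) * H (Row s) j * v j) = (\<Sum>w\<in>W. U $$ (s, w) * v (Col w))"
    "(\<Sum>j\<in>?I. cur_sign (Col w) * H (Col w) j * v j) =
      - ((\<Sum>i<n. C $$ (i, w) * v (Obs i)) + (\<Sum>s\<in>S. U $$ (s, w) * v (Row s)))" for v i s w
    by (simp_all add: sum_cur_index SW if_distrib[of "\<lambda>x. x * _"] sum_negf cong: if_cong)
  show ?thesis unfolding iff
  proof
    assume nok: "\<not> (\<exists>v. (\<exists>i\<in>?I. v i \<noteq> 0) \<and> (\<forall>i\<in>?I. (\<Sum>j\<in>?I. cur_sign i * H i j * v j) = 0))"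
    have "ker_trivial (\<lambda>w s. U $$ (s, w)) W S"
      unfolding ker_trivial_def
    proof (intro allI impI, rule ccontr)
      fix b assume b: "\<forall>w\<in>W. (\<Sum>s\<in>S. U $$ (s, w) * b s) = 0" and "\<not> (\<forall>s\<in>S. b s = 0)"
      then obtain s where s: "s \<in> S" "b s \<noteq> 0" by blast
      define v where "v i = (case i of Row s \<Rightarrow> b s | _ \<Rightarrow> 0)" for i
      have "\<exists>i\<in>?I. v i \<noteq> 0" using s by (intro bexI[of _ "Row s"]) (auto simp: v_def cur_index_def)
      moreover have "\<forall>i\<in>?I. (\<Sum>j\<in>?I. cur_sign i * H i j * v j) = 0"
      proof
        fix i assume "i \<in> ?I"
        then consider j where "i = Obs j" "j < n" | s where "i = Row s" | w where "i = Col w" "w \<in> W"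
          by (auto simp: cur_index_def)
        then show "(\<Sum>j\<in>?I. cur_sign i * H i j * v j) = 0"
          by cases (simp_all only: rows, simp_all add: v_def b)
      qed
      ultimately show False using nok by blast
    qed
    then show "ker_trivial (\<lambda>i j. U $$ (i, j)) S W"
      using ker_trivial_transpose[of S W "\<lambda>i j. U $$ (i, j)"] SW by simp
  next
    assume tr: "ker_trivial (\<lambda>i j. U $$ (i, j)) S W"
    then have tr': "ker_trivial (\<lambda>w s. U $$ (s, w)) W S"
      using ker_trivial_transpose[of W S "\<lambda>w s. U $$ (s, w)"] SW by simp
    show "\<not> (\<exists>v. (\<exists>i\<in>?I. v i \<noteq> 0) \<and> (\<forall>i\<in>?I. (\<Sum>j\<in>?I. cur_sign i * H i j * v j) = 0))"
    proof
      assume "\<exists>v. (\<exists>i\<in>?I. v i \<noteq> 0) \<and> (\<forall>i\<in>?I. (\<Sum>j\<in>?I. cur_sign i * H i j * v j) = 0)"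
      then obtain v where v: "\<exists>i\<in>?I. v i \<noteq> 0" and ker: "\<And>i. i \<in> ?I \<Longrightarrow> (\<Sum>j\<in>?I. cur_sign i * H i j * v j) = 0"
        by blast
      have mem: "Obs i \<in> ?I" if "i < n" for i using that by (simp add: cur_index_def)
      have memR: "Row s \<in> ?I" if "s \<in> S" for s using that by (simp add: cur_index_def)
      have memC: "Col w \<in> ?I" if "w \<in> W" for w using that by (simp add: cur_index_def)
      have "\<forall>s\<in>S. (\<Sum>w\<in>W. U $$ (s, w) * v (Col w)) = 0" using ker[OF memR] unfolding rows by blast
      then have c: "\<forall>w\<in>W. v (Col w) = 0"
        using tr[unfolded ker_trivial_def, THEN spec, of "\<lambda>w. v (Col w)"] by blast
      have a: "v (Obs i) = 0" if "i < n" for i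
        using ker[OF mem[OF that]] c unfolding rows(1)[OF that] by simp
      have "\<forall>w\<in>W. (\<Sum>s\<in>S. U $$ (s, w) * v (Row s)) = 0"
      proof
        fix w assume "w \<in> W"
        from ker[OF memC[OF this]] show "(\<Sum>s\<in>S. U $$ (s, w) * v (Row s)) = 0"
          unfolding rows by (simp add: a)
      qed
      then have "\<forall>s\<in>S. v (Row s) = 0"
        using tr'[unfolded ker_trivial_def, THEN spec, of "\<lambda>s. v (Row s)"] by blast
      then show False using v a c by (auto simp: cur_index_def)
    qed
  qed
qed

lemma coeff_cur_poly_nonneg:
  assumes S: "S \<in> ksubsets m k" and W: "W \<in> ksubsets l k"
  shows "0 \<le> coeff (cur_poly S W A C U R) d"
proof -
  have SW: "finite S" "finite W"
    using S W finite_subset[OF _ finite_lessThan] by (auto simp: ksubsets_def)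
  let ?I = "cur_index n S W 0"
  have "coeff (cur_poly S W A C U R) d = idet ?I (\<lambda>i j. cur_sign i * H i j)"
    using coeff_pdet_top[of "cur_index n S W d" cur_sign H K] SW
    unfolding index_diff choice_of_pair(3)[OF S W] choice_of_pair(2)[OF S W, symmetric] by simp
  also have "\<dots> = poly (pdet cur_sign H {} ?I) 0" unfolding poly_pdet by (rule idet_cong) auto
  also have "0 \<le> \<dots>"
    using SW by (intro poly_pdet_nonneg cur_entry_skew cur_entry_diag) auto
  finally show ?thesis .
qed

lemma submatrix_inverse:
  assumes S: "S \<in> ksubsets m k" and W: "W \<in> ksubsets l k" and tr: "ker_trivial (\<lambda>i j. U $$ (i, j)) S W"
  obtains N where "mat_inverse (submatrix U S W) = Some N" "N \<in> carrier_mat k k"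
    "submatrix U S W * N = 1\<^sub>m k" "N * submatrix U S W = 1\<^sub>m k"
proof -
  let ?M = "submatrix U S W"
  have SW: "S \<subseteq> {..<m}" "card S = k" "W \<subseteq> {..<l}" "card W = k" "finite S" "finite W"
    using S W finite_subset[OF _ finite_lessThan] by (auto simp: ksubsets_def)
  have M: "?M \<in> carrier_mat k k" using submatrix_carrier(1)[OF U SW(1,3)] by (simp add: SW)
  have "det ?M \<noteq> 0"
  proof
    assume "det ?M = 0"
    then have "idet {..<k} (\<lambda>i j. ?M $$ (i, j)) = 0" using det_eq_idet[OF M] by simp
    then obtain v j0 where v: "j0 < k" "v j0 \<noteq> 0" "\<And>i. i < k \<Longrightarrow> (\<Sum>j<k. ?M $$ (i, j) * v j) = 0"
      using idet_eq_0_iff_kernel[of "{..<k}" "\<lambda>i j. ?M $$ (i, j)"] by auto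
    have bS: "bij_betw (pick S) {..<k} S" and bW: "bij_betw (pick W) {..<k} W"
      using bij_betw_pick[OF SW(5)] bij_betw_pick[OF SW(6)] SW by simp_all
    define c where "c w = v (inv_into {..<k} (pick W) w)" for w
    have c: "c (pick W j) = v j" if "j < k" for j
      using bij_betw_inv_into_left[OF bW, of j] that by (simp add: c_def)
    have "(\<Sum>w\<in>W. U $$ (s, w) * c w) = 0" if "s \<in> S" for s
    proof -
      obtain i where i: "i < k" "s = pick S i" using \<open>s \<in> S\<close> bS by (auto simp: bij_betw_def)
      have "(\<Sum>w\<in>W. U $$ (s, w) * c w) = (\<Sum>j<k. U $$ (s, pick W j) * c (pick W j))"
        by (rule sum.reindex_bij_betw[OF bW, symmetric])
      also have "\<dots> = (\<Sum>j<k. ?M $$ (i, j) * v j)"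
        using submatrix_entry(1)[OF U SW(1,3)] i SW by (intro sum.cong refl) (simp add: c)
      finally show ?thesis using v(3)[OF i(1)] by simp
    qed
    then have "\<forall>w\<in>W. c w = 0" using tr unfolding ker_trivial_def by blast
    moreover have "pick W j0 \<in> W" using pick_in_set_le v(1) SW by simp
    ultimately show False using c[OF v(1)] v(2) by simp
  qed
  then have unit: "?M \<in> Units (ring_mat TYPE(real) k ())"
    by (rule det_non_zero_imp_unit[OF M])
  obtain N where N: "mat_inverse ?M = Some N"
    using mat_inverse(1)[OF M, where b = "()"] unit by (cases "mat_inverse ?M") auto
  with mat_inverse(2)[OF M N] that show thesis by blast
qed
end

section \<open>The spectral norm of the residual\<close>

lemma mult_mat_vec_index:
  assumes "Q \<in> carrier_mat r d" "u \<in> carrier_vec d" "i < r"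
  shows "(Q *\<^sub>v u) $ i = (\<Sum>j<d. Q $$ (i, j) * u $ j)"
  using assms by (simp add: scalar_prod_def atLeast0LessThan)

lemma minus_self_vec: "(-1) \<cdot>\<^sub>v w + w = 0\<^sub>v r" if "(w :: real vec) \<in> carrier_vec r"
  by (rule eq_vecI) (use that in auto)

lemma transpose_minus_mat:
  assumes "X \<in> carrier_mat n d" "Y \<in> carrier_mat n d"
  shows "transpose_mat (X - Y) = transpose_mat X - transpose_mat Y"
  by (rule eq_matI) (use assms in auto)

text \<open>The maximum of the Rayleigh quotient of \<open>M\<^sup>T M\<close> is an eigenvalue and bounds \<open>|M u|\<^sup>2\<close> on the
  unit ball.\<close>

lemma spectral_norm_le:
  fixes M :: "real mat"
  assumes M: "M \<in> carrier_mat n d" and d: "0 < d"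
    and eig: "\<And>t v. v \<in> carrier_vec d \<Longrightarrow> v \<noteq> 0\<^sub>v d \<Longrightarrow> transpose_mat M *\<^sub>v (M *\<^sub>v v) = t \<cdot>\<^sub>v v \<Longrightarrow> t \<le> b"
  shows "(spectral_norm M)\<^sup>2 \<le> b"
proof -
  define G where "G i j = (transpose_mat M * M) $$ (i, j)" for i j
  have MM: "transpose_mat M * M \<in> carrier_mat d d" using M by simp
  have "transpose_mat (transpose_mat M * M) = transpose_mat M * M"
    using M by (subst transpose_mult[of _ d n _ d]) auto
  then have sym: "G i j = G j i" if "i < d" "j < d" for i j
  proof -
    have "(transpose_mat M * M) $$ (i, j) = transpose_mat (transpose_mat M * M) $$ (i, j)"
      by (simp only: \<open>transpose_mat (transpose_mat M * M) = transpose_mat M * M\<close>)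
    also have "\<dots> = (transpose_mat M * M) $$ (j, i)"
      using that MM by (intro index_transpose_mat(1)) (simp_all only: carrier_matD)
    finally show ?thesis by (simp only: G_def)
  qed
  have "\<exists>v t. (\<exists>i\<in>{..<d}. v i \<noteq> 0) \<and> (\<forall>i\<in>{..<d}. (\<Sum>j\<in>{..<d}. G i j * v j) = t * v i) \<and>
    (\<forall>w. (\<Sum>i\<in>{..<d}. \<Sum>j\<in>{..<d}. w i * G i j * w j) \<le> t * (\<Sum>i\<in>{..<d}. (w i)\<^sup>2))"
    by (rule rayleigh_maximum) (use d sym in auto)
  then obtain v t where v: "\<exists>i<d. v i \<noteq> 0" "\<And>i. i < d \<Longrightarrow> (\<Sum>j<d. G i j * v j) = t * v i"
    and max: "\<And>w. (\<Sum>i<d. \<Sum>j<d. w i * G i j * w j) \<le> t * (\<Sum>i<d. (w i)\<^sup>2)"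
    by auto
  have G_mult: "(transpose_mat M *\<^sub>v (M *\<^sub>v u)) $ i = (\<Sum>j<d. G i j * u $ j)" if "i < d" "u \<in> carrier_vec d" for i u
  proof -
    have "transpose_mat M *\<^sub>v (M *\<^sub>v u) = (transpose_mat M * M) *\<^sub>v u"
      using M that by (simp add: assoc_mult_mat_vec[of _ d n _ d])
    also have "((transpose_mat M * M) *\<^sub>v u) $ i = (\<Sum>j<d. G i j * u $ j)"
      unfolding G_def by (rule mult_mat_vec_index[OF MM that(2,1)])
    finally show ?thesis .
  qed
  define x where "x = vec d v"
  have x: "x \<in> carrier_vec d" by (simp add: x_def)
  have "x \<noteq> 0\<^sub>v d" using v(1) by (auto simp: x_def vec_eq_iff)
  moreover have "transpose_mat M *\<^sub>v (M *\<^sub>v x) = t \<cdot>\<^sub>v x"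
  proof (rule eq_vecI)
    fix i assume "i < dim_vec (t \<cdot>\<^sub>v x)"
    then have i: "i < d" by (simp add: x_def)
    have "(transpose_mat M *\<^sub>v (M *\<^sub>v x)) $ i = (\<Sum>j<d. G i j * v j)"
      unfolding G_mult[OF i x] by (simp add: x_def)
    then show "(transpose_mat M *\<^sub>v (M *\<^sub>v x)) $ i = (t \<cdot>\<^sub>v x) $ i"
      using v(2)[OF i] i by (simp add: x_def)
  qed (use M in \<open>simp add: x_def\<close>)
  ultimately have tb: "t \<le> b" by (rule eig[OF x])
  have form: "(M *\<^sub>v u) \<bullet> (M *\<^sub>v u) = (\<Sum>i<d. \<Sum>j<d. u $ i * G i j * u $ j)" if u: "u \<in> carrier_vec d" for u
  proof -
    have "(M *\<^sub>v u) \<bullet> (M *\<^sub>v u) = u \<bullet> (transpose_mat M *\<^sub>v (M *\<^sub>v u))"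
      using transpose_vec_mult_scalar[OF M u, of "M *\<^sub>v u"] M u
      by (metis comm_scalar_prod mult_mat_vec_carrier transpose_carrier_mat)
    also have "\<dots> = (\<Sum>i<d. u $ i * (\<Sum>j<d. G i j * u $ j))"
    proof -
      have "dim_vec (transpose_mat M *\<^sub>v (M *\<^sub>v u)) = d" using M by simp
      then have "u \<bullet> (transpose_mat M *\<^sub>v (M *\<^sub>v u)) = (\<Sum>i<d. u $ i * (transpose_mat M *\<^sub>v (M *\<^sub>v u)) $ i)"
        by (simp only: scalar_prod_def atLeast0LessThan)
      also have "\<dots> = (\<Sum>i<d. u $ i * (\<Sum>j<d. G i j * u $ j))"
        by (intro sum.cong refl) (simp only: lessThan_iff G_mult[OF _ u])
      finally show ?thesis .
    qed
    finally show ?thesis by (simp add: sum_distrib_left mult.assoc)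
  qed
  have le: "(M *\<^sub>v u) \<bullet> (M *\<^sub>v u) \<le> t * (u \<bullet> u)" if u: "u \<in> carrier_vec d" for u
    using max[of "\<lambda>i. u $ i"] u unfolding form[OF u]
    by (simp add: scalar_prod_def[of u u] power2_eq_square atLeast0LessThan)
  have nonneg: "0 \<le> w \<bullet> w" for w :: "real vec"
    unfolding scalar_prod_def by (intro sum_nonneg) simp
  have "0 < x \<bullet> x"
  proof -
    obtain i where i: "i < d" "v i \<noteq> 0" using v(1) by blast
    have "0 < x $ i * x $ i" using i by (auto simp: x_def zero_less_mult_iff linorder_neq_iff)
    also have "\<dots> \<le> (\<Sum>i<d. x $ i * x $ i)" using i by (intro member_le_sum) auto
    finally show ?thesis by (simp add: scalar_prod_def x_def atLeast0LessThan)
  qed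
  moreover have "0 \<le> t * (x \<bullet> x)" using le[OF x] nonneg[of "M *\<^sub>v x"] by linarith
  ultimately have t0: "0 \<le> t" by (simp add: zero_le_mult_iff)
  let ?V = "{sqrt ((M *\<^sub>v u) \<bullet> (M *\<^sub>v u)) | u. u \<in> carrier_vec (dim_col M) \<and> u \<bullet> u \<le> 1}"
  have dimM: "dim_col M = d" using M by simp
  have ub: "s \<le> sqrt t" if "s \<in> ?V" for s
  proof -
    obtain u where u: "s = sqrt ((M *\<^sub>v u) \<bullet> (M *\<^sub>v u))" "u \<in> carrier_vec d" "u \<bullet> u \<le> 1"
      using \<open>s \<in> ?V\<close> dimM by auto
    have "(M *\<^sub>v u) \<bullet> (M *\<^sub>v u) \<le> t * (u \<bullet> u)" by (rule le[OF u(2)])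
    also have "\<dots> \<le> t * 1" using u(3) t0 by (rule mult_left_mono)
    finally show ?thesis by (simp add: u(1))
  qed
  have "(0\<^sub>v d :: real vec) \<bullet> 0\<^sub>v d = 0" by (simp add: scalar_prod_def)
  then have mem: "sqrt ((M *\<^sub>v 0\<^sub>v d) \<bullet> (M *\<^sub>v 0\<^sub>v d)) \<in> ?V" using dimM by (auto intro!: exI[of _ "0\<^sub>v d"])
  have "spectral_norm M \<le> sqrt t"
    unfolding spectral_norm_def by (rule cSup_least) (use mem ub in blast)+
  moreover have "0 \<le> spectral_norm M"
  proof -
    have "0 \<le> sqrt ((M *\<^sub>v 0\<^sub>v d) \<bullet> (M *\<^sub>v 0\<^sub>v d))" using nonneg by simp
    also have "\<dots> \<le> spectral_norm M"
      unfolding spectral_norm_def by (rule cSup_upper[OF mem]) (use ub in \<open>auto intro!: bdd_aboveI\<close>)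
    finally show ?thesis .
  qed
  ultimately have "(spectral_norm M)\<^sup>2 \<le> (sqrt t)\<^sup>2" by (intro power_mono)
  then show ?thesis using t0 tb by simp
qed

context cur_data
begin

definition real_block :: "nat set \<Rightarrow> nat set \<Rightarrow> real \<Rightarrow> real mat" where
  "real_block S W x = four_block_mat
     (four_block_mat (1\<^sub>m n) (0\<^sub>m n k) (0\<^sub>m k n) (0\<^sub>m k k))
     (four_block_mat (submatrix C UNIV W) A (submatrix U S W) (submatrix R S UNIV))
     (four_block_mat (transpose_mat (submatrix C UNIV W)) (transpose_mat (submatrix U S W))
        (transpose_mat A) (transpose_mat (submatrix R S UNIV)))
     (four_block_mat (0\<^sub>m k k) (0\<^sub>m k d) (0\<^sub>m d k) ((- x) \<cdot>\<^sub>m 1\<^sub>m d))"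

lemma poly_det_cur_block_mat:
  assumes S: "S \<in> ksubsets m k" and W: "W \<in> ksubsets l k"
  shows "poly (det (cur_block_mat S W A C U R)) x = det (real_block S W x)"
proof -
  have SW: "S \<subseteq> {..<m}" "card S = k" "W \<subseteq> {..<l}" "card W = k"
    using S W by (auto simp: ksubsets_def)
  note carr = submatrix_carrier(2)[OF C subset_refl SW(3)] submatrix_carrier(1)[OF U SW(1,3)]
    submatrix_carrier(3)[OF R SW(1) subset_refl] A
  note dims = carr[THEN carrier_matD(1), unfolded SW(2,4)] carr[THEN carrier_matD(2), unfolded SW(2,4)]
  have rb: "real_block S W x \<in> carrier_mat (n + k + k + d) (n + k + k + d)"
    unfolding real_block_def
    by (intro carrier_matI) (simp_all only: index_mat_four_block index_one_mat index_smult_mat index_zero_mat)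
  have "poly (det (cur_block_mat S W A C U R)) x =
      idet {..<n + k + k + d} (\<lambda>i j. poly (cur_block_mat S W A C U R $$ (i, j)) x)"
    by (simp only: det_eq_idet[OF cur_block_carrier[OF S W]] poly_idet)
  also have "\<dots> = idet {..<n + k + k + d} (\<lambda>i j. real_block S W x $$ (i, j))"
  proof (rule idet_cong)
    fix i j assume ij: "i \<in> {..<n + k + k + d}" "j \<in> {..<n + k + k + d}"
    have ci: "i < n \<or> (n \<le> i \<and> i < n + k) \<or> (n + k \<le> i \<and> i < n + k + k) \<or> n + k + k \<le> i" by linarith
    have cj: "j < n \<or> (n \<le> j \<and> j < n + k) \<or> (n + k \<le> j \<and> j < n + k + k) \<or> n + k + k \<le> j" by linarith
    show "poly (cur_block_mat S W A C U R $$ (i, j)) x = real_block S W x $$ (i, j)"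
      using ci cj ij unfolding cur_block_mat_def real_block_def Let_def SW(2) dims
      by (elim disjE conjE) (simp_all add: dims less_diff_conv2)
  qed
  also have "\<dots> = det (real_block S W x)" by (rule det_eq_idet[OF rb, symmetric])
  finally show ?thesis .
qed

text \<open>With \<open>u = E v\<close>, \<open>c = N R v\<close> and \<open>y = N\<^sup>T C\<^sup>T u\<close>, where \<open>C\<close>, \<open>U\<close>, \<open>R\<close> stand for the submatrices
  and \<open>N\<close> is the inverse of \<open>U\<close>, the vector \<open>(- u, y, - c, v)\<close> lies in the kernel of the block
  matrix at \<open>x = - t\<close>.  The first three block rows hold by the choice of the vectors, and the last
  one is the eigenvector equation.\<close>

lemma cur_poly_root_of_eigenvalue:
  assumes S: "S \<in> ksubsets m k" and W: "W \<in> ksubsets l k"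
    and N: "N \<in> carrier_mat k k" "submatrix U S W * N = 1\<^sub>m k" "N * submatrix U S W = 1\<^sub>m k"
  defines "E \<equiv> A - submatrix C UNIV W * N * submatrix R S UNIV"
  assumes v: "v \<in> carrier_vec d" "v \<noteq> 0\<^sub>v d" and eig: "transpose_mat E *\<^sub>v (E *\<^sub>v v) = t \<cdot>\<^sub>v v"
  shows "poly (cur_poly S W A C U R) (- t) = 0"
proof -
  have SW: "S \<subseteq> {..<m}" "card S = k" "W \<subseteq> {..<l}" "card W = k"
    using S W by (auto simp: ksubsets_def)
  let ?C = "submatrix C UNIV W" and ?U = "submatrix U S W" and ?R = "submatrix R S UNIV"
  have car: "?C \<in> carrier_mat n k" "?U \<in> carrier_mat k k" "?R \<in> carrier_mat k d"
    using submatrix_carrier(2)[OF C subset_refl SW(3)] submatrix_carrier(1)[OF U SW(1,3)]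
    submatrix_carrier(3)[OF R SW(1) subset_refl] SW by simp_all
  have CN: "?C * N \<in> carrier_mat n k" by (rule mult_carrier_mat[OF car(1) N(1)])
  have CNR: "?C * N * ?R \<in> carrier_mat n d" by (rule mult_carrier_mat[OF CN car(3)])
  have E: "E \<in> carrier_mat n d" unfolding E_def by (rule minus_carrier_mat[OF CNR])
  have tr: "transpose_mat A \<in> carrier_mat d n" "transpose_mat ?C \<in> carrier_mat k n"
    "transpose_mat ?U \<in> carrier_mat k k" "transpose_mat ?R \<in> carrier_mat d k"
    "transpose_mat N \<in> carrier_mat k k"
    using A car N(1) by simp_all
  define u where "u = E *\<^sub>v v"
  define c where "c = N *\<^sub>v (?R *\<^sub>v v)"
  define z where "z = transpose_mat ?C *\<^sub>v u"
  define y where "y = transpose_mat N *\<^sub>v z"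
  have u: "u \<in> carrier_vec n" unfolding u_def by (rule mult_mat_vec_carrier[OF E v(1)])
  have Rv: "?R *\<^sub>v v \<in> carrier_vec k" by (rule mult_mat_vec_carrier[OF car(3) v(1)])
  have c: "c \<in> carrier_vec k" unfolding c_def by (rule mult_mat_vec_carrier[OF N(1) Rv])
  have z: "z \<in> carrier_vec k" unfolding z_def by (rule mult_mat_vec_carrier[OF tr(2) u])
  have y: "y \<in> carrier_vec k" unfolding y_def by (rule mult_mat_vec_carrier[OF tr(5) z])
  have f1: "u = A *\<^sub>v v - ?C *\<^sub>v c"
    unfolding u_def E_def c_def minus_mult_distrib_mat_vec[OF A CNR v(1)]
      assoc_mult_mat_vec[OF CN car(3) v(1)] assoc_mult_mat_vec[OF car(1) N(1) Rv] ..
  have f2: "?U *\<^sub>v c = ?R *\<^sub>v v"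
    unfolding c_def assoc_mult_mat_vec[OF car(2) N(1) Rv, symmetric] N(2) by (rule one_mult_mat_vec[OF Rv])
  have f3: "transpose_mat ?U *\<^sub>v y = z"
    unfolding y_def assoc_mult_mat_vec[OF tr(3,5) z, symmetric] transpose_mult[OF N(1) car(2), symmetric] N(3)
    using z by simp
  have f4: "transpose_mat E *\<^sub>v u = transpose_mat A *\<^sub>v u - transpose_mat ?R *\<^sub>v y"
  proof -
    have NC: "transpose_mat N * transpose_mat ?C \<in> carrier_mat k n" by (rule mult_carrier_mat[OF tr(5,2)])
    have "transpose_mat (?C * N * ?R) = transpose_mat ?R * (transpose_mat N * transpose_mat ?C)"
      by (simp only: transpose_mult[OF CN car(3)] transpose_mult[OF car(1) N(1)])
    moreover have "transpose_mat E = transpose_mat A - transpose_mat (?C * N * ?R)"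
      unfolding E_def by (rule transpose_minus_mat[OF A CNR])
    ultimately have "transpose_mat E *\<^sub>v u =
        transpose_mat A *\<^sub>v u - (transpose_mat ?R * (transpose_mat N * transpose_mat ?C)) *\<^sub>v u"
      by (simp only: minus_mult_distrib_mat_vec[OF tr(1) mult_carrier_mat[OF tr(4) NC] u])
    then show ?thesis
      by (simp only: assoc_mult_mat_vec[OF tr(4) NC u] assoc_mult_mat_vec[OF tr(5,2) u] y_def z_def)
  qed
  let ?a = "(-1) \<cdot>\<^sub>v u" and ?c = "(-1) \<cdot>\<^sub>v c"
  have a': "?a \<in> carrier_vec n" and c': "?c \<in> carrier_vec k" using u c by simp_all
  let ?w = "(?a @\<^sub>v y) @\<^sub>v (?c @\<^sub>v v)"
  have top1: "four_block_mat (1\<^sub>m n) (0\<^sub>m n k) (0\<^sub>m k n) (0\<^sub>m k k) *\<^sub>v (?a @\<^sub>v y) = ?a @\<^sub>v 0\<^sub>v k"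
    by (subst four_block_mat_mult_vec[of _ n n _ k _ k _ _]) (use a' y in auto)
  have top2: "four_block_mat ?C A ?U ?R *\<^sub>v (?c @\<^sub>v v) = u @\<^sub>v 0\<^sub>v k"
  proof -
    have "four_block_mat ?C A ?U ?R *\<^sub>v (?c @\<^sub>v v) = (?C *\<^sub>v ?c + A *\<^sub>v v) @\<^sub>v (?U *\<^sub>v ?c + ?R *\<^sub>v v)"
      by (rule four_block_mat_mult_vec[OF car(1) A car(2,3) c' v(1)])
    also have "?C *\<^sub>v ?c + A *\<^sub>v v = u"
      unfolding f1 mult_mat_vec[OF car(1) c] using A car(1) v(1) c by (intro eq_vecI) auto
    also have "?U *\<^sub>v ?c + ?R *\<^sub>v v = 0\<^sub>v k"
      unfolding mult_mat_vec[OF car(2) c] f2 by (rule minus_self_vec[OF Rv])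
    finally show ?thesis .
  qed
  have bot1: "four_block_mat (transpose_mat ?C) (transpose_mat ?U) (transpose_mat A) (transpose_mat ?R) *\<^sub>v (?a @\<^sub>v y)
      = 0\<^sub>v k @\<^sub>v ((-t) \<cdot>\<^sub>v v)"
  proof -
    have "four_block_mat (transpose_mat ?C) (transpose_mat ?U) (transpose_mat A) (transpose_mat ?R) *\<^sub>v (?a @\<^sub>v y)
      = (transpose_mat ?C *\<^sub>v ?a + transpose_mat ?U *\<^sub>v y) @\<^sub>v (transpose_mat A *\<^sub>v ?a + transpose_mat ?R *\<^sub>v y)"
      by (rule four_block_mat_mult_vec[OF tr(2,3,1,4) a' y])
    also have "transpose_mat ?C *\<^sub>v ?a + transpose_mat ?U *\<^sub>v y = 0\<^sub>v k"
      unfolding mult_mat_vec[OF tr(2) u] f3 z_def[symmetric] by (rule minus_self_vec[OF z])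
    also have "transpose_mat A *\<^sub>v ?a + transpose_mat ?R *\<^sub>v y = (-t) \<cdot>\<^sub>v v"
    proof (rule eq_vecI)
      fix i assume "i < dim_vec ((-t) \<cdot>\<^sub>v v)"
      then have i: "i < d" using v(1) by simp
      have "transpose_mat A *\<^sub>v u - transpose_mat ?R *\<^sub>v y = t \<cdot>\<^sub>v v"
        using f4 eig unfolding u_def by simp
      then have "(transpose_mat A *\<^sub>v u - transpose_mat ?R *\<^sub>v y) $ i = t * v $ i"
        using i v(1) by simp
      moreover have "(transpose_mat A *\<^sub>v u - transpose_mat ?R *\<^sub>v y) $ i =
          (transpose_mat A *\<^sub>v u) $ i - (transpose_mat ?R *\<^sub>v y) $ i"
        using i tr(4) by (intro index_minus_vec(1)) simp
      moreover have "(transpose_mat A *\<^sub>v ?a + transpose_mat ?R *\<^sub>v y) $ i =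
          (-1) * (transpose_mat A *\<^sub>v u) $ i + (transpose_mat ?R *\<^sub>v y) $ i"
      proof -
        have "i < dim_vec (transpose_mat ?R *\<^sub>v y)" "i < dim_vec (transpose_mat A *\<^sub>v u)"
          using i tr(1,4) by simp_all
        then show ?thesis unfolding mult_mat_vec[OF tr(1) u]
          by (simp only: index_add_vec(1) index_smult_vec(1))
      qed
      moreover have "((-t) \<cdot>\<^sub>v v) $ i = - (t * v $ i)" using i v(1) by simp
      ultimately show "(transpose_mat A *\<^sub>v ?a + transpose_mat ?R *\<^sub>v y) $ i = ((-t) \<cdot>\<^sub>v v) $ i"
        by linarith
    qed (use tr(4) v(1) in simp)
    finally show ?thesis .
  qed
  have bot2: "four_block_mat (0\<^sub>m k k) (0\<^sub>m k d) (0\<^sub>m d k) ((- (- t)) \<cdot>\<^sub>m 1\<^sub>m d) *\<^sub>v (?c @\<^sub>v v) = 0\<^sub>v k @\<^sub>v (t \<cdot>\<^sub>v v)"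
  proof -
    have "(t \<cdot>\<^sub>m 1\<^sub>m d) *\<^sub>v v = t \<cdot>\<^sub>v v" using v(1) by (intro eq_vecI) auto
    then show ?thesis
      by (subst four_block_mat_mult_vec[of _ k k _ d _ d _ _]) (use c' v(1) in auto)
  qed
  have "real_block S W (- t) *\<^sub>v ?w = ((?a @\<^sub>v 0\<^sub>v k) + (u @\<^sub>v 0\<^sub>v k)) @\<^sub>v ((0\<^sub>v k @\<^sub>v ((-t) \<cdot>\<^sub>v v)) + (0\<^sub>v k @\<^sub>v (t \<cdot>\<^sub>v v)))"
    unfolding real_block_def top1[symmetric] top2[symmetric] bot1[symmetric] bot2[symmetric]
    by (rule four_block_mat_mult_vec[of _ "n + k" "n + k" _ "k + d" _ "k + d"])
      (use A car a' c' y v(1) in auto)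
  also have "\<dots> = 0\<^sub>v (n + k + k + d)"
    using u v(1) by (intro eq_vecI) auto
  finally have ker: "real_block S W (- t) *\<^sub>v ?w = 0\<^sub>v (n + k + k + d)" .
  have rb: "real_block S W (- t) \<in> carrier_mat (n + k + k + d) (n + k + k + d)"
    unfolding real_block_def using A car by (intro carrier_matI) auto
  have w: "?w \<in> carrier_vec (n + k + k + d)"
    using append_carrier_vec[OF append_carrier_vec[OF a' y] append_carrier_vec[OF c' v(1)]] by (simp add: add.assoc)
  obtain i where i: "i < d" "v $ i \<noteq> 0" using v by (auto simp: vec_eq_iff)
  have "?w $ (n + k + k + i) = v $ i"
    using i u c y v(1) by simp
  then have "?w \<noteq> 0\<^sub>v (n + k + k + d)" using i by (metis add_less_cancel_left index_zero_vec(1))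
  then have "det (real_block S W (- t)) = 0"
    unfolding det_0_iff_vec_prod_zero[OF rb] using w ker by blast
  then show ?thesis by (simp add: cur_poly_def poly_det_cur_block_mat[OF S W])
qed
end

section \<open>The submatrix with small residual\<close>

lemma real_rooted_has_root:
  assumes "real_rooted f" "0 < degree f"
  shows "\<exists>x. poly f x = 0"
proof -
  have "\<not> constant (poly (cpoly f))"
    using assms(2) by (simp add: constant_degree degree_map_poly)
  then obtain z where z: "poly (cpoly f) z = 0" using fundamental_theorem_of_algebra by blast
  then have "z \<in> \<real>" using assms(1) by (simp add: real_rooted_def)
  then obtain x where "z = of_real x" by (auto elim: Reals_cases)
  then have "complex_of_real (poly f x) = 0" using z by simp
  then show ?thesis by (intro exI[of _ x]) (simp only: of_real_eq_0_iff)
qed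

lemma minroot_root:
  assumes "f \<noteq> 0" "\<exists>x. poly f x = 0"
  shows "poly f (minroot f) = 0" "poly f x = 0 \<Longrightarrow> minroot f \<le> x"
proof -
  have fin: "finite {x. poly f x = 0}" using assms(1) by (rule poly_roots_finite)
  show "poly f (minroot f) = 0" using Min_in[OF fin] assms(2) unfolding minroot_def by blast
  show "poly f x = 0 \<Longrightarrow> minroot f \<le> x" using Min_le[OF fin] unfolding minroot_def by blast
qed

lemma maxroot_reflect:
  assumes "f \<noteq> 0" "\<exists>x. poly f x = 0"
  shows "maxroot (pcompose f [:0, -1:]) = - minroot f"
proof -
  have fin: "finite {x. poly f x = 0}" using assms(1) by (rule poly_roots_finite)
  have "{x. poly (pcompose f [:0, -1:]) x = 0} = uminus ` {x. poly f x = 0}"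
    by (auto simp: poly_pcompose image_iff intro: exI[of _ "- _"]) (metis minus_minus)
  then have "maxroot (pcompose f [:0, -1:]) = Max (uminus ` {x. poly f x = 0})"
    by (simp add: maxroot_def)
  also have "\<dots> = - minroot f"
    by (rule Max_eqI) (use fin minroot_root[OF assms] in auto)
  finally show ?thesis .
qed

context cur_data
begin

text \<open>The leading coefficients of the summands are nonnegative and one is positive, so the sum has
  degree \<open>d\<close> and \<open>select_pdet\<close> applies with its smallest root as the threshold \<open>r\<close>.\<close>

lemma exists_good_submatrices:
  assumes d: "0 < d" and k: "k \<le> vec_space.rank m U"
  shows "real_rooted (cur_sum_poly k A C U R) \<and>
    (\<exists>S\<in>ksubsets m k. \<exists>W\<in>ksubsets l k.
       invertible_mat (submatrix U S W) \<and>
       real_rooted (cur_poly S W A C U R) \<and>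
       minroot (cur_poly S W A C U R) \<ge> minroot (cur_sum_poly k A C U R) \<and>
       (spectral_norm (A - submatrix C UNIV W * the (mat_inverse (submatrix U S W))
                             * submatrix R S UNIV))\<^sup>2
         \<le> maxroot (pcompose (cur_sum_poly k A C U R) [:0, -1:]))"
proof -
  let ?P = "cur_sum_poly k A C U R"
  let ?p = "\<lambda>X. pdet cur_sign H K (B \<union> X)"
  have fins: "finite B" "finite (Row ` {..<m})" "finite (Col ` {..<l})" by simp_all
  have disj: "B \<inter> Row ` {..<m} = {}" "B \<inter> Col ` {..<l} = {}" "Row ` {..<m} \<inter> Col ` {..<l} = {}"
    by auto
  have cK: "card K = d" by (simp add: card_image inj_on_def)
  have finch: "finite choices"
    unfolding choices_def by (rule finite_subset[of _ "Pow (Row ` {..<m} \<union> Col ` {..<l})"]) auto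
  obtain S0 W0 where SW0: "S0 \<subseteq> {..<m}" "W0 \<subseteq> {..<l}" "card S0 = k" "card W0 = k"
    "ker_trivial (\<lambda>i j. U $$ (i, j)) S0 W0"
    using rank_ge_nonsingular_minor[OF U k] by blast
  then have ks0: "S0 \<in> ksubsets m k" "W0 \<in> ksubsets l k" by (auto simp: ksubsets_def)
  have nonneg: "0 \<le> coeff (?p X) d" if X: "X \<in> choices" for X
  proof -
    obtain S W where SW: "S \<in> ksubsets m k" "W \<in> ksubsets l k" "X = Row ` S \<union> Col ` W"
      using pair_of_choice[OF X] by blast
    show ?thesis using coeff_cur_poly_nonneg[OF SW(1,2)] choice_of_pair(3)[OF SW(1,2)] SW(3) by simp
  qed
  have "0 < coeff ?P d"
    unfolding cur_sum_poly_eq coeff_sum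
  proof (rule sum_pos2[OF finch choice_of_pair(1)[OF ks0]])
    show "0 < coeff (?p (Row ` S0 \<union> Col ` W0)) d"
      using coeff_cur_poly_nonzero_iff[OF ks0] coeff_cur_poly_nonneg[OF ks0] SW0(5)
      unfolding choice_of_pair(3)[OF ks0] by simp
  qed (use nonneg in auto)
  then have Pd: "coeff ?P d \<noteq> 0" and P0: "?P \<noteq> 0" by auto
  have "?P = (\<Sum>X | (X \<subseteq> Row ` {..<m} \<union> Col ` {..<l} \<and> card (X \<inter> Row ` {..<m}) = k \<and>
      card (X \<inter> Col ` {..<l}) = k) \<and> {} \<subseteq> X \<and> X \<inter> {} = {}. ?p X)"
    unfolding cur_sum_poly_eq choices_def by simp
  moreover have "\<dots> = 0 \<or> real_rooted \<dots>"
    by (rule restricted_sum_real_rooted[OF fins disj cur_entry_sym]) auto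
  ultimately have rrP: "real_rooted ?P" using P0 by simp
  have "0 < degree ?P" using Pd le_degree[of ?P d] d by simp
  then have rootP: "\<exists>x. poly ?P x = 0" using real_rooted_has_root[OF rrP] by blast
  define r where "r = minroot ?P"
  have r: "poly ?P r = 0" "\<And>x. poly ?P x = 0 \<Longrightarrow> r \<le> x"
    using minroot_root[OF P0 rootP] by (auto simp: r_def)
  have r0: "r \<le> 0"
  proof (rule ccontr)
    assume "\<not> r \<le> 0"
    then have rpos: "0 < r" by simp
    have fJ: "finite (B \<union> X)" if "X \<in> choices" for X
      using that finite_subset[of X "Row ` {..<m} \<union> Col ` {..<l}"] by (auto simp: choices_def)
    have "(\<Sum>X\<in>choices. poly (?p X) r) = 0" using r(1) by (simp add: cur_sum_poly_eq poly_sum)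
    moreover have "0 \<le> poly (?p X) r" if "X \<in> choices" for X
      using rpos by (intro poly_pdet_nonneg fJ[OF that] cur_entry_skew cur_entry_diag) auto
    ultimately have "\<forall>X\<in>choices. poly (?p X) r = 0"
      using finch by (subst (asm) sum_nonneg_eq_0_iff) auto
    then have "?p X = 0" if "X \<in> choices" for X
      using that rpos by (intro pdet_eq_0_if_positive_root[of _ _ _ r] fJ cur_entry_skew cur_entry_diag) auto
    then have "?P = 0" by (simp add: cur_sum_poly_eq)
    then show False using P0 by simp
  qed
  have good: "no_root_below (card K) r (\<Sum>X\<in>choices. ?p X)"
    using Pd r unfolding no_root_below_def cK cur_sum_poly_eq[symmetric] by fastforce
  have "\<exists>X\<in>choices. no_root_below (card K) r (?p X) \<and> real_rooted (?p X)"
    unfolding choices_def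
    by (rule select_pdet[OF fins disj cur_entry_sym _ _ _ _ cur_entry_skew cur_entry_diag r0 good[unfolded choices_def]]) auto
  then obtain X where X: "X \<in> choices" "no_root_below d r (?p X)" "real_rooted (?p X)"
    unfolding cK by blast
  obtain S W where SW: "S \<in> ksubsets m k" "W \<in> ksubsets l k" "X = Row ` S \<union> Col ` W"
    using pair_of_choice[OF X(1)] by blast
  let ?f = "cur_poly S W A C U R"
  have f: "no_root_below d r ?f" "real_rooted ?f"
    using X(2,3) unfolding choice_of_pair(3)[OF SW(1,2)] SW(3) by simp_all
  have tr: "ker_trivial (\<lambda>i j. U $$ (i, j)) S W"
    using f(1) coeff_cur_poly_nonzero_iff[OF SW(1,2)] by (simp add: no_root_below_def)
  obtain N where N: "mat_inverse (submatrix U S W) = Some N" "N \<in> carrier_mat k k"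
    "submatrix U S W * N = 1\<^sub>m k" "N * submatrix U S W = 1\<^sub>m k"
    using submatrix_inverse[OF SW(1,2) tr] by blast
  have cU: "submatrix U S W \<in> carrier_mat k k"
    using submatrix_carrier(1)[OF U, of S W] SW(1,2) by (auto simp: ksubsets_def)
  have inv: "invertible_mat (submatrix U S W)"
    unfolding invertible_mat_def inverts_mat_def using cU N by auto
  have rootle: "r \<le> x" if "poly ?f x = 0" for x
    using f(1) that unfolding no_root_below_def by (meson not_le)
  have "coeff ?f d \<noteq> 0" using f(1) by (simp add: no_root_below_def)
  then have "0 < degree ?f" using le_degree[of ?f d] d by simp
  then have rootf: "\<exists>x. poly ?f x = 0" using real_rooted_has_root[OF f(2)] by blast
  have "?f \<noteq> 0" using f(2) by (simp add: real_rooted_def)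
  then have min: "minroot ?P \<le> minroot ?f"
    using rootle minroot_root(1)[OF _ rootf] unfolding r_def by blast
  let ?E = "A - submatrix C UNIV W * N * submatrix R S UNIV"
  have E: "?E \<in> carrier_mat n d"
  proof -
    have "submatrix C UNIV W \<in> carrier_mat n k" "submatrix R S UNIV \<in> carrier_mat k d"
      using submatrix_carrier(2)[OF C subset_refl, of W] submatrix_carrier(3)[OF R _ subset_refl, of S]
        SW(1,2) by (auto simp: ksubsets_def)
    then show ?thesis using N(2) by (intro minus_carrier_mat mult_carrier_mat)
  qed
  have "(spectral_norm ?E)\<^sup>2 \<le> - r"
  proof (rule spectral_norm_le[OF E d])
    fix t v assume v: "v \<in> carrier_vec d" "v \<noteq> 0\<^sub>v d" "transpose_mat ?E *\<^sub>v (?E *\<^sub>v v) = t \<cdot>\<^sub>v v"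
    have "poly ?f (- t) = 0" by (rule cur_poly_root_of_eigenvalue[OF SW(1,2) N(2-4) v])
    then show "t \<le> - r" using rootle[of "- t"] by simp
  qed
  also have "- r = maxroot (pcompose ?P [:0, -1:])"
    unfolding r_def by (rule maxroot_reflect[OF P0 rootP, symmetric])
  finally have "(spectral_norm (A - submatrix C UNIV W * the (mat_inverse (submatrix U S W))
      * submatrix R S UNIV))\<^sup>2 \<le> maxroot (pcompose ?P [:0, -1:])"
    by (simp only: N(1) option.sel)
  then show ?thesis using rrP SW(1,2) inv f(2) min by blast
qed
end

theorem theorem1p1:
  fixes A C U R :: "real mat" and n d n\<^sub>R d\<^sub>C k :: nat
  assumes "A \<in> carrier_mat n d"
    and "C \<in> carrier_mat n d\<^sub>C"
    and "U \<in> carrier_mat n\<^sub>R d\<^sub>C"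
    and "R \<in> carrier_mat n\<^sub>R d"
    and "0 < d"
    and "1 \<le> k" and "k \<le> vec_space.rank n\<^sub>R U"
  shows "real_rooted (cur_sum_poly k A C U R) \<and>
    (\<exists>S\<in>ksubsets n\<^sub>R k. \<exists>W\<in>ksubsets d\<^sub>C k.
       invertible_mat (submatrix U S W) \<and>
       real_rooted (cur_poly S W A C U R) \<and>
       minroot (cur_poly S W A C U R) \<ge> minroot (cur_sum_poly k A C U R) \<and>
       (spectral_norm (A - submatrix C UNIV W * the (mat_inverse (submatrix U S W))
                             * submatrix R S UNIV))\<^sup>2
         \<le> maxroot (pcompose (cur_sum_poly k A C U R) [:0, -1:]))"
proof -
  interpret cur_data A C U R n d n\<^sub>R d\<^sub>C k
    by unfold_locales (rule assms)+
  show ?thesis by (rule exists_good_submatrices[OF assms(5,7)])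
qed

end
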